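(* Let $\delta=2\nu+2>0$, $s>0$ and $a>0$ be fixed, and denote $$S=\begin{cases}[0,+\infty), & \text{if } a\ge1,\\[2pt] \left[0,\dfrac{s}{(1/a)^{1/(\nu+1)}-1}\right], & \text{if } 0<a<1.\end{cases}$$ For $t\in S$ define $$\psi_a(t)=\sqrt{\frac{2t(t+s)}{s}\left[(\nu+1)\log\left(1+\frac st\right)+\log a\right]}$$ (with $\psi_a(0)=0$ by continuity), and let $\tau_\psi=\inf\{t>0:\ Z^{\delta,0}_t\ge\psi_a(t)\}$. Then the density of the hitting time $\tau_\psi$ is given by $$\mathbb{P}_0(\tau_\psi\in\mathrm{d}t)=\frac{1}{\Gamma(\nu+1)}\,\frac1t\left(\frac{t+s}{s}\right)^{\nu}\left[\log\left(a\left(\frac{t+s}{t}\right)^{\nu+1}\right)\right]^{\nu+1}\exp\left[-\frac{t+s}{s}\log\left(a\left(\frac{t+s}{t}\right)^{\nu+1}\right)\right]\mathbf{1}_S(t)\,\mathrm{d}t.$$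
   Context: $Z^{\delta,0}$ is the $\delta$-dimensional Bessel process started at $0$, $\delta=2\nu+2>0$ (index $\nu=\delta/2-1$), i.e. the nonnegative square root of the squared Bessel process $Y$ solving $\mathrm{d}Y_t=\delta\,\mathrm{d}t+2\sqrt{|Y_t|}\,\mathrm{d}B_t$, $Y_0=0$ (for $\delta>1$ it solves $Z_t=\frac{\delta-1}{2}\int_0^tZ_s^{-1}\mathrm{d}s+B_t$). $\mathbb{P}_0$ denotes its law. The formula describes the law of $\tau_\psi$ on finite times ($\inf\emptyset=+\infty$). *)

theory Defs
  imports "HOL-Probability.Probability" "HOL-Analysis.Gamma_Function"
begin

text \<open>
  Processes are functions \<open>real \<Rightarrow> 'a \<Rightarrow> real\<close>, of which only the restriction to times \<open>t \<ge> 0\<close>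
  matters. Continuous processes have all their paths continuous; identities between processes
  hold almost surely, simultaneously for all times. Filtrations are not assumed to satisfy the
  usual conditions. Since the library's \<^locale>\<open>filtration\<close> is indexed by a whole type, \<open>F t\<close> is also
  given for \<open>t < 0\<close>, but it is never used there.
\<close>

definition filtration_on :: "'a measure \<Rightarrow> (real \<Rightarrow> 'a measure) \<Rightarrow> bool" where
  "filtration_on M F \<longleftrightarrow> filtration (space M) F \<and> (\<forall>t. subalgebra M (F t))"

definition continuous_paths :: "'a measure \<Rightarrow> (real \<Rightarrow> 'a \<Rightarrow> real) \<Rightarrow> bool" where
  "continuous_paths M X \<longleftrightarrow> (\<forall>\<omega>\<in>space M. continuous_on {0..} (\<lambda>t. X t \<omega>))"

definition adapted :: "(real \<Rightarrow> 'a measure) \<Rightarrow> (real \<Rightarrow> 'a \<Rightarrow> real) \<Rightarrow> bool" where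
  "adapted F X \<longleftrightarrow> (\<forall>t\<ge>0. X t \<in> borel_measurable (F t))"

definition progressively_measurable :: "(real \<Rightarrow> 'a measure) \<Rightarrow> (real \<Rightarrow> 'a \<Rightarrow> real) \<Rightarrow> bool" where
  "progressively_measurable F X \<longleftrightarrow>
     (\<forall>T\<ge>0. (\<lambda>(t, \<omega>). X t \<omega>) \<in> borel_measurable (restrict_space borel {0..T} \<Otimes>\<^sub>M F T))"

definition brownian_motion ::
    "'a measure \<Rightarrow> (real \<Rightarrow> 'a measure) \<Rightarrow> (real \<Rightarrow> 'a \<Rightarrow> real) \<Rightarrow> bool" where
  "brownian_motion M F B \<longleftrightarrow>
     adapted F B \<and> continuous_paths M B \<and> (AE \<omega> in M. B 0 \<omega> = 0) \<and>
     (\<forall>s t. 0 \<le> s \<and> s < t \<longrightarrow>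
        distributed M lborel (\<lambda>\<omega>. B t \<omega> - B s \<omega>) (normal_density 0 (sqrt (t - s))) \<and>
        prob_space.indep_set M (sets (F s))
          (sets (vimage_algebra (space M) (\<lambda>\<omega>. B t \<omega> - B s \<omega>) borel)))"


subsection \<open>The It\^o integral\<close>

text \<open>
  A simple integrand is encoded by a number \<open>n\<close> of steps, the grid \<open>p 0 \<le> \<dots> \<le> p n\<close> and the
  bounded \<open>F (p i)\<close>-measurable value \<open>\<xi> i\<close> taken on \<open>(p i, p (i + 1)]\<close>.
\<close>

definition simple_integrand ::
    "'a measure \<Rightarrow> (real \<Rightarrow> 'a measure) \<Rightarrow> nat \<Rightarrow> (nat \<Rightarrow> real) \<Rightarrow> (nat \<Rightarrow> 'a \<Rightarrow> real) \<Rightarrow> bool" where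
  "simple_integrand M F n p \<xi> \<longleftrightarrow>
     0 \<le> p 0 \<and> (\<forall>i<n. p i \<le> p (Suc i)) \<and>
     (\<forall>i<n. \<xi> i \<in> borel_measurable (F (p i))) \<and>
     (\<exists>C. \<forall>i<n. \<forall>\<omega>\<in>space M. \<bar>\<xi> i \<omega>\<bar> \<le> C)"

definition simple_process ::
    "nat \<Rightarrow> (nat \<Rightarrow> real) \<Rightarrow> (nat \<Rightarrow> 'a \<Rightarrow> real) \<Rightarrow> real \<Rightarrow> 'a \<Rightarrow> real" where
  "simple_process n p \<xi> t \<omega> = (\<Sum>i<n. \<xi> i \<omega> * indicator {p i<..p (Suc i)} t)"

definition simple_integral ::
    "(real \<Rightarrow> 'a \<Rightarrow> real) \<Rightarrow> nat \<Rightarrow> (nat \<Rightarrow> real) \<Rightarrow> (nat \<Rightarrow> 'a \<Rightarrow> real) \<Rightarrow> real \<Rightarrow> 'a \<Rightarrow> real" where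
  "simple_integral B n p \<xi> t \<omega> =
     (\<Sum>i<n. \<xi> i \<omega> * (B (min t (p (Suc i))) \<omega> - B (min t (p i)) \<omega>))"

text \<open>
  \<open>I\<close> is a continuous version of \<open>\<integral> H dB\<close>: the limit, in probability and locally uniformly in
  time, of the integrals of simple integrands \<open>H\<^sub>k\<close> with \<open>\<integral>\<^sub>0\<^sup>T (H\<^sub>k - H)\<^sup>2 ds \<rightarrow> 0\<close> in probability
  for all \<open>T\<close>. By It\^o's isometry and localization \<open>I\<close> does not depend on the approximation,
  up to indistinguishability. The time integral is a nonnegative one because the Bochner
  integral would be \<open>0\<close> if it diverged.
\<close>

definition ito_integral ::
    "'a measure \<Rightarrow> (real \<Rightarrow> 'a measure) \<Rightarrow> (real \<Rightarrow> 'a \<Rightarrow> real) \<Rightarrow>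
       (real \<Rightarrow> 'a \<Rightarrow> real) \<Rightarrow> (real \<Rightarrow> 'a \<Rightarrow> real) \<Rightarrow> bool" where
  "ito_integral M F B H I \<longleftrightarrow>
     progressively_measurable F H \<and> adapted (\<lambda>_. M) I \<and> continuous_paths M I \<and>
     (\<exists>n p \<xi>. (\<forall>k. simple_integrand M F (n k) (p k) (\<xi> k)) \<and>
        (\<forall>T\<ge>0. \<forall>\<epsilon>>0.
           (\<lambda>k. measure M {\<omega>\<in>space M.
              (\<integral>\<^sup>+s\<in>{0..T}. ennreal ((simple_process (n k) (p k) (\<xi> k) s \<omega> - H s \<omega>)\<^sup>2) \<partial>lborel)
                > ennreal \<epsilon>}) \<longlonglongrightarrow> 0 \<and>
           (\<lambda>k. measure M {\<omega>\<in>space M.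
              \<exists>t\<in>{0..T}. \<bar>simple_integral B (n k) (p k) (\<xi> k) t \<omega> - I t \<omega>\<bar> > \<epsilon>}) \<longlonglongrightarrow> 0))"


subsection \<open>Bessel processes\<close>

definition squared_bessel_process ::
    "'a measure \<Rightarrow> (real \<Rightarrow> 'a measure) \<Rightarrow> (real \<Rightarrow> 'a \<Rightarrow> real) \<Rightarrow> real \<Rightarrow> real \<Rightarrow>
       (real \<Rightarrow> 'a \<Rightarrow> real) \<Rightarrow> bool" where
  "squared_bessel_process M F B \<delta> y Y \<longleftrightarrow>
     adapted F Y \<and> continuous_paths M Y \<and> (AE \<omega> in M. Y 0 \<omega> = y) \<and>
     (\<exists>I. ito_integral M F B (\<lambda>t \<omega>. 2 * sqrt \<bar>Y t \<omega>\<bar>) I \<and>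
          (AE \<omega> in M. \<forall>t\<ge>0. Y t \<omega> = Y 0 \<omega> + \<delta> * t + I t \<omega>))"

definition bessel_process ::
    "'a measure \<Rightarrow> real \<Rightarrow> real \<Rightarrow> (real \<Rightarrow> 'a \<Rightarrow> real) \<Rightarrow> bool" where
  "bessel_process M \<delta> z Z \<longleftrightarrow>
     adapted (\<lambda>_. M) Z \<and> continuous_paths M Z \<and>
     (\<exists>F B Y. filtration_on M F \<and> brownian_motion M F B \<and>
        squared_bessel_process M F B \<delta> (z\<^sup>2) Y \<and>
        (AE \<omega> in M. \<forall>t\<ge>0. 0 \<le> Z t \<omega> \<and> (Z t \<omega>)\<^sup>2 = Y t \<omega>))"


subsection \<open>The boundary and its hitting time\<close>

definition psi_domain :: "real \<Rightarrow> real \<Rightarrow> real \<Rightarrow> real set" where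
  "psi_domain \<nu> s a =
     (if a \<ge> 1 then {0..} else {0 .. s / ((1 / a) powr (1 / (\<nu> + 1)) - 1)})"

definition psi :: "real \<Rightarrow> real \<Rightarrow> real \<Rightarrow> real \<Rightarrow> real" where
  "psi \<nu> s a t =
     (if t = 0 then 0
      else sqrt (2 * t * (t + s) / s * ((\<nu> + 1) * ln (1 + s / t) + ln a)))"

text \<open>
  As \<open>\<psi>\<^sub>a\<close> is only defined on \<open>S\<close>, the infimum is over times in \<open>S\<close>; it is \<open>\<infinity>\<close> if there are none.
\<close>

definition hitting_time ::
    "real set \<Rightarrow> (real \<Rightarrow> real) \<Rightarrow> (real \<Rightarrow> 'a \<Rightarrow> real) \<Rightarrow> 'a \<Rightarrow> ereal" where
  "hitting_time S f Z \<omega> = Inf (ereal ` {t\<in>S. t > 0 \<and> Z t \<omega> \<ge> f t})"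

definition hitting_density :: "real \<Rightarrow> real \<Rightarrow> real \<Rightarrow> real \<Rightarrow> real" where
  "hitting_density \<nu> s a t =
     1 / Gamma (\<nu> + 1) * (1 / t) * ((t + s) / s) powr \<nu> *
     ln (a * ((t + s) / t) powr (\<nu> + 1)) powr (\<nu> + 1) *
     exp (- ((t + s) / s) * ln (a * ((t + s) / t) powr (\<nu> + 1))) *
     indicator (psi_domain \<nu> s a) t"

end

theory Submission
  imports Defs "HOL-Real_Asymp.Real_Asymp"
begin

text \<open>
  Write \<open>Y = Z\<^sup>2\<close> and \<open>R(t, y) = (t / (t + s)) powr (\<nu> + 1) * exp (y s / (2 t (t + s)))\<close>, the quotient
  of the densities of \<open>Y\<^sub>t\<^sub>+\<^sub>s\<close> and \<open>Y\<^sub>t\<close>. Then \<open>Z\<^sub>t \<ge> \<psi>\<^sub>a(t)\<close> means \<open>R(t, Y\<^sub>t) \<ge> a\<close>: this is the method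
  of images, with the law of \<open>Y\<^sub>s\<close> as image measure. By the Markov property, weighting by \<open>R(t, Y\<^sub>t)\<close>
  turns the law of \<open>(Y\<^sub>u)\<close>, \<open>u \<ge> t\<close>, into that of \<open>(Y\<^sub>u\<^sub>+\<^sub>s)\<close>, \<open>u \<ge> t\<close>, so \<open>R(t, Y\<^sub>t)\<close> is a martingale in
  reversed time. Decompose the event that \<open>R(u, Y\<^sub>u)\<close> exceeds \<open>a\<close> before \<open>t\<close> but not at \<open>t\<close> according to
  the last such \<open>u\<close>, where \<open>R = a\<close> by continuity: its probability is \<open>1 / a\<close> times that of the
  same event for \<open>R(u, Y\<^sub>u\<^sub>+\<^sub>s)\<close>, which tends to infinity as \<open>u \<rightarrow> 0\<close> since \<open>Y\<^sub>s > 0\<close>. Hence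
  \<open>P(\<tau> \<le> t) = P(R(t, Y\<^sub>t) \<ge> a) + P(R(t, Y\<^sub>t\<^sub>+\<^sub>s) < a) / a\<close>. Both terms are incomplete gamma integrals, and
  their derivatives combine to the density.

  The Markov property comes from the stochastic differential equation without It\^o's formula. For
  constant \<open>\<theta>\<close> the process \<open>exp (- \<theta> Y\<^sub>t - 2 \<theta>\<^sup>2 \<integral>Y + \<theta> \<delta> t)\<close> is a martingale, as a limit of exponential
  martingales of simple integrands. Therefore \<open>\<phi>(\<theta>, t) = E[1\<^sub>A exp (- \<theta> Y\<^sub>t)]\<close> solves
  \<open>\<partial>\<^sub>t \<phi> = - \<theta> \<delta> \<phi> - 2 \<theta>\<^sup>2 \<partial>\<^sub>\<theta> \<phi>\<close>, and the method of characteristics gives the Laplace transform of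
  the transition kernel.
\<close>

subsection \<open>Exponential martingales of simple integrands\<close>

text \<open>The transition densities of \<open>Y\<close> involve Bessel functions and never appear.
  Laplace transforms suffice, because the kernel sends \<open>exp (- l * y)\<close> to a multiple of
  another \<open>exp (- \<theta> * y)\<close>: joint laws at finitely many times can be compared one
  factor at a time. The formula for R is a quotient of gamma densities: \<open>Y t / (2 * t)\<close>
  has the gamma law of shape \<delta> / 2, and the powers of y cancel. One obstacle is that the Ito
  integral is given only as a limit in probability, which says nothing about expectations of
  exponentials. Cutting off the quadratic variation at a level K yields an L2 bound for the
  approximations, while \<theta> >= 0 and Y >= 0 bound the limit. Another is that the change of
  measure is available on finite grids only, and a grid sees neither a path that merely touches the
  boundary nor times close to 0. Levels and starting times are relaxed first and restored after the
  mesh has tended to 0. Reversed time enters only through the choice of the last grid index: what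
  follows it is a forward event, to which the Markov property applies.\<close>

lemma nn_integral_gaussian_exp:
  assumes "\<sigma> > 0"
  shows "(\<integral>\<^sup>+x. ennreal (exp (c * x - c\<^sup>2 * \<sigma>\<^sup>2 / 2)) \<partial>density lborel (normal_density 0 \<sigma>)) = 1"
proof -
  \<comment> \<open>Completing the square: the exponential weight shifts the mean from 0 to
    \<open>c * \<sigma>\<^sup>2\<close>.\<close>
  have eq: "normal_density 0 \<sigma> x * exp (c * x - c\<^sup>2 * \<sigma>\<^sup>2 / 2) = normal_density (c * \<sigma>\<^sup>2) \<sigma> x" for x
  proof -
    have "- (x - 0)\<^sup>2 / (2 * \<sigma>\<^sup>2) + (c * x - c\<^sup>2 * \<sigma>\<^sup>2 / 2) = - (x - c * \<sigma>\<^sup>2)\<^sup>2 / (2 * \<sigma>\<^sup>2)"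
      using assms by (simp add: field_simps power2_eq_square)
    then show ?thesis
      by (simp add: normal_density_def flip: exp_add)
  qed
  have "(\<integral>\<^sup>+x. ennreal (exp (c * x - c\<^sup>2 * \<sigma>\<^sup>2 / 2)) \<partial>density lborel (normal_density 0 \<sigma>))
      = (\<integral>\<^sup>+x. ennreal (normal_density (c * \<sigma>\<^sup>2) \<sigma> x) \<partial>lborel)"
    by (subst nn_integral_density) (auto simp: eq simp flip: ennreal_mult)
  also have "\<dots> = 1"
    using prob_space.emeasure_space_1[OF prob_space_normal_density[OF assms, of "c * \<sigma>\<^sup>2"]]
    by (simp add: emeasure_density)
  finally show ?thesis .
qed

text \<open>Independence makes the joint law of \<open>X\<close> and the identity, viewed as a map
  into \<open>G\<close>, a product. Fubini then freezes \<open>\<xi>\<close> and \<open>W\<close>,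
  and the Gaussian integral applies for each frozen value. Random coefficients known to
  \<open>G\<close> are what adapted integrands produce.\<close>

lemma (in prob_space) nn_integral_exp_gaussian_indep:
  assumes G: "subalgebra M G" and \<sigma>: "\<sigma> > 0"
    and X: "distributed M lborel X (normal_density 0 \<sigma>)"
    and indep: "indep_set (sets G) (sets (vimage_algebra (space M) X borel))"
    and W: "W \<in> borel_measurable G" and \<xi>: "\<xi> \<in> borel_measurable G"
  shows "(\<integral>\<^sup>+\<omega>. W \<omega> * ennreal (exp (\<xi> \<omega> * X \<omega> - (\<xi> \<omega>)\<^sup>2 * \<sigma>\<^sup>2 / 2)) \<partial>M) = (\<integral>\<^sup>+\<omega>. W \<omega> \<partial>M)"
proof -
  have X_meas[measurable]: "X \<in> borel_measurable M"
    using distributed_measurable[OF X] by simp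
  have id_meas[measurable]: "(\<lambda>\<omega>. \<omega>) \<in> measurable M G"
    using measurable_from_subalg[OF G measurable_ident[of G, unfolded id_def]] by simp
  note [measurable] = W \<xi>
  have spG: "space G = space M" using G by (simp add: subalgebra_def)
  interpret D1: prob_space "distr M G (\<lambda>\<omega>. \<omega>)" by (rule prob_space_distr) simp
  interpret D2: prob_space "distr M borel X" by (rule prob_space_distr) simp
  have D: "distr M G (\<lambda>\<omega>. \<omega>) \<Otimes>\<^sub>M distr M borel X = distr M (G \<Otimes>\<^sub>M borel) (\<lambda>\<omega>. (\<omega>, X \<omega>))"
  proof (rule pair_measure_eqI)
    fix A C assume A: "A \<in> sets (distr M G (\<lambda>\<omega>. \<omega>))" and C: "C \<in> sets (distr M borel X)"
    then have AG: "A \<in> sets G" and [measurable]: "C \<in> sets borel" by auto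
    have AM[measurable]: "A \<in> sets M" and As: "A \<subseteq> space M"
      using G sets.sets_into_space[OF AG] spG AG by (auto simp: subalgebra_def)
    have "X -` C \<inter> space M \<in> sets (vimage_algebra (space M) X borel)"
      by (intro in_vimage_algebra) simp
    from indep_setD[OF indep AG this]
    have "prob (A \<inter> (X -` C \<inter> space M)) = prob A * prob (X -` C \<inter> space M)" .
    moreover have "(\<lambda>\<omega>. (\<omega>, X \<omega>)) -` (A \<times> C) \<inter> space M = A \<inter> (X -` C \<inter> space M)"
      using As by auto
    moreover have "A \<inter> space M = A" using As by auto
    ultimately show "emeasure (distr M G (\<lambda>\<omega>. \<omega>)) A * emeasure (distr M borel X) C
       = emeasure (distr M (G \<Otimes>\<^sub>M borel) (\<lambda>\<omega>. (\<omega>, X \<omega>))) (A \<times> C)"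
      using AG by (simp add: emeasure_distr emeasure_eq_measure flip: ennreal_mult)
  qed (auto intro: D1.sigma_finite_measure_axioms D2.sigma_finite_measure_axioms)
  have DX: "distr M borel X = density lborel (normal_density 0 \<sigma>)"
    using distributed_distr_eq_density[OF X] by (simp cong: distr_cong)
  have "(\<integral>\<^sup>+\<omega>. W \<omega> * ennreal (exp (\<xi> \<omega> * X \<omega> - (\<xi> \<omega>)\<^sup>2 * \<sigma>\<^sup>2 / 2)) \<partial>M) =
     (\<integral>\<^sup>+p. W (fst p) * ennreal (exp (\<xi> (fst p) * snd p - (\<xi> (fst p))\<^sup>2 * \<sigma>\<^sup>2 / 2))
        \<partial>distr M (G \<Otimes>\<^sub>M borel) (\<lambda>\<omega>. (\<omega>, X \<omega>)))"
    by (subst nn_integral_distr) auto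
  also have "\<dots> = (\<integral>\<^sup>+\<omega>. \<integral>\<^sup>+x. W \<omega> * ennreal (exp (\<xi> \<omega> * x - (\<xi> \<omega>)\<^sup>2 * \<sigma>\<^sup>2 / 2))
      \<partial>distr M borel X \<partial>distr M G (\<lambda>\<omega>. \<omega>))"
    unfolding D[symmetric]
    by (subst D2.nn_integral_fst[symmetric]) auto
  also have "\<dots> = (\<integral>\<^sup>+\<omega>. W \<omega> * (\<integral>\<^sup>+x. ennreal (exp (\<xi> \<omega> * x - (\<xi> \<omega>)\<^sup>2 * \<sigma>\<^sup>2 / 2)) \<partial>distr M borel X)
      \<partial>distr M G (\<lambda>\<omega>. \<omega>))"
    by (intro nn_integral_cong nn_integral_cmult) auto
  also have "\<dots> = (\<integral>\<^sup>+\<omega>. W \<omega> \<partial>distr M G (\<lambda>\<omega>. \<omega>))"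
    unfolding DX nn_integral_gaussian_exp[OF \<sigma>] by simp
  also have "\<dots> = (\<integral>\<^sup>+\<omega>. W \<omega> \<partial>M)"
    by (subst nn_integral_distr) auto
  finally show ?thesis .
qed

text \<open>Equality of conditional expectations given \<open>G\<close>, phrased for nonnegative
  functions so that infinite values are allowed. Both densities are pushed forward to
  \<open>G\<close>, where agreement on sets is equality of measures.\<close>

lemma (in prob_space) nn_integral_eq_subalgebraI:
  assumes G: "subalgebra M G"
    and f[measurable]: "f \<in> borel_measurable M" and g[measurable]: "g \<in> borel_measurable M"
    and eq: "\<And>A. A \<in> sets G \<Longrightarrow> (\<integral>\<^sup>+\<omega>. indicator A \<omega> * f \<omega> \<partial>M) = (\<integral>\<^sup>+\<omega>. indicator A \<omega> * g \<omega> \<partial>M)"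
    and h: "h \<in> borel_measurable G"
  shows "(\<integral>\<^sup>+\<omega>. h \<omega> * f \<omega> \<partial>M) = (\<integral>\<^sup>+\<omega>. h \<omega> * g \<omega> \<partial>M)"
proof -
  have id_meas[measurable]: "(\<lambda>\<omega>. \<omega>) \<in> measurable M G"
    using measurable_from_subalg[OF G measurable_ident[of G, unfolded id_def]] by simp
  have spG: "space G = space M" using G by (simp add: subalgebra_def)
  note [measurable] = h
  have *: "(\<integral>\<^sup>+\<omega>. h \<omega> * k \<omega> \<partial>M) = (\<integral>\<^sup>+\<omega>. h \<omega> \<partial>distr (density M k) G (\<lambda>\<omega>. \<omega>))"
    if [measurable]: "k \<in> borel_measurable M" for k
    by (subst nn_integral_distr, simp, simp, subst nn_integral_density) (auto simp: mult.commute)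
  have "distr (density M f) G (\<lambda>\<omega>. \<omega>) = distr (density M g) G (\<lambda>\<omega>. \<omega>)"
  proof (rule measure_eqI)
    fix A assume "A \<in> sets (distr (density M f) G (\<lambda>\<omega>. \<omega>))"
    then have A: "A \<in> sets G" by simp
    then have AM: "A \<in> sets M" "A \<inter> space M = A"
      using G sets.sets_into_space[OF A] spG by (auto simp: subalgebra_def)
    have e: "emeasure (distr (density M k) G (\<lambda>\<omega>. \<omega>)) A = (\<integral>\<^sup>+\<omega>. indicator A \<omega> * k \<omega> \<partial>M)"
      if [measurable]: "k \<in> borel_measurable M" for k
      using A AM by (subst emeasure_distr) (auto simp: emeasure_density vimage_def mult.commute)
    show "emeasure (distr (density M f) G (\<lambda>\<omega>. \<omega>)) A = emeasure (distr (density M g) G (\<lambda>\<omega>. \<omega>)) A"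
      using eq[OF A] by (simp add: e)
  qed simp
  then show ?thesis by (simp add: *)
qed

locale brownian_setting = prob_space M for M :: "'a measure" +
  fixes F :: "real \<Rightarrow> 'a measure" and B :: "real \<Rightarrow> 'a \<Rightarrow> real"
  assumes filt: "filtration_on M F" and bm: "brownian_motion M F B"
begin

lemma subalg: "subalgebra M (F t)"
  using filt by (simp add: filtration_on_def)

lemma F_measurable_mono: "f \<in> measurable (F s) N \<Longrightarrow> s \<le> t \<Longrightarrow> f \<in> measurable (F t) N"
proof -
  assume f: "f \<in> measurable (F s) N" and "s \<le> t"
  have "filtration (space M) F" using filt by (simp add: filtration_on_def)
  from filtration.sets_F_mono[OF this \<open>s \<le> t\<close>] filtration.space_F[OF this]
  have "subalgebra (F t) (F s)" by (simp add: subalgebra_def)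
  from measurable_from_subalg[OF this f] show ?thesis .
qed

lemma F_measurable_M: "f \<in> measurable (F s) N \<Longrightarrow> f \<in> measurable M N"
  by (rule measurable_from_subalg[OF subalg])

lemma F_sets_M: "A \<in> sets (F s) \<Longrightarrow> A \<in> sets M"
  using subalg[of s] by (auto simp: subalgebra_def)

lemma space_F: "space (F t) = space M"
  using subalg[of t] by (simp add: subalgebra_def)

lemma B_measurable: "0 \<le> t \<Longrightarrow> B t \<in> borel_measurable (F t)"
  using bm by (simp add: brownian_motion_def adapted_def)

lemma nn_integral_exp_increment:
  assumes "0 \<le> s" "s \<le> t" and W: "W \<in> borel_measurable (F s)" and \<xi>: "\<xi> \<in> borel_measurable (F s)"
  shows "(\<integral>\<^sup>+\<omega>. W \<omega> * ennreal (exp (\<xi> \<omega> * (B t \<omega> - B s \<omega>) - (\<xi> \<omega>)\<^sup>2 * (t - s) / 2)) \<partial>M) = (\<integral>\<^sup>+\<omega>. W \<omega> \<partial>M)"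
\<comment> \<open>\<open>brownian_motion\<close> speaks of increments with \<open>s < t\<close>
  only, whereas neighbouring grid points may coincide.\<close>
proof (cases "s = t")
  case False
  then have "s < t" using assms by simp
  then have d: "distributed M lborel (\<lambda>\<omega>. B t \<omega> - B s \<omega>) (normal_density 0 (sqrt (t - s)))"
    and i: "indep_set (sets (F s)) (sets (vimage_algebra (space M) (\<lambda>\<omega>. B t \<omega> - B s \<omega>) borel))"
    using bm assms by (auto simp: brownian_motion_def)
  show ?thesis
    using nn_integral_exp_gaussian_indep[OF subalg _ d i W \<xi>] \<open>s < t\<close> by simp
qed simp

lemma exponential_simple_measurable:
  assumes "0 \<le> q 0" "\<And>i. i < n \<Longrightarrow> q i \<le> q (Suc i)"
    and \<xi>: "\<And>i. i < n \<Longrightarrow> \<xi> i \<in> borel_measurable (F (q i))"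
  shows "(\<lambda>\<omega>. \<Sum>i<n. \<xi> i \<omega> * (B (q (Suc i)) \<omega> - B (q i) \<omega>) - (\<xi> i \<omega>)\<^sup>2 * (q (Suc i) - q i) / 2)
    \<in> borel_measurable (F (q n))"
proof -
  have mono: "i \<le> j \<Longrightarrow> j \<le> n \<Longrightarrow> q i \<le> q j" for i j
    by (induction j rule: dec_induct) (auto intro: order_trans[OF _ assms(2)])
  have q0: "i \<le> n \<Longrightarrow> 0 \<le> q i" for i using mono[of 0 i] assms(1) by simp
  show ?thesis
  proof (rule borel_measurable_sum)
    fix i assume "i \<in> {..<n}"
    then have [measurable]: "\<xi> i \<in> borel_measurable (F (q n))" "B (q i) \<in> borel_measurable (F (q n))"
      "B (q (Suc i)) \<in> borel_measurable (F (q n))"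
      using mono[of i n] mono[of "Suc i" n] q0
      by (auto intro!: F_measurable_mono[OF \<xi>] F_measurable_mono[OF B_measurable])
    show "(\<lambda>\<omega>. \<xi> i \<omega> * (B (q (Suc i)) \<omega> - B (q i) \<omega>) - (\<xi> i \<omega>)\<^sup>2 * (q (Suc i) - q i) / 2)
      \<in> borel_measurable (F (q n))" by measurable
  qed
qed

text \<open>The induction peels off the last increment: \<Phi> and the earlier factors are
  \<open>F (q n)\<close>-measurable and go into the weight \<open>W\<close> of
  \<open>nn_integral_exp_increment\<close>.\<close>

lemma nn_integral_exponential_simple:
  assumes "0 \<le> u" "u \<le> q 0" "\<And>i. i < n \<Longrightarrow> q i \<le> q (Suc i)"
    and \<xi>: "\<And>i. i < n \<Longrightarrow> \<xi> i \<in> borel_measurable (F (q i))"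
    and \<Phi>: "\<Phi> \<in> borel_measurable (F u)"
  shows "(\<integral>\<^sup>+\<omega>. \<Phi> \<omega> * ennreal (exp (\<Sum>i<n. \<xi> i \<omega> * (B (q (Suc i)) \<omega> - B (q i) \<omega>)
      - (\<xi> i \<omega>)\<^sup>2 * (q (Suc i) - q i) / 2)) \<partial>M) = (\<integral>\<^sup>+\<omega>. \<Phi> \<omega> \<partial>M)"
  using assms(3,4)
proof (induction n)
  case (Suc n)
  have mono: "i \<le> j \<Longrightarrow> j \<le> n \<Longrightarrow> q i \<le> q j" for i j
    by (induction j rule: dec_induct) (auto intro: order_trans[OF _ Suc.prems(1)])
  have qn: "u \<le> q n" using mono[of 0 n] assms by simp
  let ?S = "\<lambda>\<omega>. \<Sum>i<n. \<xi> i \<omega> * (B (q (Suc i)) \<omega> - B (q i) \<omega>) - (\<xi> i \<omega>)\<^sup>2 * (q (Suc i) - q i) / 2"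
  have [measurable]: "?S \<in> borel_measurable (F (q n))"
    using Suc.prems assms by (intro exponential_simple_measurable) auto
  have [measurable]: "\<Phi> \<in> borel_measurable (F (q n))"
    by (rule F_measurable_mono[OF \<Phi> qn])
  have "(\<integral>\<^sup>+\<omega>. (\<Phi> \<omega> * ennreal (exp (?S \<omega>))) *
      ennreal (exp (\<xi> n \<omega> * (B (q (Suc n)) \<omega> - B (q n) \<omega>) - (\<xi> n \<omega>)\<^sup>2 * (q (Suc n) - q n) / 2)) \<partial>M)
     = (\<integral>\<^sup>+\<omega>. \<Phi> \<omega> * ennreal (exp (?S \<omega>)) \<partial>M)"
    using Suc.prems assms qn by (intro nn_integral_exp_increment) auto
  also have "\<dots> = (\<integral>\<^sup>+\<omega>. \<Phi> \<omega> \<partial>M)"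
    using Suc by auto
  finally show ?case
    by (simp add: exp_add ennreal_mult mult.assoc)
qed simp

end

text \<open>Running sums of nonnegative terms increase, so the indices that survive the truncation
  form an initial segment. A general \<open>g\<close> is allowed because both the squares and the
  full exponents have to be summed over it.\<close>

lemma sum_truncated_grid:
  fixes x d :: "nat \<Rightarrow> real" and g :: "nat \<Rightarrow> real \<Rightarrow> real" and K :: real
  assumes K: "0 \<le> K" and d: "\<And>i. i < n \<Longrightarrow> 0 \<le> d i" and g: "\<And>i. g i 0 = 0"
  shows "\<exists>m\<le>n. (\<Sum>j<m. (x j)\<^sup>2 * d j) \<le> K \<and>
    (\<Sum>i<n. g i (if (\<Sum>j\<le>i. (x j)\<^sup>2 * d j) \<le> K then x i else 0)) = (\<Sum>i<m. g i (x i)) \<and>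
    ((\<Sum>j<n. (x j)\<^sup>2 * d j) \<le> K \<longrightarrow> m = n)"
  using d
proof (induction n)
  case 0
  then show ?case using K by auto
next
  case (Suc n)
  then obtain m where m: "m \<le> n" "(\<Sum>j<m. (x j)\<^sup>2 * d j) \<le> K"
    "(\<Sum>i<n. g i (if (\<Sum>j\<le>i. (x j)\<^sup>2 * d j) \<le> K then x i else 0)) = (\<Sum>i<m. g i (x i))"
    "(\<Sum>j<n. (x j)\<^sup>2 * d j) \<le> K \<longrightarrow> m = n" by auto
  show ?case
  proof (cases "(\<Sum>j\<le>n. (x j)\<^sup>2 * d j) \<le> K")
    case True
    have "(\<Sum>j<n. (x j)\<^sup>2 * d j) \<le> (\<Sum>j\<le>n. (x j)\<^sup>2 * d j)"
      using Suc.prems by (intro sum_mono2) auto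
    with True m have "m = n" by simp
    with m True show ?thesis by (intro exI[of _ "Suc n"]) (auto simp: lessThan_Suc_atMost[symmetric])
  next
    case False
    with m show ?thesis
      by (intro exI[of _ m]) (auto simp: lessThan_Suc_atMost[symmetric] g)
  qed
qed

text \<open>Young's inequality with a free weight, the difference of the two sides being a square
  over \<eta>. Quadratic variations sit in an exponent, so they must be compared with a factor that
  can be brought close to 1.\<close>

lemma square_le_weighted:
  fixes x y \<eta> :: real assumes "\<eta> > 0"
  shows "x\<^sup>2 \<le> (1 + \<eta>) * y\<^sup>2 + (1 + 1 / \<eta>) * (y - x)\<^sup>2"
proof -
  have "(1 + \<eta>) * y\<^sup>2 + (1 + 1 / \<eta>) * (y - x)\<^sup>2 - x\<^sup>2 = (\<eta> * y + (y - x))\<^sup>2 / \<eta>"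
    using assms by (simp add: field_simps power2_eq_square)
  also have "\<dots> \<ge> 0" using assms by simp
  finally show ?thesis by simp
qed

text \<open>The threshold \<open>\<eta>\<^sup>2 / (1 + \<eta>)\<close> is chosen so that
  multiplication by \<open>1 + 1 / \<eta>\<close> gives \<eta>. Measurability is asked of the
  restrictions to \<open>A\<close> because progressive measurability controls paths on bounded
  intervals only.\<close>

lemma nn_integral_square_le_weighted:
  fixes f g :: "real \<Rightarrow> real"
  assumes [measurable]: "(\<lambda>s. f s * indicator A s) \<in> borel_measurable lborel" 
      "(\<lambda>s. g s * indicator A s) \<in> borel_measurable lborel" 
    and "\<eta> > 0" "A \<in> sets borel"
    and e: "(\<integral>\<^sup>+s\<in>A. ennreal ((f s - g s)\<^sup>2) \<partial>lborel) \<le> ennreal (\<eta>\<^sup>2 / (1 + \<eta>))"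
  shows "(\<integral>\<^sup>+s\<in>A. ennreal ((f s)\<^sup>2) \<partial>lborel) \<le> ennreal (1 + \<eta>) * (\<integral>\<^sup>+s\<in>A. ennreal ((g s)\<^sup>2) \<partial>lborel) + ennreal \<eta>"
proof -
  note [measurable] = \<open>A \<in> sets borel\<close>
  have sqm: "(\<lambda>s. ennreal ((h s)\<^sup>2) * indicator A s) = (\<lambda>s. ennreal ((h s * indicator A s)\<^sup>2))"
    for h :: "real \<Rightarrow> real" by (auto simp: indicator_def)
  have [measurable]: "(\<lambda>s. ennreal ((g s)\<^sup>2) * indicator A s) \<in> borel_measurable lborel"
    unfolding sqm by measurable
  have eq: "(\<lambda>s. (f s - g s) * indicator A s) = (\<lambda>s. f s * indicator A s - g s * indicator A s)"
    by (auto simp: algebra_simps)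
  have [measurable]: "(\<lambda>s. (f s - g s) * indicator A s) \<in> borel_measurable lborel"
    unfolding eq by measurable
  have [measurable]: "(\<lambda>s. ennreal ((f s - g s)\<^sup>2) * indicator A s) \<in> borel_measurable lborel"
    unfolding sqm by measurable
  have "(\<integral>\<^sup>+s\<in>A. ennreal ((f s)\<^sup>2) \<partial>lborel) \<le>
    (\<integral>\<^sup>+s. ennreal (1 + \<eta>) * (ennreal ((g s)\<^sup>2) * indicator A s) +
      ennreal (1 + 1 / \<eta>) * (ennreal ((f s - g s)\<^sup>2) * indicator A s) \<partial>lborel)"
    using square_le_weighted[OF \<open>\<eta> > 0\<close>] \<open>\<eta> > 0\<close>
    by (intro nn_integral_mono)
      (auto simp: indicator_def power2_commute[of "f _"] simp flip: ennreal_mult ennreal_plus)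
  also have "\<dots> = ennreal (1 + \<eta>) * (\<integral>\<^sup>+s\<in>A. ennreal ((g s)\<^sup>2) \<partial>lborel) +
      ennreal (1 + 1 / \<eta>) * (\<integral>\<^sup>+s\<in>A. ennreal ((f s - g s)\<^sup>2) \<partial>lborel)"
    by (subst nn_integral_add) (simp_all add: nn_integral_cmult)
  also have "\<dots> \<le> ennreal (1 + \<eta>) * (\<integral>\<^sup>+s\<in>A. ennreal ((g s)\<^sup>2) \<partial>lborel) +
      ennreal (1 + 1 / \<eta>) * ennreal (\<eta>\<^sup>2 / (1 + \<eta>))"
    by (intro add_left_mono mult_left_mono e) auto
  also have "ennreal (1 + 1 / \<eta>) * ennreal (\<eta>\<^sup>2 / (1 + \<eta>)) = ennreal \<eta>"
  proof -
    have "1 + 1 / \<eta> = (1 + \<eta>) / \<eta>" using \<open>\<eta> > 0\<close> by (simp add: field_simps)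
    then have "(1 + 1 / \<eta>) * (\<eta>\<^sup>2 / (1 + \<eta>)) = \<eta>"
      using \<open>\<eta> > 0\<close> by (simp add: power2_eq_square)
    then show ?thesis using \<open>\<eta> > 0\<close> by (subst ennreal_mult[symmetric]) auto
  qed
  finally show ?thesis .
qed

lemma clip_grid_mono: "a \<le> b \<Longrightarrow> max u (min t a) \<le> max u (min t (b::real))"
  by auto

text \<open>At most one of the half-open intervals contains \<open>s\<close>, so the mixed terms
  vanish.\<close>

lemma indicator_Ioc_sum:
  fixes p :: "nat \<Rightarrow> real"
  assumes "\<And>i. i < n \<Longrightarrow> p i \<le> p (Suc i)"
  shows "(\<Sum>i<n. c i * indicator {p i<..p (Suc i)} s)\<^sup>2 = (\<Sum>i<n. (c i)\<^sup>2 * indicator {p i<..p (Suc i)} s :: real)"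
  using assms
proof (induction n)
  case (Suc n)
  have mono: "i \<le> j \<Longrightarrow> j \<le> n \<Longrightarrow> p i \<le> p j" for i j
    by (induction j rule: dec_induct) (auto intro: order_trans[OF _ Suc.prems])
  have z: "(\<Sum>i<n. c i * indicator {p i<..p (Suc i)} s) = 0" if "s \<in> {p n<..p (Suc n)}"
  proof (rule sum.neutral, safe)
    fix i assume "i < n"
    with mono[of "Suc i" n] that show "c i * indicator {p i<..p (Suc i)} s = 0" by (auto simp: indicator_def)
  qed
  have "(\<Sum>i<Suc n. c i * indicator {p i<..p (Suc i)} s)\<^sup>2 =
     (\<Sum>i<n. c i * indicator {p i<..p (Suc i)} s)\<^sup>2 + (c n)\<^sup>2 * indicator {p n<..p (Suc n)} s"
    using z by (cases "s \<in> {p n<..p (Suc n)}") (auto simp: indicator_def)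
  with Suc show ?case by simp
qed simp

text \<open>The clipped points \<open>q i\<close> cut the grid down to the interval from
  \<open>u\<close> to \<open>t\<close>; intervals outside it collapse to length 0. This is the
  quadratic variation of the simple integral from \<open>u\<close> to \<open>q m\<close>.\<close>

lemma nn_integral_simple_process_square:
  fixes p :: "nat \<Rightarrow> real"
  assumes p: "\<And>i. i < n \<Longrightarrow> p i \<le> p (Suc i)" and "u \<le> t" and m: "m \<le> n"
  defines "q \<equiv> \<lambda>i. max u (min t (p i))"
  shows "(\<integral>\<^sup>+s\<in>{u..q m}. ennreal ((simple_process n p \<xi> s \<omega>)\<^sup>2) \<partial>lborel)
    = ennreal (\<Sum>i<m. (\<xi> i \<omega>)\<^sup>2 * (q (Suc i) - q i))"
proof -
  have mono: "i \<le> j \<Longrightarrow> j \<le> n \<Longrightarrow> p i \<le> p j" for i j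
    by (induction j rule: dec_induct) (auto intro: order_trans[OF _ p])
  have qm: "i \<le> j \<Longrightarrow> j \<le> n \<Longrightarrow> q i \<le> q j" for i j
    unfolding q_def using mono[of i j] by auto
  \<comment> \<open>A grid interval may contain \<open>u\<close>, while the clipped interval is open
    there; the single point is discarded.\<close>
  have ae: "AE s in lborel. s \<noteq> u" by (rule AE_lborel_singleton)
  have "(\<integral>\<^sup>+s\<in>{u..q m}. ennreal ((simple_process n p \<xi> s \<omega>)\<^sup>2) \<partial>lborel)
    = (\<integral>\<^sup>+s. (\<Sum>i<m. ennreal ((\<xi> i \<omega>)\<^sup>2) * indicator {q i<..q (Suc i)} s) \<partial>lborel)"
  proof (rule nn_integral_cong_AE, use ae in eventually_elim)
    fix s assume s: "s \<noteq> u"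
    have "(simple_process n p \<xi> s \<omega>)\<^sup>2 * indicator {u..q m} s
       = (\<Sum>i<n. (\<xi> i \<omega>)\<^sup>2 * (indicator {p i<..p (Suc i)} s * indicator {u..q m} s))"
      unfolding simple_process_def using p
      by (subst indicator_Ioc_sum) (simp_all only: sum_distrib_right mult.assoc)
    also have "\<dots> = (\<Sum>i<m. (\<xi> i \<omega>)\<^sup>2 * indicator {q i<..q (Suc i)} s)"
    proof (rule sum.mono_neutral_cong_right)
      show "\<forall>i\<in>{..<n} - {..<m}. (\<xi> i \<omega>)\<^sup>2 * (indicator {p i<..p (Suc i)} s * indicator {u..q m} s) = 0"
      proof (rule ballI)
        fix i assume i: "i \<in> {..<n} - {..<m}"
        with mono[of m i] have "p m \<le> p i" by simp
        then have "\<not> (s \<in> {p i<..p (Suc i)} \<and> s \<in> {u..q m})"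
          using s unfolding q_def by (auto simp: max_def min_def split: if_splits)
        then show "(\<xi> i \<omega>)\<^sup>2 * (indicator {p i<..p (Suc i)} s * indicator {u..q m} s) = 0"
          by (auto simp: indicator_def)
      qed
      fix i assume i: "i \<in> {..<m}"
      with m mono[of "Suc i" m] have "p (Suc i) \<le> p m" by simp
      then have "s \<in> {p i<..p (Suc i)} \<and> s \<in> {u..q m} \<longleftrightarrow> s \<in> {q i<..q (Suc i)}"
        using s mono[of i "Suc i"] i m unfolding q_def by (auto simp: max_def min_def split: if_splits)
      then show "(\<xi> i \<omega>)\<^sup>2 * (indicator {p i<..p (Suc i)} s * indicator {u..q m} s)
          = (\<xi> i \<omega>)\<^sup>2 * indicator {q i<..q (Suc i)} s"
        by (auto simp: indicator_def)
    qed (use m in auto)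
    finally have *: "(simple_process n p \<xi> s \<omega>)\<^sup>2 * indicator {u..q m} s = (\<Sum>i<m. (\<xi> i \<omega>)\<^sup>2 * indicator {q i<..q (Suc i)} s)" .
    have "ennreal ((simple_process n p \<xi> s \<omega>)\<^sup>2) * indicator {u..q m} s
       = ennreal ((simple_process n p \<xi> s \<omega>)\<^sup>2 * indicator {u..q m} s)"
      by (auto simp: indicator_def)
    also have "\<dots> = (\<Sum>i<m. ennreal ((\<xi> i \<omega>)\<^sup>2 * indicator {q i<..q (Suc i)} s))"
      unfolding * by (rule sum_ennreal[symmetric]) auto
    also have "\<dots> = (\<Sum>i<m. ennreal ((\<xi> i \<omega>)\<^sup>2) * indicator {q i<..q (Suc i)} s)"
      by (intro sum.cong) (auto simp: indicator_def)
    finally show "ennreal ((simple_process n p \<xi> s \<omega>)\<^sup>2) * indicator {u..q m} s = 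
       (\<Sum>i<m. ennreal ((\<xi> i \<omega>)\<^sup>2) * indicator {q i<..q (Suc i)} s)" .
  qed
  also have "\<dots> = (\<Sum>i<m. ennreal ((\<xi> i \<omega>)\<^sup>2) * emeasure lborel {q i<..q (Suc i)})"
    by (subst nn_integral_sum) (auto simp: nn_integral_cmult_indicator)
  also have "\<dots> = (\<Sum>i<m. ennreal ((\<xi> i \<omega>)\<^sup>2 * (q (Suc i) - q i)))"
    using qm m by (intro sum.cong) (auto simp: ennreal_mult)
  also have "\<dots> = ennreal (\<Sum>i<m. (\<xi> i \<omega>)\<^sup>2 * (q (Suc i) - q i))"
    using qm m by (intro sum_ennreal) auto
  finally show ?thesis .
qed

text \<open>Counterpart of the preceding lemma for the stochastic sums, with the same clipped
  grid.\<close>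

lemma simple_integral_diff:
  fixes p :: "nat \<Rightarrow> real"
  assumes p: "\<And>i. i < n \<Longrightarrow> p i \<le> p (Suc i)" and "u \<le> t" and m: "m \<le> n"
  defines "q \<equiv> \<lambda>i. max u (min t (p i))"
  shows "simple_integral B n p \<xi> (q m) \<omega> - simple_integral B n p \<xi> u \<omega> =
    (\<Sum>i<m. \<xi> i \<omega> * (B (q (Suc i)) \<omega> - B (q i) \<omega>))"
proof -
  have mono: "i \<le> j \<Longrightarrow> j \<le> n \<Longrightarrow> p i \<le> p j" for i j
    by (induction j rule: dec_induct) (auto intro: order_trans[OF _ p])
  have "simple_integral B n p \<xi> (q m) \<omega> - simple_integral B n p \<xi> u \<omega> =
    (\<Sum>i<n. \<xi> i \<omega> * (B (min (q m) (p (Suc i))) \<omega> - B (min (q m) (p i)) \<omega> -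
        (B (min u (p (Suc i))) \<omega> - B (min u (p i)) \<omega>)))"
    unfolding simple_integral_def by (simp add: sum_subtractf[symmetric] right_diff_distrib)
  also have "\<dots> = (\<Sum>i<m. \<xi> i \<omega> * (B (q (Suc i)) \<omega> - B (q i) \<omega>))"
  proof (rule sum.mono_neutral_cong_right)
    \<comment> \<open>If \<open>x\<close> lies before \<open>u\<close> both sides vanish; otherwise
      \<open>min u x\<close> is \<open>u\<close> and the outer \<open>max\<close> does
      nothing.\<close>
    have c: "B (min (q m) x) \<omega> - B (min u x) \<omega> = B (max u (min (q m) x)) \<omega> - B u \<omega>" for x
      unfolding q_def by (auto simp: max_def min_def)
    have d: "B (min (q m) x) \<omega> - B (min (q m) y) \<omega> - (B (min u x) \<omega> - B (min u y) \<omega>) =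
       B (max u (min (q m) x)) \<omega> - B (max u (min (q m) y)) \<omega>" for x y
      using c[of x] c[of y] by (simp add: algebra_simps)
    show "\<forall>i\<in>{..<n} - {..<m}. \<xi> i \<omega> * (B (min (q m) (p (Suc i))) \<omega> - B (min (q m) (p i)) \<omega> -
        (B (min u (p (Suc i))) \<omega> - B (min u (p i)) \<omega>)) = 0"
    proof (rule ballI)
      fix i assume i: "i \<in> {..<n} - {..<m}"
      with mono[of m i] p[of i] have "p m \<le> p i" "p i \<le> p (Suc i)" by auto
      then have "max u (min (q m) (p (Suc i))) = max u (min (q m) (p i))"
        unfolding q_def by (auto simp: max_def min_def)
      then show "\<xi> i \<omega> * (B (min (q m) (p (Suc i))) \<omega> - B (min (q m) (p i)) \<omega> -
        (B (min u (p (Suc i))) \<omega> - B (min u (p i)) \<omega>)) = 0" unfolding d by simp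
    qed
    fix i assume i: "i \<in> {..<m}"
    with m mono[of "Suc i" m] mono[of i m] have "p (Suc i) \<le> p m" "p i \<le> p m" by auto
    then have "max u (min (q m) (p (Suc i))) = q (Suc i)" "max u (min (q m) (p i)) = q i"
      unfolding q_def by (auto simp: max_def min_def)
    then show "\<xi> i \<omega> * (B (min (q m) (p (Suc i))) \<omega> - B (min (q m) (p i)) \<omega> -
        (B (min u (p (Suc i))) \<omega> - B (min u (p i)) \<omega>)) = \<xi> i \<omega> * (B (q (Suc i)) \<omega> - B (q i) \<omega>)"
      unfolding d by simp
  qed (use m in auto)
  finally show ?thesis .
qed

text \<open>A strict inequality persists near \<open>t\<close> by continuity, so rationals detect
  it. They are taken in the parameter interval from 0 to 1 because the interval from
  \<open>a\<close> to \<open>b\<close> may be a single irrational point.\<close>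

lemma ex_greater_rational_iff:
  fixes f :: "real \<Rightarrow> real"
  assumes f: "continuous_on {a..b} f" and "a \<le> b"
  shows "(\<exists>t\<in>{a..b}. x < f t) \<longleftrightarrow> (\<exists>r\<in>\<rat> \<inter> {0..1}. x < f (a + (b - a) * r))"
proof
  assume "\<exists>t\<in>{a..b}. x < f t"
  then obtain t where t: "t \<in> {a..b}" "x < f t" by auto
  define r0 where "r0 = (if a = b then 0 else (t - a) / (b - a))"
  have r0: "r0 \<in> {0..1}" "a + (b - a) * r0 = t"
    using t \<open>a \<le> b\<close> by (auto simp: r0_def)
  have "a + (b - a) * r \<in> {a..b}" if "r \<in> {0..1}" for r
    using that \<open>a \<le> b\<close> mult_left_le[of r "b - a"] by auto
  then have "continuous_on {0..1} (\<lambda>r. f (a + (b - a) * r))"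
    by (intro continuous_on_compose2[OF f] continuous_intros) auto
  then have "((\<lambda>r. f (a + (b - a) * r)) \<longlongrightarrow> f t) (at r0 within {0..1})"
    using r0 by (auto simp: continuous_on_def)
  from order_tendstoD(1)[OF this t(2)] obtain d where d: "d > 0"
    "\<And>r. r \<in> {0..1} \<Longrightarrow> r \<noteq> r0 \<Longrightarrow> dist r r0 < d \<Longrightarrow> x < f (a + (b - a) * r)"
    unfolding eventually_at by auto
  have "max 0 (r0 - d) < min 1 (r0 + d)" using r0 d by auto
  from Rats_dense_in_real[OF this] obtain r where "r \<in> \<rat>" "max 0 (r0 - d) < r" "r < min 1 (r0 + d)" by auto
  then have "r \<in> \<rat> \<inter> {0..1}" "x < f (a + (b - a) * r)"
    using d(2)[of r] t r0 by (cases "r = r0"; auto simp: dist_real_def)+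
  then show "\<exists>r\<in>\<rat> \<inter> {0..1}. x < f (a + (b - a) * r)" by blast
next
  assume "\<exists>r\<in>\<rat> \<inter> {0..1}. x < f (a + (b - a) * r)"
  then obtain r where r: "r \<in> {0..1}" "x < f (a + (b - a) * r)" by auto
  then have "a + (b - a) * r \<in> {a..b}"
    using \<open>a \<le> b\<close> mult_left_le[of r "b - a"] by auto
  with r show "\<exists>t\<in>{a..b}. x < f t" by blast
qed

lemma sets_Collect_ex_greater:
  fixes f :: "real \<Rightarrow> 'a \<Rightarrow> real"
  assumes "\<And>\<omega>. \<omega> \<in> space M \<Longrightarrow> continuous_on {a..b} (\<lambda>t. f t \<omega>)" and ab: "a \<le> b"
    and f: "\<And>t. t \<in> {a..b} \<Longrightarrow> f t \<in> borel_measurable M"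
  shows "{\<omega>\<in>space M. \<exists>t\<in>{a..b}. x < f t \<omega>} \<in> sets M"
proof -
  have "{\<omega>\<in>space M. \<exists>t\<in>{a..b}. x < f t \<omega>} = 
     (\<Union>r\<in>\<rat> \<inter> {0..1}. {\<omega>\<in>space M. x < f (a + (b - a) * r) \<omega>})"
    using ex_greater_rational_iff[OF assms(1) ab, of _ x] by auto
  also have "\<dots> \<in> sets M"
  proof (rule sets.countable_UN'')
    fix r :: real assume "r \<in> \<rat> \<inter> {0..1}"
    then have "a + (b - a) * r \<in> {a..b}"
      using ab mult_left_le[of r "b - a"] by auto
    from f[OF this] have [measurable]: "f (a + (b - a) * r) \<in> borel_measurable M" .
    show "{\<omega>\<in>space M. x < f (a + (b - a) * r) \<omega>} \<in> sets M" by measurable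
  qed (auto intro: countable_subset[OF _ countable_rat])
  finally show ?thesis .
qed

text \<open>Clipping the time to the range from 0 to \<open>T\<close> turns measurability on a
  restricted space into measurability on the whole line, where product measures with
  \<open>lborel\<close> are at hand.\<close>

lemma progressively_measurable_clip:
  assumes H: "progressively_measurable F H" and T: "0 \<le> T"
  shows "(\<lambda>(s, \<omega>). H (max 0 (min T s)) \<omega>) \<in> borel_measurable (borel \<Otimes>\<^sub>M F T)"
proof -
  have H': "(\<lambda>(t, \<omega>). H t \<omega>) \<in> borel_measurable (restrict_space borel {0..T} \<Otimes>\<^sub>M F T)"
    using H T by (simp add: progressively_measurable_def)
  have c: "(\<lambda>s. max 0 (min T s)) \<in> measurable borel (restrict_space borel {0..T})"
    using T by (intro measurable_restrict_space2) auto
  have "(\<lambda>p. (max 0 (min T (fst p)), snd p)) \<in> measurable (borel \<Otimes>\<^sub>M F T) (restrict_space borel {0..T} \<Otimes>\<^sub>M F T)"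
    by (intro measurable_Pair measurable_compose[OF measurable_fst c] measurable_snd)
  from measurable_compose[OF this H'] show ?thesis by (simp add: case_prod_beta)
qed

lemma progressively_measurable_nn_integral:
  assumes H: "progressively_measurable F H" and T: "0 \<le> T" "0 \<le> u" "v \<le> T"
    and [measurable]: "g \<in> borel_measurable borel"
  shows "(\<lambda>\<omega>. \<integral>\<^sup>+s\<in>{u..v}. g (H s \<omega>) \<partial>lborel) \<in> borel_measurable (F T)"
proof -
  have [measurable]: "(\<lambda>p. H (max 0 (min T (snd p))) (fst p)) \<in> borel_measurable (F T \<Otimes>\<^sub>M lborel)"
    using measurable_compose[OF measurable_pair_swap' progressively_measurable_clip[OF H T(1)]]
    by (simp add: case_prod_beta cong: measurable_cong_sets)
  have eq: "(\<integral>\<^sup>+s\<in>{u..v}. g (H s \<omega>) \<partial>lborel) = (\<integral>\<^sup>+s. g (H (max 0 (min T s)) \<omega>) * indicator {u..v} s \<partial>lborel)" for \<omega>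
    using T by (intro nn_integral_cong) (simp add: indicator_def)
  show ?thesis unfolding eq
    by (rule lborel.borel_measurable_nn_integral) (simp add: case_prod_beta)
qed

lemma progressively_measurable_path:
  assumes H: "progressively_measurable F H" and "0 \<le> T" "0 \<le> u" "v \<le> T" and \<omega>: "\<omega> \<in> space (F T)"
  shows "(\<lambda>s. H s \<omega> * indicator {u..v} s) \<in> borel_measurable borel"
proof -
  have "(\<lambda>s. H (max 0 (min T s)) \<omega>) \<in> borel_measurable borel"
    using measurable_compose[OF measurable_Pair2'[OF \<omega>] progressively_measurable_clip[OF H \<open>0 \<le> T\<close>]] by simp
  then have "(\<lambda>s. H (max 0 (min T s)) \<omega> * indicator {u..v} s) \<in> borel_measurable borel" by simp
  also have "(\<lambda>s. H (max 0 (min T s)) \<omega> * indicator {u..v} s) = (\<lambda>s. H s \<omega> * indicator {u..v} s)"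
    using assms(2-4) by (intro ext) (simp add: indicator_def)
  finally show ?thesis .
qed

context brownian_setting
begin

lemma B_continuous: "\<omega> \<in> space M \<Longrightarrow> continuous_on {0..} (\<lambda>t. B t \<omega>)"
  using bm by (simp add: brownian_motion_def continuous_paths_def)

lemma simple_integrand_grid_nonneg:
  assumes "simple_integrand M F n p \<xi>" "i \<le> n"
  shows "0 \<le> p i"
  using assms(2)
proof (induction i)
  case (Suc i)
  with assms(1) have "p i \<le> p (Suc i)" by (simp add: simple_integrand_def)
  with Suc show ?case by simp
qed (use assms in \<open>simp add: simple_integrand_def\<close>)

lemma simple_integral_continuous:
  assumes "simple_integrand M F n p \<xi>" "\<omega> \<in> space M"
  shows "continuous_on {0..} (\<lambda>t. simple_integral B n p \<xi> t \<omega>)"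
  unfolding simple_integral_def using simple_integrand_grid_nonneg[OF assms(1)]
  by (intro continuous_intros continuous_on_compose2[OF B_continuous[OF assms(2)]]) auto

lemma simple_integral_measurable:
  assumes s: "simple_integrand M F n p \<xi>" and "0 \<le> t"
  shows "simple_integral B n p \<xi> t \<in> borel_measurable M"
proof -
  have [measurable]: "i < n \<Longrightarrow> \<xi> i \<in> borel_measurable M" for i
    using s by (auto simp: simple_integrand_def intro: F_measurable_M)
  have [measurable]: "i \<le> n \<Longrightarrow> B (min t (p i)) \<in> borel_measurable M" for i
    using simple_integrand_grid_nonneg[OF s, of i] \<open>0 \<le> t\<close> by (intro F_measurable_M[OF B_measurable]) auto
  have "(\<lambda>\<omega>. \<Sum>i<n. \<xi> i \<omega> * (B (min t (p (Suc i))) \<omega> - B (min t (p i)) \<omega>)) \<in> borel_measurable M"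
    by (intro borel_measurable_sum borel_measurable_times borel_measurable_diff) auto
  then show ?thesis by (simp add: simple_integral_def[abs_def])
qed

text \<open>
  Needed because \<^const>\<open>measure\<close> is \<open>0\<close> on nonmeasurable sets, for which the convergence required
  by \<^const>\<open>ito_integral\<close> would say nothing.
\<close>

lemma ito_bad_set:
  assumes s: "simple_integrand M F n p \<xi>" and H: "progressively_measurable F H"
    and I: "adapted (\<lambda>_. M) I" "continuous_paths M I" and T: "0 \<le> T"
  shows "{\<omega>\<in>space M. (\<integral>\<^sup>+s\<in>{0..T}. ennreal ((simple_process n p \<xi> s \<omega> - H s \<omega>)\<^sup>2) \<partial>lborel) > e} \<in> sets M"
    and "{\<omega>\<in>space M. \<exists>t\<in>{0..T}. \<bar>simple_integral B n p \<xi> t \<omega> - I t \<omega>\<bar> > \<epsilon>} \<in> sets M"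
proof -
  have [measurable]: "i < n \<Longrightarrow> \<xi> i \<in> borel_measurable M" for i
    using s by (auto simp: simple_integrand_def intro: F_measurable_M)
  have M': "(\<lambda>p. p) \<in> measurable (borel \<Otimes>\<^sub>M M) (borel \<Otimes>\<^sub>M F T)"
    using measurable_Pair[OF measurable_fst[of borel M] measurable_compose[OF measurable_snd[of borel M] F_measurable_M[OF measurable_ident, unfolded id_def, of T]]]
    by simp
  have [measurable]: "(\<lambda>p. H (max 0 (min T (snd p))) (fst p)) \<in> borel_measurable (M \<Otimes>\<^sub>M lborel)"
    using measurable_compose[OF measurable_pair_swap' measurable_compose[OF M' progressively_measurable_clip[OF H T]]]
    by (simp add: case_prod_beta cong: measurable_cong_sets)
  have [measurable]: "(\<lambda>q. simple_process n p \<xi> (snd q) (fst q)) \<in> borel_measurable (M \<Otimes>\<^sub>M lborel)"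
    unfolding simple_process_def[abs_def]
  proof (rule borel_measurable_sum)
    fix i assume "i \<in> {..<n}"
    then have [measurable]: "\<xi> i \<in> borel_measurable M" by simp
    show "(\<lambda>q. \<xi> i (fst q) * indicator {p i<..p (Suc i)} (snd q)) \<in> borel_measurable (M \<Otimes>\<^sub>M lborel)"
      by measurable
  qed
  have eq: "(\<integral>\<^sup>+s\<in>{0..T}. ennreal ((simple_process n p \<xi> s \<omega> - H s \<omega>)\<^sup>2) \<partial>lborel) =
     (\<integral>\<^sup>+s. ennreal ((simple_process n p \<xi> s \<omega> - H (max 0 (min T s)) \<omega>)\<^sup>2) * indicator {0..T} s \<partial>lborel)" for \<omega>
    using T by (intro nn_integral_cong) (simp add: indicator_def)
  have [measurable]: "(\<lambda>\<omega>. \<integral>\<^sup>+s\<in>{0..T}. ennreal ((simple_process n p \<xi> s \<omega> - H s \<omega>)\<^sup>2) \<partial>lborel) \<in> borel_measurable M"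
    unfolding eq by (rule lborel.borel_measurable_nn_integral) (simp add: case_prod_beta)
  show "{\<omega>\<in>space M. (\<integral>\<^sup>+s\<in>{0..T}. ennreal ((simple_process n p \<xi> s \<omega> - H s \<omega>)\<^sup>2) \<partial>lborel) > e} \<in> sets M"
    by measurable
  show "{\<omega>\<in>space M. \<exists>t\<in>{0..T}. \<bar>simple_integral B n p \<xi> t \<omega> - I t \<omega>\<bar> > \<epsilon>} \<in> sets M"
  proof (rule sets_Collect_ex_greater)
    fix t assume "t \<in> {0..T}"
    then have [measurable]: "simple_integral B n p \<xi> t \<in> borel_measurable M" "I t \<in> borel_measurable M"
      using I by (auto intro: simple_integral_measurable[OF s] simp: adapted_def)
    show "(\<lambda>\<omega>. \<bar>simple_integral B n p \<xi> t \<omega> - I t \<omega>\<bar>) \<in> borel_measurable M" by measurable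
  next
    fix \<omega> assume "\<omega> \<in> space M"
    then have "continuous_on {0..T} (\<lambda>t. simple_integral B n p \<xi> t \<omega>)" "continuous_on {0..T} (\<lambda>t. I t \<omega>)"
      using I by (auto intro: continuous_on_subset[OF simple_integral_continuous[OF s]] 
          continuous_on_subset[of "{0..}"] simp: continuous_paths_def)
    then show "continuous_on {0..T} (\<lambda>t. \<bar>simple_integral B n p \<xi> t \<omega> - I t \<omega>\<bar>)"
      by (intro continuous_intros)
  qed (use T in auto)
qed

end

text \<open>The clipped last grid point may come before \<open>t\<close>, but the integrand vanishes
  after \<open>p n\<close>, so neither integral changes on the remaining stretch.\<close>

lemma simple_process_tail:
  fixes p :: "nat \<Rightarrow> real"
  assumes p: "\<And>i. i < n \<Longrightarrow> p i \<le> p (Suc i)" and "u \<le> t"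
  shows "simple_integral B n p \<xi> (max u (min t (p n))) \<omega> = simple_integral B n p \<xi> t \<omega>" (is ?A)
    and "(\<integral>\<^sup>+s\<in>{u..max u (min t (p n))}. ennreal ((simple_process n p \<xi> s \<omega>)\<^sup>2) \<partial>lborel)
      = (\<integral>\<^sup>+s\<in>{u..t}. ennreal ((simple_process n p \<xi> s \<omega>)\<^sup>2) \<partial>lborel)" (is ?B)
proof -
  have mono: "i \<le> n \<Longrightarrow> p i \<le> p n" for i
    by (induction rule: inc_induct) (auto intro: order_trans[OF p])
  show ?A
  proof (cases "p n \<le> t")
    case True
    then have "i \<le> n \<Longrightarrow> min (max u (min t (p n))) (p i) = min t (p i)" for i
      using mono[of i] by simp
    then show ?thesis by (auto simp: simple_integral_def intro!: sum.cong)
  qed (use \<open>u \<le> t\<close> in simp)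
  show ?B
  proof (rule nn_integral_cong)
    fix s
    have "simple_process n p \<xi> s \<omega> = 0" if "p n < s"
      unfolding simple_process_def
    proof (rule sum.neutral, rule ballI)
      fix i assume "i \<in> {..<n}"
      with mono[of "Suc i"] that show "\<xi> i \<omega> * indicator {p i<..p (Suc i)} s = 0" by simp
    qed
    then show "ennreal ((simple_process n p \<xi> s \<omega>)\<^sup>2) * indicator {u..max u (min t (p n))} s
       = ennreal ((simple_process n p \<xi> s \<omega>)\<^sup>2) * indicator {u..t} s"
      using \<open>u \<le> t\<close> by (cases "p n < s") (auto simp: indicator_def)
  qed
qed

context brownian_setting
begin

text \<open>
  The integrand is switched off as soon as \<open>\<Sum> \<xi>\<^sup>2 \<Delta>p\<close> would exceed \<open>K\<close>. This bounds \<open>D\<close> in \<open>L\<^sup>2\<close>, and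
  \<open>D\<close> is still the untruncated exponential, read off at an earlier time \<open>v\<close>.
\<close>

lemma truncated_exponential:
  assumes s: "simple_integrand M F n p \<xi>" and u: "0 \<le> u" "u \<le> t" and K: "0 \<le> K"
  obtains D :: "'a \<Rightarrow> real" where "D \<in> borel_measurable M" "\<And>\<omega>. 0 \<le> D \<omega>"
    "\<And>\<Phi>. \<Phi> \<in> borel_measurable (F u) \<Longrightarrow> (\<integral>\<^sup>+\<omega>. \<Phi> \<omega> * ennreal (D \<omega>) \<partial>M) = (\<integral>\<^sup>+\<omega>. \<Phi> \<omega> \<partial>M)"
    "(\<integral>\<^sup>+\<omega>. ennreal ((D \<omega>)\<^sup>2) \<partial>M) \<le> ennreal (exp (c\<^sup>2 * K))"
    "\<And>\<omega>. \<exists>v\<in>{u..t}. \<exists>A. 0 \<le> A \<and> A \<le> K \<and>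
       (\<integral>\<^sup>+s\<in>{u..v}. ennreal ((simple_process n p \<xi> s \<omega>)\<^sup>2) \<partial>lborel) = ennreal A \<and>
       D \<omega> = exp (c * (simple_integral B n p \<xi> v \<omega> - simple_integral B n p \<xi> u \<omega>) - c\<^sup>2 / 2 * A) \<and>
       ((\<integral>\<^sup>+s\<in>{u..t}. ennreal ((simple_process n p \<xi> s \<omega>)\<^sup>2) \<partial>lborel) \<le> ennreal K \<longrightarrow> v = t)"
proof -
  have p: "i < n \<Longrightarrow> p i \<le> p (Suc i)" and \<xi>: "i < n \<Longrightarrow> \<xi> i \<in> borel_measurable (F (p i))" for i
    using s by (auto simp: simple_integrand_def)
  define q where "q i = max u (min t (p i))" for i
  have q: "i < n \<Longrightarrow> q i \<le> q (Suc i)" for i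
    unfolding q_def by (rule clip_grid_mono) (rule p)
  have qm: "i \<le> j \<Longrightarrow> j \<le> n \<Longrightarrow> q i \<le> q j" for i j
    by (induction j rule: dec_induct) (auto intro: order_trans[OF _ q])
  have q0: "u \<le> q i" "q i \<le> t" for i using u by (auto simp: q_def)
  \<comment> \<open>If \<open>p i > t\<close> then \<open>q i = t < p i\<close>, so
    \<open>\<xi> i\<close> need not be known at time \<open>q i\<close>. The clipped step has length
    0 there, and replacing the value by 0 changes no sum.\<close>
  define x where "x i \<omega> = (if p i \<le> t then \<xi> i \<omega> else 0)" for i \<omega>
  have x0: "x i \<omega> = \<xi> i \<omega> \<or> q (Suc i) = q i" if "i < n" for i \<omega>
    using p[OF that] by (auto simp: x_def q_def)
  have x: "x i \<in> borel_measurable (F (q i))" if "i < n" for i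
  proof (cases "p i \<le> t")
    case True
    then have "p i \<le> q i" by (simp add: q_def)
    with True show ?thesis unfolding x_def
      by (simp add: F_measurable_mono[OF \<xi>[OF that]])
  qed (simp add: x_def[abs_def])
  define A where "A m \<omega> = (\<Sum>j<m. (x j \<omega>)\<^sup>2 * (q (Suc j) - q j))" for m \<omega>
  \<comment> \<open>The test includes step \<open>i\<close> itself: its length is deterministic, so
    the decision is known at time \<open>q i\<close>, and the accumulated sum never overshoots
    \<open>K\<close>.\<close>
  define y where "y i \<omega> = (if (\<Sum>j\<le>i. (x j \<omega>)\<^sup>2 * (q (Suc j) - q j)) \<le> K then x i \<omega> else 0)" for i \<omega>
  have y: "y i \<in> borel_measurable (F (q i))" if "i < n" for i
  proof -
    have xj: "j \<le> i \<Longrightarrow> x j \<in> borel_measurable (F (q i))" for j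
      using that by (intro F_measurable_mono[OF x qm]) auto
    have "(\<lambda>\<omega>. \<Sum>j\<le>i. (x j \<omega>)\<^sup>2 * (q (Suc j) - q j)) \<in> borel_measurable (F (q i))"
      by (intro borel_measurable_sum borel_measurable_times borel_measurable_power xj) auto
    then show ?thesis unfolding y_def
      by (intro measurable_If xj borel_measurable_le) auto
  qed
  define E where "E c \<omega> = exp (\<Sum>i<n. (c * y i \<omega>) * (B (q (Suc i)) \<omega> - B (q i) \<omega>)
      - (c * y i \<omega>)\<^sup>2 * (q (Suc i) - q i) / 2)" for c \<omega>
  have cy: "i < n \<Longrightarrow> (\<lambda>\<omega>. c * y i \<omega>) \<in> borel_measurable (F (q i))" for i c
    using y by simp
  have E_meas[measurable]: "E c \<in> borel_measurable M" for c
  proof -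
    have "(\<lambda>\<omega>. \<Sum>i<n. (c * y i \<omega>) * (B (q (Suc i)) \<omega> - B (q i) \<omega>)
        - (c * y i \<omega>)\<^sup>2 * (q (Suc i) - q i) / 2) \<in> borel_measurable (F (q n))"
      using u q0[of 0] by (intro exponential_simple_measurable[of q n "\<lambda>i \<omega>. c * y i \<omega>"] q cy) auto
    from F_measurable_M[OF this] show ?thesis unfolding E_def by measurable
  qed
  have E_int: "(\<integral>\<^sup>+\<omega>. \<Phi> \<omega> * ennreal (E c \<omega>) \<partial>M) = (\<integral>\<^sup>+\<omega>. \<Phi> \<omega> \<partial>M)"
    if "\<Phi> \<in> borel_measurable (F u)" for \<Phi> c
    unfolding E_def using u q0 q cy that by (intro nn_integral_exponential_simple) auto
  have A_mono: "i \<le> j \<Longrightarrow> j \<le> n \<Longrightarrow> A i \<omega> \<le> A j \<omega>" for i j \<omega>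
    unfolding A_def using q by (intro sum_mono2) auto
  have A0: "m \<le> n \<Longrightarrow> 0 \<le> A m \<omega>" for m \<omega>
    using A_mono[of 0 m \<omega>] by (simp add: A_def)
  have tr: "\<exists>m\<le>n. A m \<omega> \<le> K \<and> (\<Sum>i<n. g i (y i \<omega>)) = (\<Sum>i<m. g i (x i \<omega>)) \<and> (A n \<omega> \<le> K \<longrightarrow> m = n)"
    if "\<And>i. g i 0 = 0" for g :: "nat \<Rightarrow> real \<Rightarrow> real" and \<omega>
    unfolding A_def y_def using that q by (intro sum_truncated_grid[OF K]) auto
  have Aeq: "(\<integral>\<^sup>+s\<in>{u..q m}. ennreal ((simple_process n p \<xi> s \<omega>)\<^sup>2) \<partial>lborel) = ennreal (A m \<omega>)"
    if "m \<le> n" for m \<omega>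
  proof -
    have "(\<Sum>j<m. (x j \<omega>)\<^sup>2 * (q (Suc j) - q j)) = (\<Sum>j<m. (\<xi> j \<omega>)\<^sup>2 * (q (Suc j) - q j))"
    proof (rule sum.cong)
      fix j assume "j \<in> {..<m}"
      then show "(x j \<omega>)\<^sup>2 * (q (Suc j) - q j) = (\<xi> j \<omega>)\<^sup>2 * (q (Suc j) - q j)"
        using x0[of j \<omega>] that by auto
    qed simp
    then show ?thesis
      using nn_integral_simple_process_square[of n p u t m \<xi> \<omega>, OF p \<open>u \<le> t\<close> that]
      by (simp add: A_def q_def)
  qed
  have Jeq: "(\<Sum>j<m. x j \<omega> * (B (q (Suc j)) \<omega> - B (q j) \<omega>)) =
     simple_integral B n p \<xi> (q m) \<omega> - simple_integral B n p \<xi> u \<omega>" if "m \<le> n" for m \<omega>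
  proof -
    have "(\<Sum>j<m. x j \<omega> * (B (q (Suc j)) \<omega> - B (q j) \<omega>)) = (\<Sum>j<m. \<xi> j \<omega> * (B (q (Suc j)) \<omega> - B (q j) \<omega>))"
    proof (rule sum.cong)
      fix j assume "j \<in> {..<m}"
      then show "x j \<omega> * (B (q (Suc j)) \<omega> - B (q j) \<omega>) = \<xi> j \<omega> * (B (q (Suc j)) \<omega> - B (q j) \<omega>)"
        using x0[of j \<omega>] that by auto
    qed simp
    then show ?thesis
      using simple_integral_diff[of n p u t m B \<xi> \<omega>, OF p \<open>u \<le> t\<close> that]
      by (simp add: q_def)
  qed
  show thesis
  proof (rule that[of "E c"])
    show "0 \<le> E c \<omega>" for \<omega> by (simp add: E_def)
    show "(\<integral>\<^sup>+\<omega>. \<Phi> \<omega> * ennreal (E c \<omega>) \<partial>M) = (\<integral>\<^sup>+\<omega>. \<Phi> \<omega> \<partial>M)"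
      if "\<Phi> \<in> borel_measurable (F u)" for \<Phi> by (rule E_int[OF that])
    \<comment> \<open>Squaring doubles the coefficient: \<open>(E c)\<^sup>2\<close> is
      \<open>E (2 * c)\<close>, of expectation 1, times the exponential of \<open>c\<^sup>2\<close>
      times the truncated sum of squares, which is at most \<open>K\<close>.\<close>
    have "(E c \<omega>)\<^sup>2 \<le> E (2 * c) \<omega> * exp (c\<^sup>2 * K)" for \<omega>
    proof -
      obtain m where m: "m \<le> n" "A m \<omega> \<le> K" "(\<Sum>i<n. (y i \<omega>)\<^sup>2 * (q (Suc i) - q i)) = A m \<omega>"
        using tr[of "\<lambda>i z. z\<^sup>2 * (q (Suc i) - q i)" \<omega>] by (auto simp: A_def)
      let ?S = "\<lambda>c. (\<Sum>i<n. (c * y i \<omega>) * (B (q (Suc i)) \<omega> - B (q i) \<omega>)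
        - (c * y i \<omega>)\<^sup>2 * (q (Suc i) - q i) / 2)"
      have "2 * ?S c = ?S (2 * c) + c\<^sup>2 * (\<Sum>i<n. (y i \<omega>)\<^sup>2 * (q (Suc i) - q i))"
        unfolding sum_distrib_left sum.distrib[symmetric]
        by (intro sum.cong) (auto simp: power2_eq_square field_simps)
      also have "\<dots> \<le> ?S (2 * c) + c\<^sup>2 * K"
        unfolding m(3) using m(2) by (intro add_left_mono mult_left_mono) auto
      finally show ?thesis
        by (simp add: E_def flip: exp_add exp_of_nat_mult[of 2])
    qed
    then have "ennreal ((E c \<omega>)\<^sup>2) \<le> ennreal (exp (c\<^sup>2 * K) * E (2 * c) \<omega>)" for \<omega>
      by (intro ennreal_leI) (simp add: mult.commute)
    then have "(\<integral>\<^sup>+\<omega>. ennreal ((E c \<omega>)\<^sup>2) \<partial>M) \<le> (\<integral>\<^sup>+\<omega>. ennreal (exp (c\<^sup>2 * K)) * ennreal (E (2 * c) \<omega>) \<partial>M)"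
      by (intro nn_integral_mono) (simp add: ennreal_mult')
    also have "\<dots> = ennreal (exp (c\<^sup>2 * K))"
      by (subst E_int) (auto simp: emeasure_space_1)
    finally show "(\<integral>\<^sup>+\<omega>. ennreal ((E c \<omega>)\<^sup>2) \<partial>M) \<le> ennreal (exp (c\<^sup>2 * K))" .
    fix \<omega>
    obtain m where m: "m \<le> n" "A m \<omega> \<le> K" "A n \<omega> \<le> K \<longrightarrow> m = n"
      "(\<Sum>i<n. (c * y i \<omega>) * (B (q (Suc i)) \<omega> - B (q i) \<omega>) - (c * y i \<omega>)\<^sup>2 * (q (Suc i) - q i) / 2)
      = (\<Sum>i<m. (c * x i \<omega>) * (B (q (Suc i)) \<omega> - B (q i) \<omega>) - (c * x i \<omega>)\<^sup>2 * (q (Suc i) - q i) / 2)"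
      using tr[of "\<lambda>i z. (c * z) * (B (q (Suc i)) \<omega> - B (q i) \<omega>) - (c * z)\<^sup>2 * (q (Suc i) - q i) / 2" \<omega>] by auto
    have sm: "(\<Sum>i<m. (c * x i \<omega>) * (B (q (Suc i)) \<omega> - B (q i) \<omega>) - (c * x i \<omega>)\<^sup>2 * (q (Suc i) - q i) / 2)
        = c * (\<Sum>j<m. x j \<omega> * (B (q (Suc j)) \<omega> - B (q j) \<omega>)) - c\<^sup>2 / 2 * A m \<omega>"
      unfolding A_def sum_distrib_left sum_subtractf[symmetric]
      by (intro sum.cong) (auto simp: power2_eq_square)
    have Ec: "E c \<omega> = exp (c * (simple_integral B n p \<xi> (q m) \<omega> - simple_integral B n p \<xi> u \<omega>) - c\<^sup>2 / 2 * A m \<omega>)"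
      unfolding E_def m(4) sm Jeq[OF m(1)] ..
    note tail = simple_process_tail(1)[of n p u t B \<xi> \<omega>, OF p \<open>u \<le> t\<close>, folded q_def]
      simple_process_tail(2)[of n p u t \<xi> \<omega>, OF p \<open>u \<le> t\<close>, folded q_def]
    show "\<exists>v\<in>{u..t}. \<exists>A. 0 \<le> A \<and> A \<le> K \<and>
       (\<integral>\<^sup>+s\<in>{u..v}. ennreal ((simple_process n p \<xi> s \<omega>)\<^sup>2) \<partial>lborel) = ennreal A \<and>
       E c \<omega> = exp (c * (simple_integral B n p \<xi> v \<omega> - simple_integral B n p \<xi> u \<omega>) - c\<^sup>2 / 2 * A) \<and>
       ((\<integral>\<^sup>+s\<in>{u..t}. ennreal ((simple_process n p \<xi> s \<omega>)\<^sup>2) \<partial>lborel) \<le> ennreal K \<longrightarrow> v = t)"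
    \<comment> \<open>If the truncation never acts, the whole grid counts and the tail lemma gives
      \<open>v = t\<close>. Otherwise \<open>v\<close> is the point \<open>q m\<close> where the
      integrand is switched off, and the last implication is vacuous.\<close>
    proof (cases "A n \<omega> \<le> K")
      case True
      with m have "m = n" by simp
      with Ec Aeq[of n \<omega>] True A0[of n \<omega>] show ?thesis
        using tail \<open>u \<le> t\<close> by (intro bexI[of _ t] exI[of _ "A n \<omega>"]) auto
    next
      case False
      with Ec m A0[of m \<omega>] Aeq[of m \<omega>] Aeq[of n \<omega>] K q0[of m] show ?thesis
        using tail
        by (intro bexI[of _ "q m"] exI[of _ "A m \<omega>"]) (auto simp: ennreal_le_iff)
    qed
  qed simp
qed

end

section \<open>Exponentials of Ito integrals\<close>

context brownian_setting
begin

text \<open>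
  The bound \<open>C\<close> replaces uniform integrability. Where the approximation is good, the truncated
  exponential is close to the limiting exponential at some earlier time, hence essentially at
  most \<open>C\<close>; the remaining event has small probability and is controlled by the \<open>L\<^sup>2\<close> bound.
\<close>

lemma exponential_ito_integral:
  assumes ito: "ito_integral M F B H I" and u: "0 \<le> u" "u \<le> t"
    and fin: "AE \<omega> in M. (\<integral>\<^sup>+s\<in>{u..t}. ennreal ((H s \<omega>)\<^sup>2) \<partial>lborel) < \<infinity>"
    and \<Phi>: "\<Phi> \<in> borel_measurable (F u)" "\<And>\<omega>. 0 \<le> \<Phi> \<omega>" and C: "0 \<le> C"
    and bound: "AE \<omega> in M. \<forall>v\<in>{u..t}. \<Phi> \<omega> * exp (c * (I v \<omega> - I u \<omega>)
        - c\<^sup>2 / 2 * enn2real (\<integral>\<^sup>+s\<in>{u..v}. ennreal ((H s \<omega>)\<^sup>2) \<partial>lborel)) \<le> C"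
  shows "(\<integral>\<^sup>+\<omega>. ennreal (\<Phi> \<omega> * exp (c * (I t \<omega> - I u \<omega>)
        - c\<^sup>2 / 2 * enn2real (\<integral>\<^sup>+s\<in>{u..t}. ennreal ((H s \<omega>)\<^sup>2) \<partial>lborel))) \<partial>M)
     = (\<integral>\<^sup>+\<omega>. ennreal (\<Phi> \<omega>) \<partial>M)"
proof -
  define Q where "Q v \<omega> = (\<integral>\<^sup>+s\<in>{u..v}. ennreal ((H s \<omega>)\<^sup>2) \<partial>lborel)" for v \<omega>
  define L where "L v \<omega> = \<Phi> \<omega> * exp (c * (I v \<omega> - I u \<omega>) - c\<^sup>2 / 2 * enn2real (Q v \<omega>))" for v \<omega>
  have H: "progressively_measurable F H" and I: "adapted (\<lambda>_. M) I" "continuous_paths M I"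
    using ito by (auto simp: ito_integral_def)
  obtain n p \<xi> where s: "\<And>k. simple_integrand M F (n k) (p k) (\<xi> k)"
    and lim: "\<And>T \<epsilon>. T \<ge> 0 \<Longrightarrow> \<epsilon> > 0 \<Longrightarrow> (\<lambda>k. prob {\<omega>\<in>space M.
              (\<integral>\<^sup>+s\<in>{0..T}. ennreal ((simple_process (n k) (p k) (\<xi> k) s \<omega> - H s \<omega>)\<^sup>2) \<partial>lborel)
                > ennreal \<epsilon>}) \<longlonglongrightarrow> 0"
      "\<And>T \<epsilon>. T \<ge> 0 \<Longrightarrow> \<epsilon> > 0 \<Longrightarrow> (\<lambda>k. prob {\<omega>\<in>space M.
              \<exists>t\<in>{0..T}. \<bar>simple_integral B (n k) (p k) (\<xi> k) t \<omega> - I t \<omega>\<bar> > \<epsilon>}) \<longlonglongrightarrow> 0"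
    using ito unfolding ito_integral_def by blast
  have "0 \<le> t" using u by simp
  have [measurable]: "\<Phi> \<in> borel_measurable M" by (rule F_measurable_M[OF \<Phi>(1)])
  have [measurable]: "I t \<in> borel_measurable M" "I u \<in> borel_measurable M"
    using I u by (auto simp: adapted_def)
  have Q_meas[measurable]: "Q t \<in> borel_measurable M"
    unfolding Q_def using u
    by (intro F_measurable_M[OF progressively_measurable_nn_integral[OF H, of t]]) auto
  have L_meas[measurable]: "L t \<in> borel_measurable M" unfolding L_def by measurable
  have L0: "0 \<le> L v \<omega>" for v \<omega> using \<Phi> by (simp add: L_def)
  have bound': "AE \<omega> in M. \<forall>v\<in>{u..t}. L v \<omega> \<le> C"
    using bound by (simp add: L_def Q_def)
  \<comment> \<open>Hence \<open>L u\<close> is \<Phi>, and the bound at \<open>v = u\<close> says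
    that \<Phi> itself is at most \<open>C\<close>.\<close>
  have Qu: "Q u \<omega> = 0" for \<omega>
  proof -
    have "AE s in lborel. ennreal ((H s \<omega>)\<^sup>2) * indicator {u..u} s = 0"
      using AE_lborel_singleton[of u] by eventually_elim auto
    from nn_integral_cong_AE[OF this] show ?thesis by (simp add: Q_def)
  qed
  have \<Phi>C: "AE \<omega> in M. \<Phi> \<omega> \<le> C"
    using bound' by eventually_elim (use u in \<open>force simp: L_def Qu\<close>)
  define a where "a = expectation \<Phi>"
  define l where "l = expectation (L t)"
  have "integrable M \<Phi>"
    by (rule integrable_const_bound[of _ C]) (use \<Phi>C \<Phi>(2) in auto)
  then have a: "(\<integral>\<^sup>+\<omega>. ennreal (\<Phi> \<omega>) \<partial>M) = ennreal a" and a0: "0 \<le> a"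
    unfolding a_def using \<Phi>(2) by (auto intro: nn_integral_eq_integral)
  have "AE \<omega> in M. norm (L t \<omega>) \<le> C"
    using bound' by eventually_elim (use L0[of t] u in auto)
  then have "integrable M (L t)"
    by (rule integrable_const_bound) simp
  then have l: "(\<integral>\<^sup>+\<omega>. ennreal (L t \<omega>) \<partial>M) = ennreal l" and l0: "0 \<le> l"
    unfolding l_def using L0 by (auto intro: nn_integral_eq_integral)
  \<comment> \<open>The approximation fails in quadratic mean or uniformly. The first threshold is
    the one required by \<open>nn_integral_square_le_weighted\<close>.\<close>
  define bad where "bad \<eta> k =
      {\<omega>\<in>space M. (\<integral>\<^sup>+s\<in>{0..t}. ennreal ((simple_process (n k) (p k) (\<xi> k) s \<omega> - H s \<omega>)\<^sup>2) \<partial>lborel)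
           > ennreal (\<eta>\<^sup>2 / (1 + \<eta>))} \<union>
      {\<omega>\<in>space M. \<exists>v\<in>{0..t}. \<bar>simple_integral B (n k) (p k) (\<xi> k) v \<omega> - I v \<omega>\<bar> > \<eta>}" for \<eta> k
  have bad_sets[measurable]: "bad \<eta> k \<in> sets M" for \<eta> k
    unfolding bad_def by (intro sets.Un ito_bad_set[OF s H I \<open>0 \<le> t\<close>])
  have bad_lim: "(\<lambda>k. prob (bad \<eta> k)) \<longlonglongrightarrow> 0" if "\<eta> > 0" for \<eta>
  proof (rule tendsto_sandwich[of "\<lambda>_. 0"])
    have "\<eta>\<^sup>2 / (1 + \<eta>) > 0" using that by simp
    from tendsto_add[OF lim(1)[OF \<open>0 \<le> t\<close> this] lim(2)[OF \<open>0 \<le> t\<close> that]]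
    show "(\<lambda>k. prob {\<omega>\<in>space M. (\<integral>\<^sup>+s\<in>{0..t}. ennreal ((simple_process (n k) (p k) (\<xi> k) s \<omega> - H s \<omega>)\<^sup>2) \<partial>lborel)
           > ennreal (\<eta>\<^sup>2 / (1 + \<eta>))} +
         prob {\<omega>\<in>space M. \<exists>v\<in>{0..t}. \<bar>simple_integral B (n k) (p k) (\<xi> k) v \<omega> - I v \<omega>\<bar> > \<eta>}) \<longlonglongrightarrow> 0"
      by simp
    show "\<forall>\<^sub>F k in sequentially. prob (bad \<eta> k) \<le> prob {\<omega>\<in>space M. (\<integral>\<^sup>+s\<in>{0..t}. ennreal ((simple_process (n k) (p k) (\<xi> k) s \<omega> - H s \<omega>)\<^sup>2) \<partial>lborel)
           > ennreal (\<eta>\<^sup>2 / (1 + \<eta>))} +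
         prob {\<omega>\<in>space M. \<exists>v\<in>{0..t}. \<bar>simple_integral B (n k) (p k) (\<xi> k) v \<omega> - I v \<omega>\<bar> > \<eta>}"
      unfolding bad_def
      by (intro always_eventually allI measure_Un_le ito_bad_set[OF s H I \<open>0 \<le> t\<close>])
  qed auto
  \<comment> \<open>The integral of the squared integrand is finite almost surely but need not be
    bounded; \<open>rem j\<close> is the mass lost by pretending that it is at most
    \<open>j\<close>.\<close>
  define rem where "rem j = prob {\<omega>\<in>space M. Q t \<omega> > ennreal (real j)}" for j :: nat
  have rem_lim: "rem \<longlonglongrightarrow> 0"
  proof -
    have "decseq (\<lambda>j. {\<omega>\<in>space M. Q t \<omega> > ennreal (real j)})"
      unfolding decseq_def
    proof safe
      fix i j :: nat and \<omega> assume ij: "i \<le> j" and Qj: "ennreal (real j) < Q t \<omega>"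
      have "ennreal (real i) \<le> ennreal (real j)" using ij by (intro ennreal_leI) simp
      from order_le_less_trans[OF this Qj] show "ennreal (real i) < Q t \<omega>" .
    qed
    then have "(\<lambda>j. prob {\<omega>\<in>space M. Q t \<omega> > ennreal (real j)}) \<longlonglongrightarrow> prob (\<Inter>j. {\<omega>\<in>space M. Q t \<omega> > ennreal (real j)})"
      by (intro finite_Lim_measure_decseq) auto
    also have "prob (\<Inter>j. {\<omega>\<in>space M. Q t \<omega> > ennreal (real j)}) = 0"
    proof (rule measure_eq_0_null_sets)
      have "AE \<omega> in M. \<omega> \<notin> (\<Inter>j. {\<omega>\<in>space M. Q t \<omega> > ennreal (real j)})"
        using fin
      proof eventually_elim
        fix \<omega> assume "(\<integral>\<^sup>+s\<in>{u..t}. ennreal ((H s \<omega>)\<^sup>2) \<partial>lborel) < \<infinity>"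
        then have "Q t \<omega> < \<infinity>" by (simp add: Q_def)
        then obtain j where "Q t \<omega> < of_nat j" using ennreal_Ex_less_of_nat by auto
        then show "\<omega> \<notin> (\<Inter>j. {\<omega>\<in>space M. Q t \<omega> > ennreal (real j)})"
          by (auto simp: ennreal_of_nat_eq_real_of_nat intro!: exI[of _ j])
      qed
      then show "(\<Inter>j. {\<omega>\<in>space M. Q t \<omega> > ennreal (real j)}) \<in> null_sets M"
        by (subst AE_iff_null_sets) auto
    qed
    finally show ?thesis by (simp add: rem_def[abs_def])
  qed
  \<comment> \<open>Bound for the discrepancy of the exponents: \<open>2 * \<eta>\<close> from the
    stochastic integrals at the two end points, and \<eta> times \<open>K + 1\<close>, with
    \<open>K = 2 * real j + 1\<close>, from the quadratic variations.\<close>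
  define \<kappa> where "\<kappa> \<eta> j = 2 * \<bar>c\<bar> * \<eta> + c\<^sup>2 / 2 * (\<eta> * (2 * real j + 2))" for \<eta> and j :: nat
  \<comment> \<open>The limits are taken in the order k to infinity, \<eta> to 0, j to infinity. The
    factor \<open>C / \<eta>\<close> is why \<eta> is held fixed while the probability of
    \<open>bad\<close> vanishes.\<close>
  have main: "a \<le> exp (\<kappa> \<eta> j) * (l + C * rem j) + C * \<eta> * exp (c\<^sup>2 * (2 * real j + 1)) + C / \<eta> * prob (bad \<eta> k)
      \<and> l \<le> exp (\<kappa> \<eta> j) * a + C * rem j + C * prob (bad \<eta> k)"
    if \<eta>: "0 < \<eta>" "\<eta> \<le> 1" for \<eta> j k
  proof -
    \<comment> \<open>Off \<open>R\<close> and off \<open>bad\<close> the simple integrand has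
      square integral at most \<open>(1 + \<eta>) * j + \<eta>\<close>. As \<eta> is at most 1 this
      stays below \<open>?K\<close>, so the truncation does not act there.\<close>
    let ?K = "2 * real j + 1"
    let ?f = "simple_process (n k) (p k) (\<xi> k)" and ?J = "simple_integral B (n k) (p k) (\<xi> k)"
    have K0: "0 \<le> ?K" by simp
    obtain D :: "'a \<Rightarrow> real" where D[measurable]: "D \<in> borel_measurable M" and D0: "\<And>\<omega>. 0 \<le> D \<omega>"
      and D1: "\<And>\<Phi>. \<Phi> \<in> borel_measurable (F u) \<Longrightarrow> (\<integral>\<^sup>+\<omega>. \<Phi> \<omega> * ennreal (D \<omega>) \<partial>M) = (\<integral>\<^sup>+\<omega>. \<Phi> \<omega> \<partial>M)"
      and D2: "(\<integral>\<^sup>+\<omega>. ennreal ((D \<omega>)\<^sup>2) \<partial>M) \<le> ennreal (exp (c\<^sup>2 * ?K))"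
      and Dw: "\<And>\<omega>. \<exists>v\<in>{u..t}. \<exists>A. 0 \<le> A \<and> A \<le> ?K \<and>
         (\<integral>\<^sup>+s\<in>{u..v}. ennreal ((?f s \<omega>)\<^sup>2) \<partial>lborel) = ennreal A \<and>
         D \<omega> = exp (c * (?J v \<omega> - ?J u \<omega>) - c\<^sup>2 / 2 * A) \<and>
         ((\<integral>\<^sup>+s\<in>{u..t}. ennreal ((?f s \<omega>)\<^sup>2) \<partial>lborel) \<le> ennreal ?K \<longrightarrow> v = t)"
      by (rule truncated_exponential[OF s u K0]) blast
    have aD: "(\<integral>\<^sup>+\<omega>. ennreal (\<Phi> \<omega> * D \<omega>) \<partial>M) = ennreal a"
      using D1[of "\<lambda>\<omega>. ennreal (\<Phi> \<omega>)"] \<Phi> D0 a by (simp add: ennreal_mult)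
    define R where "R = {\<omega>\<in>space M. Q t \<omega> > ennreal (real j)}"
    have [measurable]: "R \<in> sets M" unfolding R_def by measurable
    have good: "\<Phi> \<omega> * D \<omega> \<le> exp (\<kappa> \<eta> j) * C"
        "\<omega> \<notin> R \<Longrightarrow> \<Phi> \<omega> * D \<omega> \<le> exp (\<kappa> \<eta> j) * L t \<omega>"
        "\<omega> \<notin> R \<Longrightarrow> L t \<omega> \<le> exp (\<kappa> \<eta> j) * (\<Phi> \<omega> * D \<omega>)"
      if \<omega>: "\<omega> \<in> space M" "\<omega> \<notin> bad \<eta> k" and bd: "\<forall>v\<in>{u..t}. L v \<omega> \<le> C" and Qfin: "Q t \<omega> < \<infinity>" for \<omega>
    proof -
      have e: "(\<integral>\<^sup>+s\<in>{0..t}. ennreal ((?f s \<omega> - H s \<omega>)\<^sup>2) \<partial>lborel) \<le> ennreal (\<eta>\<^sup>2 / (1 + \<eta>))"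
        and JI: "\<And>v. v \<in> {0..t} \<Longrightarrow> \<bar>?J v \<omega> - I v \<omega>\<bar> \<le> \<eta>"
        using \<omega> by (auto simp: bad_def not_less)
      obtain v A where v: "v \<in> {u..t}" and A: "0 \<le> A" "A \<le> ?K"
        and fA: "(\<integral>\<^sup>+s\<in>{u..v}. ennreal ((?f s \<omega>)\<^sup>2) \<partial>lborel) = ennreal A"
        and DA: "D \<omega> = exp (c * (?J v \<omega> - ?J u \<omega>) - c\<^sup>2 / 2 * A)"
        and vt: "(\<integral>\<^sup>+s\<in>{u..t}. ennreal ((?f s \<omega>)\<^sup>2) \<partial>lborel) \<le> ennreal ?K \<longrightarrow> v = t"
        using Dw[of \<omega>] by blast
      have e': "(\<integral>\<^sup>+s\<in>{u..w}. ennreal ((?f s \<omega> - H s \<omega>)\<^sup>2) \<partial>lborel) \<le> ennreal (\<eta>\<^sup>2 / (1 + \<eta>))"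
        if "w \<in> {u..t}" for w
        by (rule order_trans[OF nn_integral_mono e]) (use that u in \<open>auto simp: indicator_def\<close>)
      have Hm: "(\<lambda>s. H s \<omega> * indicator {u..w} s) \<in> borel_measurable lborel" if "w \<in> {u..t}" for w
        using progressively_measurable_path[OF H \<open>0 \<le> t\<close> u(1), of w \<omega>] that \<omega> by (simp add: space_F)
      have fm: "(\<lambda>s. ?f s \<omega> * indicator {u..w} s) \<in> borel_measurable lborel" for w
        unfolding simple_process_def by measurable
      have Qle: "Q v \<omega> \<le> ennreal (1 + \<eta>) * ennreal A + ennreal \<eta>"
        unfolding Q_def fA[symmetric] using e'[OF v] Hm[OF v] fm[of v] \<eta>
        by (intro nn_integral_square_le_weighted) (auto simp: power2_commute)
      have Qv: "enn2real (Q v \<omega>) \<le> (1 + \<eta>) * A + \<eta>"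
        using enn2real_mono[OF Qle] \<eta> A by (simp flip: ennreal_mult ennreal_plus)
      have fle: "(\<integral>\<^sup>+s\<in>{u..t}. ennreal ((?f s \<omega>)\<^sup>2) \<partial>lborel) \<le> ennreal (1 + \<eta>) * Q t \<omega> + ennreal \<eta>"
        unfolding Q_def using e'[of t] Hm[of t] fm[of t] \<eta> u
        by (intro nn_integral_square_le_weighted) auto
      have "\<eta> * A \<le> \<eta> * ?K" using A \<eta> by (intro mult_left_mono) auto
      then have QA: "enn2real (Q v \<omega>) - A \<le> \<eta> * (2 * real j + 2)"
        using Qv by (simp add: algebra_simps)
      have Jd: "\<bar>(?J v \<omega> - ?J u \<omega>) - (I v \<omega> - I u \<omega>)\<bar> \<le> 2 * \<eta>"
        using JI[of v] JI[of u] v u by auto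
      have "\<bar>c * ((?J v \<omega> - ?J u \<omega>) - (I v \<omega> - I u \<omega>))\<bar> \<le> \<bar>c\<bar> * (2 * \<eta>)"
        unfolding abs_mult by (intro mult_left_mono Jd) simp
      then have cJ: "\<bar>c * (?J v \<omega> - ?J u \<omega>) - c * (I v \<omega> - I u \<omega>)\<bar> \<le> 2 * \<bar>c\<bar> * \<eta>"
        by (simp add: algebra_simps)
      have "c\<^sup>2 / 2 * (enn2real (Q v \<omega>) - A) \<le> c\<^sup>2 / 2 * (\<eta> * (2 * real j + 2))"
        by (intro mult_left_mono QA) simp
      then have "c * (?J v \<omega> - ?J u \<omega>) - c\<^sup>2 / 2 * A \<le> \<kappa> \<eta> j + (c * (I v \<omega> - I u \<omega>) - c\<^sup>2 / 2 * enn2real (Q v \<omega>))"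
        using cJ unfolding \<kappa>_def by (simp add: right_diff_distrib)
      then have "D \<omega> \<le> exp (\<kappa> \<eta> j) * exp (c * (I v \<omega> - I u \<omega>) - c\<^sup>2 / 2 * enn2real (Q v \<omega>))"
        unfolding DA by (simp flip: exp_add)
      from mult_left_mono[OF this \<Phi>(2)[of \<omega>]]
      have DL: "\<Phi> \<omega> * D \<omega> \<le> exp (\<kappa> \<eta> j) * L v \<omega>" by (simp add: L_def ac_simps)
      also have "\<dots> \<le> exp (\<kappa> \<eta> j) * C" using bd v by auto
      finally show "\<Phi> \<omega> * D \<omega> \<le> exp (\<kappa> \<eta> j) * C" .
      assume "\<omega> \<notin> R"
      then have Qj: "Q t \<omega> \<le> ennreal (real j)" using \<omega> by (auto simp: R_def not_less)
      have "(\<integral>\<^sup>+s\<in>{u..t}. ennreal ((?f s \<omega>)\<^sup>2) \<partial>lborel) \<le> ennreal (1 + \<eta>) * ennreal (real j) + ennreal \<eta>"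
        using fle by (rule order_trans) (intro add_right_mono mult_left_mono Qj, simp)
      also have "\<dots> = ennreal ((1 + \<eta>) * real j + \<eta>)"
        using \<eta> by (simp flip: ennreal_mult ennreal_plus)
      also have "\<dots> \<le> ennreal ?K"
        using \<eta> mult_left_le_one_le[of "real j" \<eta>] by (intro ennreal_leI) (simp add: algebra_simps)
      finally have v_t: "v = t" using vt by simp
      with DL show "\<Phi> \<omega> * D \<omega> \<le> exp (\<kappa> \<eta> j) * L t \<omega>" by simp
      have Qr: "Q t \<omega> = ennreal (enn2real (Q t \<omega>))" using Qfin by simp
      have "ennreal A \<le> ennreal ((1 + \<eta>) * enn2real (Q t \<omega>) + \<eta>)"
        using fle fA \<eta> unfolding v_t by (subst (asm) Qr) (simp flip: ennreal_mult ennreal_plus)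
      then have "A \<le> (1 + \<eta>) * enn2real (Q t \<omega>) + \<eta>"
        using \<eta> by (subst (asm) ennreal_le_iff) auto
      moreover have "\<eta> * enn2real (Q t \<omega>) \<le> \<eta> * real j"
        using Qj \<eta> by (intro mult_left_mono) (auto simp: enn2real_leI)
      moreover have "0 \<le> \<eta> * real j" using \<eta> by simp
      moreover have "(1 + \<eta>) * enn2real (Q t \<omega>) = enn2real (Q t \<omega>) + \<eta> * enn2real (Q t \<omega>)"
        "\<eta> * (2 * real j + 2) = 2 * (\<eta> * real j) + 2 * \<eta>" by (simp_all add: algebra_simps)
      ultimately have AQ: "A - enn2real (Q t \<omega>) \<le> \<eta> * (2 * real j + 2)"
        using \<eta> by linarith
      have "c\<^sup>2 / 2 * (A - enn2real (Q t \<omega>)) \<le> c\<^sup>2 / 2 * (\<eta> * (2 * real j + 2))"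
        by (intro mult_left_mono AQ) simp
      then have "c * (I v \<omega> - I u \<omega>) - c\<^sup>2 / 2 * enn2real (Q v \<omega>) \<le> \<kappa> \<eta> j + (c * (?J v \<omega> - ?J u \<omega>) - c\<^sup>2 / 2 * A)"
        using cJ unfolding \<kappa>_def v_t by (simp add: right_diff_distrib)
      then have "exp (c * (I v \<omega> - I u \<omega>) - c\<^sup>2 / 2 * enn2real (Q v \<omega>)) \<le> exp (\<kappa> \<eta> j) * D \<omega>"
        unfolding DA by (simp flip: exp_add)
      from mult_left_mono[OF this \<Phi>(2)[of \<omega>]]
      show "L t \<omega> \<le> exp (\<kappa> \<eta> j) * (\<Phi> \<omega> * D \<omega>)" by (simp add: L_def v_t ac_simps)
    qed
    have Qfin: "AE \<omega> in M. Q t \<omega> < \<infinity>" using fin by (simp add: Q_def)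
    have "ennreal a \<le> (\<integral>\<^sup>+\<omega>. ennreal (exp (\<kappa> \<eta> j)) * ennreal (L t \<omega>) + ennreal (exp (\<kappa> \<eta> j) * C) * indicator R \<omega>
        + ennreal (C * \<eta>) * ennreal ((D \<omega>)\<^sup>2) + ennreal (C / \<eta>) * indicator (bad \<eta> k) \<omega> \<partial>M)"
      unfolding aD[symmetric]
    proof (rule nn_integral_mono_AE, use bound' Qfin \<Phi>C AE_space in eventually_elim)
      fix \<omega> assume as: "\<forall>v\<in>{u..t}. L v \<omega> \<le> C" "Q t \<omega> < \<infinity>" "\<Phi> \<omega> \<le> C" "\<omega> \<in> space M"
      have "\<Phi> \<omega> * D \<omega> \<le> exp (\<kappa> \<eta> j) * L t \<omega> + (exp (\<kappa> \<eta> j) * C) * indicator R \<omega>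
        + (C * \<eta>) * (D \<omega>)\<^sup>2 + (C / \<eta>) * indicator (bad \<eta> k) \<omega>"
      proof (cases "\<omega> \<in> bad \<eta> k")
        case True
        \<comment> \<open>On the bad event nothing is known about \<open>D\<close> pointwise.
          Young's inequality splits it into a small multiple of its square, covered by the L2 bound,
          and a constant, covered by the small probability.\<close>
        have "D \<omega> \<le> \<eta> * (D \<omega>)\<^sup>2 + 1 / \<eta>"
        proof -
          have "0 \<le> (\<eta> * D \<omega> - 1)\<^sup>2 + \<eta> * D \<omega>" using \<eta> D0[of \<omega>] by simp
          then show ?thesis using \<eta> by (simp add: field_simps power2_eq_square)
        qed
        from mult_mono[OF as(3) this C D0]
        have "\<Phi> \<omega> * D \<omega> \<le> C * \<eta> * (D \<omega>)\<^sup>2 + C / \<eta>" by (simp add: algebra_simps)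
        moreover have "0 \<le> exp (\<kappa> \<eta> j) * L t \<omega>" "0 \<le> exp (\<kappa> \<eta> j) * C * indicator R \<omega>"
          using L0[of t \<omega>] C by auto
        ultimately show ?thesis using True by simp
      next
        case False
        note g = good[OF as(4) False as(1,2)]
        have "\<Phi> \<omega> * D \<omega> \<le> exp (\<kappa> \<eta> j) * L t \<omega> + (exp (\<kappa> \<eta> j) * C) * indicator R \<omega>"
          using g L0[of t \<omega>] by (cases "\<omega> \<in> R") (auto simp: add_increasing)
        then show ?thesis using False C \<eta> by (simp add: add_increasing2)
      qed
      then show "ennreal (\<Phi> \<omega> * D \<omega>) \<le> ennreal (exp (\<kappa> \<eta> j)) * ennreal (L t \<omega>) + ennreal (exp (\<kappa> \<eta> j) * C) * indicator R \<omega>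
        + ennreal (C * \<eta>) * ennreal ((D \<omega>)\<^sup>2) + ennreal (C / \<eta>) * indicator (bad \<eta> k) \<omega>"
        using C \<eta> L0[of t \<omega>]
        by (cases "\<omega> \<in> R"; cases "\<omega> \<in> bad \<eta> k") (simp_all flip: ennreal_mult ennreal_plus)
    qed
    also have "\<dots> = ennreal (exp (\<kappa> \<eta> j)) * ennreal l + ennreal (exp (\<kappa> \<eta> j) * C) * emeasure M R
        + ennreal (C * \<eta>) * (\<integral>\<^sup>+\<omega>. ennreal ((D \<omega>)\<^sup>2) \<partial>M) + ennreal (C / \<eta>) * emeasure M (bad \<eta> k)"
      by (simp add: nn_integral_add nn_integral_cmult l)
    also have "\<dots> \<le> ennreal (exp (\<kappa> \<eta> j)) * ennreal l + ennreal (exp (\<kappa> \<eta> j) * C) * emeasure M R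
        + ennreal (C * \<eta>) * ennreal (exp (c\<^sup>2 * ?K)) + ennreal (C / \<eta>) * emeasure M (bad \<eta> k)"
      by (intro add_mono mult_left_mono D2) auto
    also have "\<dots> = ennreal (exp (\<kappa> \<eta> j) * l + exp (\<kappa> \<eta> j) * C * rem j
        + C * \<eta> * exp (c\<^sup>2 * ?K) + C / \<eta> * prob (bad \<eta> k))"
      using C \<eta> l0 by (simp add: emeasure_eq_measure rem_def R_def flip: ennreal_mult ennreal_plus)
    finally have 1: "a \<le> exp (\<kappa> \<eta> j) * l + exp (\<kappa> \<eta> j) * C * rem j
        + C * \<eta> * exp (c\<^sup>2 * ?K) + C / \<eta> * prob (bad \<eta> k)"
      using C \<eta> l0 by (subst (asm) ennreal_le_iff) (auto simp: rem_def intro!: add_nonneg_nonneg)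
    have "ennreal l \<le> (\<integral>\<^sup>+\<omega>. ennreal (exp (\<kappa> \<eta> j)) * ennreal (\<Phi> \<omega> * D \<omega>) + ennreal C * indicator R \<omega>
        + ennreal C * indicator (bad \<eta> k) \<omega> \<partial>M)"
      unfolding l[symmetric]
    proof (rule nn_integral_mono_AE, use bound' Qfin AE_space in eventually_elim)
      fix \<omega> assume as: "\<forall>v\<in>{u..t}. L v \<omega> \<le> C" "Q t \<omega> < \<infinity>" "\<omega> \<in> space M"
      have LC: "L t \<omega> \<le> C" using as(1) u by auto
      have PD: "0 \<le> \<Phi> \<omega> * D \<omega>" using \<Phi>(2) D0 by simp
      have "L t \<omega> \<le> exp (\<kappa> \<eta> j) * (\<Phi> \<omega> * D \<omega>) + C * indicator R \<omega> + C * indicator (bad \<eta> k) \<omega>"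
      proof (cases "\<omega> \<in> bad \<eta> k \<or> \<omega> \<in> R")
        case True
        then show ?thesis using LC C PD by (auto simp: indicator_def add_increasing)
      next
        case False
        then show ?thesis using good(3)[OF as(3) _ as(1,2)] by simp
      qed
      then show "ennreal (L t \<omega>) \<le> ennreal (exp (\<kappa> \<eta> j)) * ennreal (\<Phi> \<omega> * D \<omega>) + ennreal C * indicator R \<omega>
        + ennreal C * indicator (bad \<eta> k) \<omega>"
        using C PD
        by (cases "\<omega> \<in> R"; cases "\<omega> \<in> bad \<eta> k") (simp_all flip: ennreal_mult ennreal_plus)
    qed
    also have "\<dots> = ennreal (exp (\<kappa> \<eta> j)) * ennreal a + ennreal C * emeasure M R
        + ennreal C * emeasure M (bad \<eta> k)"
      by (simp add: nn_integral_add nn_integral_cmult aD)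
    also have "\<dots> = ennreal (exp (\<kappa> \<eta> j) * a + C * rem j + C * prob (bad \<eta> k))"
      using C a0 by (simp add: emeasure_eq_measure rem_def R_def flip: ennreal_mult ennreal_plus)
    finally have 2: "l \<le> exp (\<kappa> \<eta> j) * a + C * rem j + C * prob (bad \<eta> k)"
      using C a0 by (subst (asm) ennreal_le_iff) (auto simp: rem_def intro!: add_nonneg_nonneg)
    from 1 2 show ?thesis by (simp add: algebra_simps)
  qed
  have main2: "a \<le> exp (\<kappa> \<eta> j) * (l + C * rem j) + C * \<eta> * exp (c\<^sup>2 * (2 * real j + 1))
      \<and> l \<le> exp (\<kappa> \<eta> j) * a + C * rem j" if \<eta>: "0 < \<eta>" "\<eta> \<le> 1" for \<eta> j
  proof
    have "(\<lambda>k. exp (\<kappa> \<eta> j) * (l + C * rem j) + C * \<eta> * exp (c\<^sup>2 * (2 * real j + 1)) + C / \<eta> * prob (bad \<eta> k))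
      \<longlonglongrightarrow> exp (\<kappa> \<eta> j) * (l + C * rem j) + C * \<eta> * exp (c\<^sup>2 * (2 * real j + 1)) + C / \<eta> * 0"
      by (intro tendsto_intros bad_lim \<eta>)
    from LIMSEQ_le_const[OF this] main[OF \<eta>]
    show "a \<le> exp (\<kappa> \<eta> j) * (l + C * rem j) + C * \<eta> * exp (c\<^sup>2 * (2 * real j + 1))" by auto
    have "(\<lambda>k. exp (\<kappa> \<eta> j) * a + C * rem j + C * prob (bad \<eta> k)) \<longlonglongrightarrow> exp (\<kappa> \<eta> j) * a + C * rem j + C * 0"
      by (intro tendsto_intros bad_lim \<eta>)
    from LIMSEQ_le_const[OF this] main[OF \<eta>]
    show "l \<le> exp (\<kappa> \<eta> j) * a + C * rem j" by auto
  qed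
  have main3: "a \<le> l + C * rem j \<and> l \<le> a + C * rem j" for j
  proof
    have ev: "\<forall>\<^sub>F \<eta> in at_right 0. 0 < \<eta> \<and> \<eta> \<le> (1::real)"
      unfolding eventually_at_right_field by (intro exI[of _ 1]) auto
    have \<kappa>0: "((\<lambda>\<eta>. exp (\<kappa> \<eta> j)) \<longlongrightarrow> exp (2 * \<bar>c\<bar> * 0 + c\<^sup>2 / 2 * (0 * (2 * real j + 2)))) (at_right 0)"
      unfolding \<kappa>_def by (intro tendsto_intros)
    have "((\<lambda>\<eta>. exp (\<kappa> \<eta> j) * (l + C * rem j) + C * \<eta> * exp (c\<^sup>2 * (2 * real j + 1)))
      \<longlongrightarrow> exp (2 * \<bar>c\<bar> * 0 + c\<^sup>2 / 2 * (0 * (2 * real j + 2))) * (l + C * rem j) + C * 0 * exp (c\<^sup>2 * (2 * real j + 1))) (at_right 0)"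
      by (intro tendsto_intros \<kappa>0)
    from tendsto_lowerbound[OF this eventually_mono[OF ev conjunct1[OF main2]]]
    show "a \<le> l + C * rem j" by simp
    have "((\<lambda>\<eta>. exp (\<kappa> \<eta> j) * a + C * rem j)
      \<longlongrightarrow> exp (2 * \<bar>c\<bar> * 0 + c\<^sup>2 / 2 * (0 * (2 * real j + 2))) * a + C * rem j) (at_right 0)"
      by (intro tendsto_intros \<kappa>0)
    from tendsto_lowerbound[OF this eventually_mono[OF ev conjunct2[OF main2]]]
    show "l \<le> a + C * rem j" by simp
  qed
  have "(\<lambda>j. l + C * rem j) \<longlonglongrightarrow> l + C * 0" "(\<lambda>j. a + C * rem j) \<longlonglongrightarrow> a + C * 0"
    by (intro tendsto_intros rem_lim)+
  from this[THEN LIMSEQ_le_const] main3 have "a \<le> l" "l \<le> a" by auto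
  then have "a = l" by simp
  then show ?thesis using a l by (simp add: L_def Q_def)
qed

end

subsection \<open>The Laplace transform of the squared Bessel transition kernel\<close>

text \<open>Nonnegativity everywhere is no restriction: \<open>\<bar>Y\<bar>\<close> has the same It\^o integrand as \<open>Y\<close>.\<close>

locale squared_bessel_setting = brownian_setting +
  fixes Y I :: "real \<Rightarrow> 'a \<Rightarrow> real" and \<delta> :: real
  assumes Y_adapted: "adapted F Y" and Y_paths: "continuous_paths M Y"
    and Y_nonneg: "0 \<le> Y t \<omega>" and Y_0: "AE \<omega> in M. Y 0 \<omega> = 0" and \<delta>_pos: "0 < \<delta>"
    and Y_ito: "ito_integral M F B (\<lambda>t \<omega>. 2 * sqrt (Y t \<omega>)) I"
    and Y_eq: "AE \<omega> in M. \<forall>t\<ge>0. Y t \<omega> = Y 0 \<omega> + \<delta> * t + I t \<omega>"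
begin

lemma Y_F_measurable: "0 \<le> t \<Longrightarrow> Y t \<in> borel_measurable (F t)"
  using Y_adapted by (simp add: adapted_def)

lemma Y_measurable: "0 \<le> t \<Longrightarrow> Y t \<in> borel_measurable M"
  by (rule F_measurable_M[OF Y_F_measurable])

lemma Y_continuous: "\<omega> \<in> space M \<Longrightarrow> continuous_on {0..} (\<lambda>t. Y t \<omega>)"
  using Y_paths by (simp add: continuous_paths_def)

lemma Y_continuous': "\<omega> \<in> space M \<Longrightarrow> 0 \<le> u \<Longrightarrow> continuous_on {u..t} (\<lambda>t. Y t \<omega>)"
  by (rule continuous_on_subset[OF Y_continuous]) auto

text \<open>The Ito integrand \<open>2 * sqrt (Y t)\<close> is progressively measurable by
  definition of the integral, and \<open>Y\<close> is recovered from it by halving and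
  squaring.\<close>

lemma Y_progressive: "progressively_measurable F Y"
  unfolding progressively_measurable_def
proof safe
  fix T :: real assume "0 \<le> T"
  then have [measurable]: "(\<lambda>(t, \<omega>). 2 * sqrt (Y t \<omega>)) \<in> borel_measurable (restrict_space borel {0..T} \<Otimes>\<^sub>M F T)"
    using Y_ito by (simp add: ito_integral_def progressively_measurable_def)
  have "(\<lambda>p. ((case p of (t, \<omega>) \<Rightarrow> 2 * sqrt (Y t \<omega>)) / 2)\<^sup>2) \<in> borel_measurable (restrict_space borel {0..T} \<Otimes>\<^sub>M F T)"
    by measurable
  then show "(\<lambda>(t, \<omega>). Y t \<omega>) \<in> borel_measurable (restrict_space borel {0..T} \<Otimes>\<^sub>M F T)"
    using Y_nonneg by (simp add: case_prod_beta)
qed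

text \<open>\<open>4 * J u t\<close> is the quadratic variation of \<open>I\<close> between
  \<open>u\<close> and \<open>t\<close>.\<close>

definition J :: "real \<Rightarrow> real \<Rightarrow> 'a \<Rightarrow> real" where "J u t \<omega> = integral {u..t} (\<lambda>s. Y s \<omega>)"

lemma nn_integral_Y: "\<omega> \<in> space M \<Longrightarrow> 0 \<le> u \<Longrightarrow> (\<integral>\<^sup>+s\<in>{u..t}. ennreal (Y s \<omega>) \<partial>lborel) = ennreal (J u t \<omega>)"
  unfolding J_def using Y_nonneg
  by (intro nn_integral_has_integral_lebesgue' integrable_integral integrable_continuous_real Y_continuous') auto

lemma J_nonneg: "\<omega> \<in> space M \<Longrightarrow> 0 \<le> u \<Longrightarrow> 0 \<le> J u t \<omega>"
  unfolding J_def using Y_nonneg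
  by (intro integral_nonneg integrable_continuous_real Y_continuous') auto

lemma J_measurable: 
  assumes "0 \<le> u" "u \<le> t" shows "J u t \<in> borel_measurable M"
proof -
  have "(\<lambda>\<omega>. enn2real (\<integral>\<^sup>+s\<in>{u..t}. ennreal (Y s \<omega>) \<partial>lborel)) \<in> borel_measurable M"
    using F_measurable_M[OF progressively_measurable_nn_integral[OF Y_progressive, of t u t ennreal]] assms by simp
  also have "?this \<longleftrightarrow> J u t \<in> borel_measurable M"
    using assms by (intro measurable_cong) (simp add: nn_integral_Y J_nonneg)
  finally show ?thesis .
qed

text \<open>\<open>exponential_ito_integral\<close> with \<open>c = - \<theta>\<close>. The weight
  \<open>exp (- \<theta> * Y u)\<close> completes the increment of \<open>Y\<close> to
  \<open>Y v\<close>; since \<open>Y v\<close> and \<open>J u v\<close> are nonnegative, only the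
  drift factor remains, which gives the deterministic bound \<open>C\<close>.\<close>

lemma exponential_martingale_set:
  assumes u: "0 \<le> u" "u \<le> t" and A: "A \<in> sets (F u)" and \<theta>: "0 \<le> \<theta>"
  shows "(\<integral>\<^sup>+\<omega>. indicator A \<omega> * ennreal (exp (- \<theta> * Y t \<omega> - 2 * \<theta>\<^sup>2 * J u t \<omega>)) \<partial>M)
    = (\<integral>\<^sup>+\<omega>. indicator A \<omega> * ennreal (exp (- \<theta> * \<delta> * (t - u)) * exp (- \<theta> * Y u \<omega>)) \<partial>M)"
proof -
  let ?H = "\<lambda>t \<omega>. 2 * sqrt (Y t \<omega>)"
  let ?\<Phi> = "\<lambda>\<omega>. indicator A \<omega> * exp (- \<theta> * Y u \<omega>)"
  have Q: "(\<integral>\<^sup>+s\<in>{u..v}. ennreal ((?H s \<omega>)\<^sup>2) \<partial>lborel) = ennreal (4 * J u v \<omega>)" if "\<omega> \<in> space M" for v \<omega>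
  proof -
    have "(\<integral>\<^sup>+s\<in>{u..v}. ennreal ((?H s \<omega>)\<^sup>2) \<partial>lborel) = (\<integral>\<^sup>+s\<in>{u..v}. ennreal (4 * Y s \<omega>) \<partial>lborel)"
      using Y_nonneg by (simp add: power_mult_distrib)
    also have "\<dots> = ennreal (4 * J u v \<omega>)"
      unfolding J_def integral_mult_right[symmetric] using Y_nonneg u that
      by (intro nn_integral_has_integral_lebesgue' integrable_integral integrable_continuous_real continuous_intros Y_continuous') auto
    finally show ?thesis .
  qed
  have ex: "?\<Phi> \<omega> * exp (- \<theta> * (I v \<omega> - I u \<omega>) - (- \<theta>)\<^sup>2 / 2 * enn2real (\<integral>\<^sup>+s\<in>{u..v}. ennreal ((?H s \<omega>)\<^sup>2) \<partial>lborel))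
      = exp (\<theta> * \<delta> * (v - u)) * (indicator A \<omega> * exp (- \<theta> * Y v \<omega> - 2 * \<theta>\<^sup>2 * J u v \<omega>))"
    if "\<omega> \<in> space M" "\<forall>t\<ge>0. Y t \<omega> = Y 0 \<omega> + \<delta> * t + I t \<omega>" "v \<in> {u..t}" for v \<omega>
  proof -
    have "I v \<omega> - I u \<omega> = Y v \<omega> - Y u \<omega> - \<delta> * (v - u)"
      using spec[OF that(2), of u] spec[OF that(2), of v] that(3) u by (simp add: algebra_simps)
    note I_diff = this
    have d: "- \<theta> * Y u \<omega> + (- \<theta> * (I v \<omega> - I u \<omega>) - (- \<theta>)\<^sup>2 / 2 * (4 * J u v \<omega>))
        = \<theta> * \<delta> * (v - u) + (- \<theta> * Y v \<omega> - 2 * \<theta>\<^sup>2 * J u v \<omega>)"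
      unfolding I_diff by (simp add: algebra_simps)
    have "enn2real (\<integral>\<^sup>+s\<in>{u..v}. ennreal ((?H s \<omega>)\<^sup>2) \<partial>lborel) = 4 * J u v \<omega>"
      unfolding Q[OF that(1)] using J_nonneg[OF that(1) u(1), of v] by simp
    then show ?thesis using arg_cong[OF d, of exp] unfolding exp_add by (simp add: mult_ac)
  qed
  have [measurable]: "Y u \<in> borel_measurable (F u)" using Y_F_measurable u by simp
  note [measurable] = A
  have "(\<integral>\<^sup>+\<omega>. ennreal (?\<Phi> \<omega> * exp (- \<theta> * (I t \<omega> - I u \<omega>) - (- \<theta>)\<^sup>2 / 2 * 
        enn2real (\<integral>\<^sup>+s\<in>{u..t}. ennreal ((?H s \<omega>)\<^sup>2) \<partial>lborel))) \<partial>M) = (\<integral>\<^sup>+\<omega>. ennreal (?\<Phi> \<omega>) \<partial>M)"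
  proof (rule exponential_ito_integral[OF Y_ito u, where C = "exp (\<theta> * \<delta> * (t - u))"])
    show "AE \<omega> in M. (\<integral>\<^sup>+s\<in>{u..t}. ennreal ((?H s \<omega>)\<^sup>2) \<partial>lborel) < \<infinity>"
      using AE_space by eventually_elim (subst Q, simp_all)
    show "?\<Phi> \<in> borel_measurable (F u)" by measurable
    show "AE \<omega> in M. \<forall>v\<in>{u..t}. ?\<Phi> \<omega> * exp (- \<theta> * (I v \<omega> - I u \<omega>) - (- \<theta>)\<^sup>2 / 2 *
          enn2real (\<integral>\<^sup>+s\<in>{u..v}. ennreal ((?H s \<omega>)\<^sup>2) \<partial>lborel)) \<le> exp (\<theta> * \<delta> * (t - u))"
      using Y_eq AE_space
    proof eventually_elim
      fix \<omega> assume as: "\<forall>t\<ge>0. Y t \<omega> = Y 0 \<omega> + \<delta> * t + I t \<omega>" "\<omega> \<in> space M"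
      show "\<forall>v\<in>{u..t}. ?\<Phi> \<omega> * exp (- \<theta> * (I v \<omega> - I u \<omega>) - (- \<theta>)\<^sup>2 / 2 *
          enn2real (\<integral>\<^sup>+s\<in>{u..v}. ennreal ((?H s \<omega>)\<^sup>2) \<partial>lborel)) \<le> exp (\<theta> * \<delta> * (t - u))"
      proof
        fix v assume v: "v \<in> {u..t}"
        have "indicator A \<omega> * exp (- \<theta> * Y v \<omega> - 2 * \<theta>\<^sup>2 * J u v \<omega>) \<le> 1 * 1"
        proof (rule mult_mono)
          have "0 \<le> \<theta> * Y v \<omega>" "0 \<le> 2 * \<theta>\<^sup>2 * J u v \<omega>"
            using \<theta> Y_nonneg[of v \<omega>] J_nonneg[OF as(2) u(1), of v] by auto
          then have "- \<theta> * Y v \<omega> - 2 * \<theta>\<^sup>2 * J u v \<omega> \<le> 0" by linarith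
          then show "exp (- \<theta> * Y v \<omega> - 2 * \<theta>\<^sup>2 * J u v \<omega>) \<le> 1" by (subst exp_le_one_iff)
        qed (auto simp: indicator_def)
        moreover have "exp (\<theta> * \<delta> * (v - u)) \<le> exp (\<theta> * \<delta> * (t - u))"
          using v \<theta> \<delta>_pos by (auto intro!: mult_left_mono)
        ultimately have "exp (\<theta> * \<delta> * (v - u)) * (indicator A \<omega> * exp (- \<theta> * Y v \<omega> - 2 * \<theta>\<^sup>2 * J u v \<omega>)) \<le> exp (\<theta> * \<delta> * (t - u)) * (1 * 1)"
          by - (rule mult_mono, auto)
        then show "?\<Phi> \<omega> * exp (- \<theta> * (I v \<omega> - I u \<omega>) - (- \<theta>)\<^sup>2 / 2 *
          enn2real (\<integral>\<^sup>+s\<in>{u..v}. ennreal ((?H s \<omega>)\<^sup>2) \<partial>lborel)) \<le> exp (\<theta> * \<delta> * (t - u))"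
          unfolding ex[OF as(2,1) v] by simp
      qed
    qed
  qed auto
  also have "(\<integral>\<^sup>+\<omega>. ennreal (?\<Phi> \<omega> * exp (- \<theta> * (I t \<omega> - I u \<omega>) - (- \<theta>)\<^sup>2 / 2 * 
        enn2real (\<integral>\<^sup>+s\<in>{u..t}. ennreal ((?H s \<omega>)\<^sup>2) \<partial>lborel))) \<partial>M)
      = (\<integral>\<^sup>+\<omega>. ennreal (exp (\<theta> * \<delta> * (t - u))) * (indicator A \<omega> * ennreal (exp (- \<theta> * Y t \<omega> - 2 * \<theta>\<^sup>2 * J u t \<omega>))) \<partial>M)"
  proof (rule nn_integral_cong_AE, use Y_eq AE_space in eventually_elim)
    fix \<omega> assume as: "\<forall>t\<ge>0. Y t \<omega> = Y 0 \<omega> + \<delta> * t + I t \<omega>" "\<omega> \<in> space M"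
    show "ennreal (?\<Phi> \<omega> * exp (- \<theta> * (I t \<omega> - I u \<omega>) - (- \<theta>)\<^sup>2 / 2 * 
        enn2real (\<integral>\<^sup>+s\<in>{u..t}. ennreal ((?H s \<omega>)\<^sup>2) \<partial>lborel))) = 
      ennreal (exp (\<theta> * \<delta> * (t - u))) * (indicator A \<omega> * ennreal (exp (- \<theta> * Y t \<omega> - 2 * \<theta>\<^sup>2 * J u t \<omega>)))"
      using u by (subst ex[OF as(2,1)]) (auto simp: ennreal_mult indicator_def)
  qed
  also have "\<dots> = ennreal (exp (\<theta> * \<delta> * (t - u))) * (\<integral>\<^sup>+\<omega>. indicator A \<omega> * ennreal (exp (- \<theta> * Y t \<omega> - 2 * \<theta>\<^sup>2 * J u t \<omega>)) \<partial>M)"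
    using Y_measurable[of t] J_measurable[OF u] u F_sets_M[OF A] by (intro nn_integral_cmult) auto
  finally have *: "ennreal (exp (\<theta> * \<delta> * (t - u))) * (\<integral>\<^sup>+\<omega>. indicator A \<omega> * ennreal (exp (- \<theta> * Y t \<omega> - 2 * \<theta>\<^sup>2 * J u t \<omega>)) \<partial>M)
     = (\<integral>\<^sup>+\<omega>. ennreal (?\<Phi> \<omega>) \<partial>M)" .
  have "(\<integral>\<^sup>+\<omega>. indicator A \<omega> * ennreal (exp (- \<theta> * Y t \<omega> - 2 * \<theta>\<^sup>2 * J u t \<omega>)) \<partial>M)
     = ennreal (exp (- \<theta> * \<delta> * (t - u))) * (ennreal (exp (\<theta> * \<delta> * (t - u))) * (\<integral>\<^sup>+\<omega>. indicator A \<omega> * ennreal (exp (- \<theta> * Y t \<omega> - 2 * \<theta>\<^sup>2 * J u t \<omega>)) \<partial>M))"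
    by (simp flip: mult.assoc ennreal_mult exp_add)
  also have "\<dots> = (\<integral>\<^sup>+\<omega>. ennreal (exp (- \<theta> * \<delta> * (t - u))) * ennreal (?\<Phi> \<omega>) \<partial>M)"
    unfolding * using F_sets_M[OF A] Y_measurable[of u] u by (intro nn_integral_cmult[symmetric]) auto
  also have "\<dots> = (\<integral>\<^sup>+\<omega>. indicator A \<omega> * ennreal (exp (- \<theta> * \<delta> * (t - u)) * exp (- \<theta> * Y u \<omega>)) \<partial>M)"
    by (intro nn_integral_cong) (auto simp: indicator_def ennreal_mult)
  finally show ?thesis .
qed

lemma exponential_martingale:
  assumes u: "0 \<le> u" "u \<le> t" and h: "h \<in> borel_measurable (F u)" and \<theta>: "0 \<le> \<theta>"
  shows "(\<integral>\<^sup>+\<omega>. h \<omega> * ennreal (exp (- \<theta> * Y t \<omega> - 2 * \<theta>\<^sup>2 * J u t \<omega>)) \<partial>M)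
    = (\<integral>\<^sup>+\<omega>. h \<omega> * ennreal (exp (- \<theta> * \<delta> * (t - u)) * exp (- \<theta> * Y u \<omega>)) \<partial>M)"
proof (rule nn_integral_eq_subalgebraI[OF subalg _ _ _ h])
  show "(\<lambda>\<omega>. ennreal (exp (- \<theta> * Y t \<omega> - 2 * \<theta>\<^sup>2 * J u t \<omega>))) \<in> borel_measurable M"
    "(\<lambda>\<omega>. ennreal (exp (- \<theta> * \<delta> * (t - u)) * exp (- \<theta> * Y u \<omega>))) \<in> borel_measurable M"
    using Y_measurable J_measurable u by auto
qed (rule exponential_martingale_set[OF u _ \<theta>])

text \<open>As the lower limit \<open>s\<close> grows, \<open>J s t\<close> decreases at rate
  \<open>Y s\<close>, so the integrand is the derivative of
  \<open>exp (- c * J s t)\<close>.\<close>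

lemma exp_Y_FTC:
  assumes \<omega>: "\<omega> \<in> space M" and u: "0 \<le> u" "u \<le> t" and "0 \<le> c"
  shows "(\<integral>\<^sup>+s\<in>{u..t}. ennreal (c * Y s \<omega> * exp (- c * J s t \<omega>)) \<partial>lborel) = ennreal (1 - exp (- c * J u t \<omega>))"
proof -
  have "((\<lambda>s. c * Y s \<omega> * exp (- c * J s t \<omega>)) has_integral exp (- c * J t t \<omega>) - exp (- c * J u t \<omega>)) {u..t}"
  proof (rule fundamental_theorem_of_calculus)
    fix s assume s: "s \<in> {u..t}"
    \<comment> \<open>Writing \<open>J\<close> as a constant minus an integral with moving upper
      limit brings it into the form of the fundamental theorem.\<close>
    define K where "K = J u t \<omega>"
    have J: "J r t \<omega> = K - integral {u..r} (\<lambda>s. Y s \<omega>)" if "r \<in> {u..t}" for r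
      using that u \<omega> Henstock_Kurzweil_Integration.integral_combine[where a = u and c = r and b = t and f = "\<lambda>s. Y s \<omega>"]
      by (simp add: K_def J_def integrable_continuous_real Y_continuous')
    have d0: "((\<lambda>r. integral {u..r} (\<lambda>s. Y s \<omega>)) has_real_derivative Y s \<omega>) (at s within {u..t})"
      using s \<omega> u by (intro integral_has_real_derivative Y_continuous')
    have "((\<lambda>r. exp (- c * (K - integral {u..r} (\<lambda>s. Y s \<omega>)))) has_real_derivative
        c * Y s \<omega> * exp (- c * (K - integral {u..s} (\<lambda>s. Y s \<omega>)))) (at s within {u..t})"
      by (auto intro!: derivative_eq_intros d0)
    also have "?this \<longleftrightarrow> ((\<lambda>r. exp (- c * J r t \<omega>)) has_real_derivative c * Y s \<omega> * exp (- c * J s t \<omega>)) (at s within {u..t})"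
      using s by (intro has_field_derivative_cong_ev) (auto simp: J eventually_at_filter)
    finally show "((\<lambda>r. exp (- c * J r t \<omega>)) has_vector_derivative c * Y s \<omega> * exp (- c * J s t \<omega>)) (at s within {u..t})"
      by (simp add: has_real_derivative_iff_has_vector_derivative)
  qed fact
  from nn_integral_has_integral_lebesgue'[OF _ this] show ?thesis
    using Y_nonneg \<open>0 \<le> c\<close> by (simp add: J_def)
qed

text \<open>Preparation for Fubini. Times are clipped so that both functions make sense on the whole
  line, and the moving lower limit of \<open>J\<close> is written as a condition inside an integral
  over all of it.\<close>

lemma J_joint_measurable:
  assumes "0 \<le> u" "u \<le> t"
  shows "(\<lambda>p. J (max u (min t (snd p))) t (fst p)) \<in> borel_measurable (M \<Otimes>\<^sub>M lborel)"
    and "(\<lambda>p. Y (max u (min t (snd p))) (fst p)) \<in> borel_measurable (M \<Otimes>\<^sub>M lborel)"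
proof -
  have t: "0 \<le> t" using assms by simp
  have M': "(\<lambda>p. p) \<in> measurable (borel \<Otimes>\<^sub>M M) (borel \<Otimes>\<^sub>M F t)"
    using measurable_Pair[OF measurable_fst[of borel M] measurable_compose[OF measurable_snd[of borel M] F_measurable_M[OF measurable_ident, unfolded id_def, of t]]]
    by simp
  have Y1: "(\<lambda>p. Y (max 0 (min t (snd p))) (fst p)) \<in> borel_measurable (M \<Otimes>\<^sub>M borel)"
    using measurable_compose[OF measurable_pair_swap' measurable_compose[OF M' progressively_measurable_clip[OF Y_progressive t]]]
    by (simp add: case_prod_beta)
  have clip: "max 0 (min t (max u (min t x))) = max u (min t x)" for x using assms by auto
  have "(\<lambda>p. (fst p, max u (min t (snd p)))) \<in> measurable (M \<Otimes>\<^sub>M lborel) (M \<Otimes>\<^sub>M borel)"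
    by measurable
  from measurable_compose[OF this Y1]
  show "(\<lambda>p. Y (max u (min t (snd p))) (fst p)) \<in> borel_measurable (M \<Otimes>\<^sub>M lborel)"
    using clip by simp
  have [measurable]: "(\<lambda>q. Y (max 0 (min t (snd q))) (fst (fst q))) \<in> borel_measurable ((M \<Otimes>\<^sub>M lborel) \<Otimes>\<^sub>M lborel)"
  proof -
    have "(\<lambda>q. (fst (fst q), snd q)) \<in> measurable ((M \<Otimes>\<^sub>M lborel) \<Otimes>\<^sub>M lborel) (M \<Otimes>\<^sub>M borel)"
      by measurable
    from measurable_compose[OF this Y1] show ?thesis by simp
  qed
  have eq: "J (max u (min t (snd p))) t (fst p) = enn2real (\<integral>\<^sup>+s. ennreal (Y (max 0 (min t s)) (fst p)) *
      (if max u (min t (snd p)) \<le> s \<and> s \<le> t then 1 else 0) \<partial>lborel)" if "p \<in> space (M \<Otimes>\<^sub>M lborel)" for p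
  proof -
    have fp: "fst p \<in> space M" using that by (auto simp: space_pair_measure)
    have "(\<integral>\<^sup>+s. ennreal (Y (max 0 (min t s)) (fst p)) * (if max u (min t (snd p)) \<le> s \<and> s \<le> t then 1 else 0) \<partial>lborel)
      = (\<integral>\<^sup>+s\<in>{max u (min t (snd p))..t}. ennreal (Y s (fst p)) \<partial>lborel)"
      using assms by (intro nn_integral_cong) (simp add: indicator_def)
    then show ?thesis
      using nn_integral_Y[OF fp, of "max u (min t (snd p))" t] J_nonneg[OF fp, of "max u (min t (snd p))" t] assms by simp
  qed
  have [measurable]: "(\<lambda>p. \<integral>\<^sup>+s. ennreal (Y (max 0 (min t s)) (fst p)) *
      (if max u (min t (snd p)) \<le> s \<and> s \<le> t then 1 else 0) \<partial>lborel) \<in> borel_measurable (M \<Otimes>\<^sub>M lborel)"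
    by (rule lborel.borel_measurable_nn_integral) (simp add: case_prod_beta)
  have "(\<lambda>p. enn2real (\<integral>\<^sup>+s. ennreal (Y (max 0 (min t s)) (fst p)) *
      (if max u (min t (snd p)) \<le> s \<and> s \<le> t then 1 else 0) \<partial>lborel)) \<in> borel_measurable (M \<Otimes>\<^sub>M lborel)"
    by measurable
  also have "?this \<longleftrightarrow> (\<lambda>p. J (max u (min t (snd p))) t (fst p)) \<in> borel_measurable (M \<Otimes>\<^sub>M lborel)"
    by (intro measurable_cong) (simp add: eq)
  finally show "(\<lambda>p. J (max u (min t (snd p))) t (fst p)) \<in> borel_measurable (M \<Otimes>\<^sub>M lborel)" .
qed

end

context squared_bessel_setting
begin

text \<open>
  Write \<open>exp (- \<theta> Y\<^sub>t)\<close> as \<open>exp (- \<theta> Y\<^sub>t - 2 \<theta>\<^sup>2 J u t)\<close> plus the integral over \<open>s\<close> of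
  \<open>2 \<theta>\<^sup>2 Y\<^sub>s exp (- \<theta> Y\<^sub>t - 2 \<theta>\<^sup>2 J s t)\<close> and take expectations, the integrand being nonnegative.
\<close>

lemma laplace_duhamel:
  assumes u: "0 \<le> u" "u \<le> t" and h: "h \<in> borel_measurable (F u)" and \<theta>: "0 \<le> \<theta>"
  shows "(\<integral>\<^sup>+\<omega>. h \<omega> * ennreal (exp (- \<theta> * Y t \<omega>)) \<partial>M)
    = (\<integral>\<^sup>+\<omega>. h \<omega> * ennreal (exp (- \<theta> * \<delta> * (t - u)) * exp (- \<theta> * Y u \<omega>)) \<partial>M)
    + (\<integral>\<^sup>+s\<in>{u..t}. (\<integral>\<^sup>+\<omega>. h \<omega> * ennreal (2 * \<theta>\<^sup>2 * exp (- \<theta> * \<delta> * (t - s)) * (Y s \<omega> * exp (- \<theta> * Y s \<omega>))) \<partial>M) \<partial>lborel)"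
proof -
  let ?c = "2 * \<theta>\<^sup>2"
  have [measurable]: "h \<in> borel_measurable M" "Y t \<in> borel_measurable M" "J u t \<in> borel_measurable M" "Y u \<in> borel_measurable M"
    using F_measurable_M[OF h] Y_measurable J_measurable u by auto
  note [measurable] = J_joint_measurable[OF u]
  have dec: "ennreal (exp (- \<theta> * Y t \<omega>)) = ennreal (exp (- \<theta> * Y t \<omega> - ?c * J u t \<omega>)) +
     (\<integral>\<^sup>+s\<in>{u..t}. ennreal (exp (- \<theta> * Y t \<omega>) * (?c * Y s \<omega> * exp (- ?c * J s t \<omega>))) \<partial>lborel)"
    if \<omega>: "\<omega> \<in> space M" for \<omega>
  proof -
    have "((\<lambda>s. ennreal (?c * Y (max u (min t s)) \<omega> * exp (- ?c * J (max u (min t s)) t \<omega>)) * indicator {u..t} s)) \<in> borel_measurable lborel"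
      using measurable_compose[OF measurable_Pair1'[OF \<omega>] J_joint_measurable(1)[OF u]]
         measurable_compose[OF measurable_Pair1'[OF \<omega>] J_joint_measurable(2)[OF u]] by simp
    also have "(\<lambda>s. ennreal (?c * Y (max u (min t s)) \<omega> * exp (- ?c * J (max u (min t s)) t \<omega>)) * indicator {u..t} s)
      = (\<lambda>s. ennreal (?c * Y s \<omega> * exp (- ?c * J s t \<omega>)) * indicator {u..t} s)"
      by (intro ext) (simp add: indicator_def)
    finally have m: "(\<lambda>s. ennreal (?c * Y s \<omega> * exp (- ?c * J s t \<omega>)) * indicator {u..t} s) \<in> borel_measurable lborel" .
    have "(\<integral>\<^sup>+s\<in>{u..t}. ennreal (exp (- \<theta> * Y t \<omega>) * (?c * Y s \<omega> * exp (- ?c * J s t \<omega>))) \<partial>lborel)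
      = (\<integral>\<^sup>+s. ennreal (exp (- \<theta> * Y t \<omega>)) * (ennreal (?c * Y s \<omega> * exp (- ?c * J s t \<omega>)) * indicator {u..t} s) \<partial>lborel)"
      using Y_nonneg by (intro nn_integral_cong) (auto simp: ennreal_mult mult.assoc)
    also have "\<dots> = ennreal (exp (- \<theta> * Y t \<omega>)) * ennreal (1 - exp (- ?c * J u t \<omega>))"
      by (subst nn_integral_cmult[OF m]) (subst exp_Y_FTC[OF \<omega> u], auto)
    also have "ennreal (exp (- \<theta> * Y t \<omega> - ?c * J u t \<omega>)) + \<dots> = ennreal (exp (- \<theta> * Y t \<omega>))"
      using J_nonneg[OF \<omega> u(1), of t]
      by (simp add: algebra_simps flip: ennreal_mult ennreal_plus exp_add)
    finally show ?thesis by simp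
  qed
  have "(\<integral>\<^sup>+\<omega>. h \<omega> * ennreal (exp (- \<theta> * Y t \<omega>)) \<partial>M) = 
     (\<integral>\<^sup>+\<omega>. h \<omega> * ennreal (exp (- \<theta> * Y t \<omega> - ?c * J u t \<omega>)) +
       (\<integral>\<^sup>+s. h \<omega> * (ennreal (exp (- \<theta> * Y t \<omega>) * (?c * Y (max u (min t s)) \<omega> * exp (- ?c * J (max u (min t s)) t \<omega>))) * indicator {u..t} s) \<partial>lborel) \<partial>M)"
  proof (rule nn_integral_cong)
    fix \<omega> assume \<omega>: "\<omega> \<in> space M"
    have m: "((\<lambda>s. ennreal (exp (- \<theta> * Y t \<omega>) * (?c * Y (max u (min t s)) \<omega> * exp (- ?c * J (max u (min t s)) t \<omega>))) * indicator {u..t} s)) \<in> borel_measurable lborel"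
      using measurable_compose[OF measurable_Pair1'[OF \<omega>] J_joint_measurable(1)[OF u]]
         measurable_compose[OF measurable_Pair1'[OF \<omega>] J_joint_measurable(2)[OF u]] by simp
    have e: "(\<integral>\<^sup>+s\<in>{u..t}. ennreal (exp (- \<theta> * Y t \<omega>) * (?c * Y s \<omega> * exp (- ?c * J s t \<omega>))) \<partial>lborel)
      = (\<integral>\<^sup>+s. ennreal (exp (- \<theta> * Y t \<omega>) * (?c * Y (max u (min t s)) \<omega> * exp (- ?c * J (max u (min t s)) t \<omega>))) * indicator {u..t} s \<partial>lborel)"
      by (intro nn_integral_cong) (simp add: indicator_def)
    show "h \<omega> * ennreal (exp (- \<theta> * Y t \<omega>)) = h \<omega> * ennreal (exp (- \<theta> * Y t \<omega> - ?c * J u t \<omega>)) +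
       (\<integral>\<^sup>+s. h \<omega> * (ennreal (exp (- \<theta> * Y t \<omega>) * (?c * Y (max u (min t s)) \<omega> * exp (- ?c * J (max u (min t s)) t \<omega>))) * indicator {u..t} s) \<partial>lborel)"
      unfolding nn_integral_cmult[OF m] e[symmetric] distrib_left[symmetric] dec[OF \<omega>, symmetric] ..
  qed
  also have "\<dots> = (\<integral>\<^sup>+\<omega>. h \<omega> * ennreal (exp (- \<theta> * Y t \<omega> - ?c * J u t \<omega>)) \<partial>M) +
     (\<integral>\<^sup>+\<omega>. \<integral>\<^sup>+s. h \<omega> * (ennreal (exp (- \<theta> * Y t \<omega>) * (?c * Y (max u (min t s)) \<omega> * exp (- ?c * J (max u (min t s)) t \<omega>))) * indicator {u..t} s) \<partial>lborel \<partial>M)"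
    by (subst nn_integral_add) auto
  also have "(\<integral>\<^sup>+\<omega>. \<integral>\<^sup>+s. h \<omega> * (ennreal (exp (- \<theta> * Y t \<omega>) * (?c * Y (max u (min t s)) \<omega> * exp (- ?c * J (max u (min t s)) t \<omega>))) * indicator {u..t} s) \<partial>lborel \<partial>M)
    = (\<integral>\<^sup>+s. \<integral>\<^sup>+\<omega>. h \<omega> * (ennreal (exp (- \<theta> * Y t \<omega>) * (?c * Y (max u (min t s)) \<omega> * exp (- ?c * J (max u (min t s)) t \<omega>))) * indicator {u..t} s) \<partial>M \<partial>lborel)"
  proof -
    interpret L: pair_sigma_finite M lborel ..
    show ?thesis by (rule L.Fubini'[symmetric]) (simp add: case_prod_beta)
  qed
  also have "\<dots> = (\<integral>\<^sup>+s\<in>{u..t}. (\<integral>\<^sup>+\<omega>. h \<omega> * ennreal (?c * exp (- \<theta> * \<delta> * (t - s)) * (Y s \<omega> * exp (- \<theta> * Y s \<omega>))) \<partial>M) \<partial>lborel)"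
  proof (rule nn_integral_cong)
    fix s :: real
    show "(\<integral>\<^sup>+\<omega>. h \<omega> * (ennreal (exp (- \<theta> * Y t \<omega>) * (?c * Y (max u (min t s)) \<omega> * exp (- ?c * J (max u (min t s)) t \<omega>))) * indicator {u..t} s) \<partial>M)
      = (\<integral>\<^sup>+\<omega>. h \<omega> * ennreal (?c * exp (- \<theta> * \<delta> * (t - s)) * (Y s \<omega> * exp (- \<theta> * Y s \<omega>))) \<partial>M) * indicator {u..t} s"
    proof (cases "s \<in> {u..t}")
      case True
      then have s: "0 \<le> s" "s \<le> t" using u by auto
      have [measurable]: "h \<in> borel_measurable (F s)" using F_measurable_mono[OF h] True by simp
      have [measurable]: "Y s \<in> borel_measurable (F s)" using Y_F_measurable s by simp
      have "(\<integral>\<^sup>+\<omega>. h \<omega> * (ennreal (exp (- \<theta> * Y t \<omega>) * (?c * Y (max u (min t s)) \<omega> * exp (- ?c * J (max u (min t s)) t \<omega>))) * indicator {u..t} s) \<partial>M)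
       = (\<integral>\<^sup>+\<omega>. (h \<omega> * ennreal (?c * Y s \<omega>)) * ennreal (exp (- \<theta> * Y t \<omega> - ?c * J s t \<omega>)) \<partial>M)"
      proof (rule nn_integral_cong)
        fix \<omega>
        have "exp (- \<theta> * Y t \<omega>) * (?c * Y s \<omega> * exp (- ?c * J s t \<omega>)) = (?c * Y s \<omega>) * exp (- \<theta> * Y t \<omega> - ?c * J s t \<omega>)"
          by (simp add: exp_diff exp_minus divide_inverse)
        then have "ennreal (exp (- \<theta> * Y t \<omega>) * (?c * Y s \<omega> * exp (- ?c * J s t \<omega>))) = ennreal (?c * Y s \<omega>) * ennreal (exp (- \<theta> * Y t \<omega> - ?c * J s t \<omega>))"
          using Y_nonneg by (simp only: ennreal_mult[symmetric] zero_le_power2 mult_nonneg_nonneg exp_ge_zero zero_le_numeral)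
        moreover have "max u (min t s) = s" using True by simp
        ultimately show "h \<omega> * (ennreal (exp (- \<theta> * Y t \<omega>) * (?c * Y (max u (min t s)) \<omega> * exp (- ?c * J (max u (min t s)) t \<omega>))) * indicator {u..t} s)
            = h \<omega> * ennreal (?c * Y s \<omega>) * ennreal (exp (- \<theta> * Y t \<omega> - ?c * J s t \<omega>))"
          using True by (simp only: indicator_simps mult_1_right mult.assoc)
      qed
      \<comment> \<open>For fixed \<open>s\<close> the factor \<open>Y s\<close> is known at time
        \<open>s\<close>, so it joins \<open>h\<close> as a weight for the martingale started at
        \<open>s\<close>.\<close>
      also have "\<dots> = (\<integral>\<^sup>+\<omega>. (h \<omega> * ennreal (?c * Y s \<omega>)) * ennreal (exp (- \<theta> * \<delta> * (t - s)) * exp (- \<theta> * Y s \<omega>)) \<partial>M)"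
        by (rule exponential_martingale[OF s _ \<theta>]) measurable
      also have "\<dots> = (\<integral>\<^sup>+\<omega>. h \<omega> * ennreal (?c * exp (- \<theta> * \<delta> * (t - s)) * (Y s \<omega> * exp (- \<theta> * Y s \<omega>))) \<partial>M)"
      proof (rule nn_integral_cong)
        fix \<omega>
        have "?c * exp (- \<theta> * \<delta> * (t - s)) * (Y s \<omega> * exp (- \<theta> * Y s \<omega>)) = (?c * Y s \<omega>) * (exp (- \<theta> * \<delta> * (t - s)) * exp (- \<theta> * Y s \<omega>))"
          by (simp only: mult_ac)
        then show "h \<omega> * ennreal (?c * Y s \<omega>) * ennreal (exp (- \<theta> * \<delta> * (t - s)) * exp (- \<theta> * Y s \<omega>))
          = h \<omega> * ennreal (?c * exp (- \<theta> * \<delta> * (t - s)) * (Y s \<omega> * exp (- \<theta> * Y s \<omega>)))"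
          using Y_nonneg by (simp only: ennreal_mult[symmetric] zero_le_power2 mult_nonneg_nonneg exp_ge_zero zero_le_numeral mult.assoc[of "h \<omega>"])
      qed
      finally show ?thesis using True by simp
    qed simp
  qed
  also have "(\<integral>\<^sup>+\<omega>. h \<omega> * ennreal (exp (- \<theta> * Y t \<omega> - ?c * J u t \<omega>)) \<partial>M) = 
     (\<integral>\<^sup>+\<omega>. h \<omega> * ennreal (exp (- \<theta> * \<delta> * (t - u)) * exp (- \<theta> * Y u \<omega>)) \<partial>M)"
    by (rule exponential_martingale[OF u h \<theta>])
  finally show ?thesis .
qed

end

lemma times_exp_neg_le:
  fixes y \<theta> :: real
  assumes "0 \<le> y" "0 < \<theta>"
  shows "y * exp (- \<theta> * y) \<le> 1 / \<theta>"
proof -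
  have "\<theta> * y \<le> exp (\<theta> * y)" using exp_ge_add_one_self[of "\<theta> * y"] by linarith
  then have "\<theta> * (y * exp (- \<theta> * y)) \<le> exp (\<theta> * y) * exp (- \<theta> * y)"
    by (subst mult.assoc[symmetric]) (rule mult_right_mono, auto)
  also have "\<dots> = 1" by (simp flip: exp_add)
  finally show ?thesis using assms by (simp add: field_simps)
qed

text \<open>The constant does not depend on \<open>y\<close> once the parameters stay above
  \<open>m > 0\<close>. This dominates the difference quotients in the parameter.\<close>

lemma exp_neg_lipschitz:
  fixes y a b m :: real
  assumes y: "0 \<le> y" and m: "0 < m" "m \<le> a" "m \<le> b"
  shows "\<bar>exp (- a * y) - exp (- b * y)\<bar> \<le> \<bar>a - b\<bar> * (1 / m)"
proof -
  have *: "\<bar>exp (- a * y) - exp (- b * y)\<bar> \<le> \<bar>a - b\<bar> * (1 / m)" if ab: "a \<le> b" "m \<le> a" for a b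
  proof -
    have "exp (- a * y) - exp (- b * y) = exp (- a * y) * (1 - exp (- ((b - a) * y)))"
      by (simp add: algebra_simps flip: exp_add)
    also have "\<dots> \<le> exp (- a * y) * ((b - a) * y)"
      using exp_ge_add_one_self[of "- ((b - a) * y)"] by (intro mult_left_mono) auto
    also have "\<dots> = (b - a) * (y * exp (- a * y))" by simp
    also have "\<dots> \<le> (b - a) * (1 / a)"
      using ab m(1) by (intro mult_left_mono times_exp_neg_le y) auto
    also have "\<dots> \<le> (b - a) * (1 / m)"
      using ab m(1) by (intro mult_left_mono) (auto simp: frac_le)
    finally have "exp (- a * y) - exp (- b * y) \<le> (b - a) * (1 / m)" .
    moreover have "exp (- b * y) \<le> exp (- a * y)" using ab y by (simp add: mult_right_mono)
    ultimately show ?thesis using ab by simp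
  qed
  show ?thesis
  proof (cases "a \<le> b")
    case False
    with *[of b a] m show ?thesis by (simp add: abs_minus_commute)
  qed (use * m in auto)
qed

section \<open>Regularity of the Laplace transform in time and parameter\<close>

context squared_bessel_setting
begin

lemma Y_tendsto:
  assumes "\<omega> \<in> space M" "s \<longlonglongrightarrow> r" "\<And>n. 0 \<le> s n" "0 \<le> r"
  shows "(\<lambda>n. Y (s n) \<omega>) \<longlonglongrightarrow> Y r \<omega>"
  using continuous_on_tendsto_compose[OF Y_continuous[OF assms(1)] assms(2)] assms by simp

definition lap :: "'a set \<Rightarrow> real \<Rightarrow> real \<Rightarrow> real" where
  "lap A \<theta> s = expectation (\<lambda>\<omega>. indicator A \<omega> * exp (- \<theta> * Y s \<omega>))"

text \<open>Minus the derivative of \<open>lap\<close> in the parameter. For \<theta> > 0 the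
  integrand is at most \<open>1 / \<theta>\<close>.\<close>

definition lap' :: "'a set \<Rightarrow> real \<Rightarrow> real \<Rightarrow> real" where
  "lap' A \<theta> s = expectation (\<lambda>\<omega>. indicator A \<omega> * (Y s \<omega> * exp (- \<theta> * Y s \<omega>)))"

context
  fixes A :: "'a set" assumes A_sets[measurable]: "A \<in> sets M"
begin

lemma lap_integrable: "0 \<le> \<theta> \<Longrightarrow> 0 \<le> s \<Longrightarrow> integrable M (\<lambda>\<omega>. indicator A \<omega> * exp (- \<theta> * Y s \<omega>))"
  using Y_measurable[of s] Y_nonneg
  by (intro integrable_const_bound[of _ 1]) (auto simp: indicator_def)

lemma lap'_integrand_bound: "0 < m \<Longrightarrow> m \<le> \<theta> \<Longrightarrow> \<bar>indicator A \<omega> * (Y s \<omega> * exp (- \<theta> * Y s \<omega>))\<bar> \<le> 1 / m"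
  using times_exp_neg_le[OF Y_nonneg, of \<theta> s \<omega>] Y_nonneg[of s \<omega>] frac_le[of 1 1 m \<theta>]
  by (auto simp: indicator_def abs_mult)

lemma lap'_integrable: "0 < \<theta> \<Longrightarrow> 0 \<le> s \<Longrightarrow> integrable M (\<lambda>\<omega>. indicator A \<omega> * (Y s \<omega> * exp (- \<theta> * Y s \<omega>)))"
  using Y_measurable[of s] lap'_integrand_bound[of \<theta> \<theta>]
  by (intro integrable_const_bound[of _ "1 / \<theta>"]) auto

lemma lap'_nonneg: "0 \<le> lap' A \<theta> s"
  unfolding lap'_def using Y_nonneg by (intro Bochner_Integration.integral_nonneg) auto

lemma lap_nonneg: "0 \<le> lap A \<theta> s"
  unfolding lap_def by (intro Bochner_Integration.integral_nonneg) auto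

text \<open>Time and parameter move together because the derivative along the characteristic curve
  uses joint continuity. The lower bound \<open>m\<close> on the parameters supplies the dominating
  constant.\<close>

lemma lap'_tendsto:
  assumes "0 < m" "\<And>n. m \<le> \<theta> n" "m \<le> \<eta>" "\<And>n. 0 \<le> s n" "0 \<le> r" "\<theta> \<longlonglongrightarrow> \<eta>" "s \<longlonglongrightarrow> r"
  shows "(\<lambda>n. lap' A (\<theta> n) (s n)) \<longlonglongrightarrow> lap' A \<eta> r"
  unfolding lap'_def
proof (rule integral_dominated_convergence[where w = "\<lambda>_. 1 / m"])
  show "AE \<omega> in M. (\<lambda>n. indicator A \<omega> * (Y (s n) \<omega> * exp (- \<theta> n * Y (s n) \<omega>)))
      \<longlonglongrightarrow> indicator A \<omega> * (Y r \<omega> * exp (- \<eta> * Y r \<omega>))"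
    using AE_space by eventually_elim (intro tendsto_intros Y_tendsto assms)
  show "AE \<omega> in M. norm (indicator A \<omega> * (Y (s n) \<omega> * exp (- \<theta> n * Y (s n) \<omega>))) \<le> 1 / m" for n
    using lap'_integrand_bound[OF assms(1,2)] by simp
qed (use Y_measurable assms in auto)

text \<open>Differentiation under the expectation along sequences. On the half line from
  \<open>m\<close> all difference quotients are dominated by \<open>1 / m\<close>.\<close>

lemma lap_has_derivative_parameter:
  assumes m: "0 < m" "m \<le> \<theta>" and s: "0 \<le> s"
  shows "((\<lambda>\<theta>. lap A \<theta> s) has_real_derivative - lap' A \<theta> s) (at \<theta> within {m..})"
  unfolding has_field_derivative_iff tendsto_at_iff_sequentially
proof safe
  fix x :: "nat \<Rightarrow> real" assume x: "\<forall>i. x i \<in> {m..} - {\<theta>}" "x \<longlonglongrightarrow> \<theta>"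
  have eq: "(lap A (x n) s - lap A \<theta> s) / (x n - \<theta>) =
     expectation (\<lambda>\<omega>. indicator A \<omega> * ((exp (- x n * Y s \<omega>) - exp (- \<theta> * Y s \<omega>)) / (x n - \<theta>)))" for n
  proof -
    have "m \<le> x n" using x(1)[rule_format, of n] by auto
    then have i: "integrable M (\<lambda>\<omega>. indicator A \<omega> * exp (- x n * Y s \<omega>))"
        "integrable M (\<lambda>\<omega>. indicator A \<omega> * exp (- \<theta> * Y s \<omega>))"
      using m s by (intro lap_integrable, linarith, linarith)+
    show ?thesis
      unfolding lap_def Bochner_Integration.integral_diff[OF i, symmetric]
      by (simp flip: Bochner_Integration.integral_divide_zero) (simp add: algebra_simps diff_divide_distrib)
  qed
  have "(\<lambda>n. expectation (\<lambda>\<omega>. indicator A \<omega> * ((exp (- x n * Y s \<omega>) - exp (- \<theta> * Y s \<omega>)) / (x n - \<theta>))))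
    \<longlonglongrightarrow> expectation (\<lambda>\<omega>. indicator A \<omega> * (- Y s \<omega> * exp (- \<theta> * Y s \<omega>)))"
  proof (rule integral_dominated_convergence[where w = "\<lambda>_. 1 / m"])
    show "AE \<omega> in M. (\<lambda>n. indicator A \<omega> * ((exp (- x n * Y s \<omega>) - exp (- \<theta> * Y s \<omega>)) / (x n - \<theta>)))
      \<longlonglongrightarrow> indicator A \<omega> * (- Y s \<omega> * exp (- \<theta> * Y s \<omega>))"
    proof (rule AE_I2)
      fix \<omega>
      have "((\<lambda>\<theta>. exp (- \<theta> * Y s \<omega>)) has_real_derivative - Y s \<omega> * exp (- \<theta> * Y s \<omega>)) (at \<theta> within {m..})"
        by (auto intro!: derivative_eq_intros)
      then have "((\<lambda>\<eta>. (exp (- \<eta> * Y s \<omega>) - exp (- \<theta> * Y s \<omega>)) / (\<eta> - \<theta>)) \<circ> x) \<longlonglongrightarrow> - Y s \<omega> * exp (- \<theta> * Y s \<omega>)"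
        unfolding has_field_derivative_iff tendsto_at_iff_sequentially using x by blast
      then show "(\<lambda>n. indicator A \<omega> * ((exp (- x n * Y s \<omega>) - exp (- \<theta> * Y s \<omega>)) / (x n - \<theta>)))
        \<longlonglongrightarrow> indicator A \<omega> * (- Y s \<omega> * exp (- \<theta> * Y s \<omega>))"
        by (intro tendsto_mult_left) (simp add: o_def)
    qed
    show "AE \<omega> in M. norm (indicator A \<omega> * ((exp (- x n * Y s \<omega>) - exp (- \<theta> * Y s \<omega>)) / (x n - \<theta>))) \<le> 1 / m" for n
    proof (rule AE_I2)
      fix \<omega>
      have "m \<le> x n" "x n \<noteq> \<theta>" using x(1)[rule_format, of n] by auto
      then have "\<bar>(exp (- x n * Y s \<omega>) - exp (- \<theta> * Y s \<omega>)) / (x n - \<theta>)\<bar> \<le> 1 / m"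
        using exp_neg_lipschitz[OF Y_nonneg m(1) _ m(2), of "x n" s \<omega>]
        unfolding abs_divide by (subst pos_divide_le_eq) (auto simp: mult.commute)
      then show "norm (indicator A \<omega> * ((exp (- x n * Y s \<omega>) - exp (- \<theta> * Y s \<omega>)) / (x n - \<theta>))) \<le> 1 / m"
        using m by (auto simp: indicator_def)
    qed
  qed (use Y_measurable[OF s] in auto)
  also have "expectation (\<lambda>\<omega>. indicator A \<omega> * (- Y s \<omega> * exp (- \<theta> * Y s \<omega>))) = - lap' A \<theta> s"
    unfolding lap'_def by (simp flip: Bochner_Integration.integral_minus)
  finally show "((\<lambda>y. (lap A y s - lap A \<theta> s) / (y - \<theta>)) \<circ> x) \<longlonglongrightarrow> - lap' A \<theta> s"
    by (simp add: o_def eq)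
qed

end

lemma lap_duhamel:
  assumes u: "0 \<le> u" "u \<le> t" and A: "A \<in> sets (F u)" and \<theta>: "0 < \<theta>"
  shows "lap A \<theta> t = exp (- \<theta> * \<delta> * (t - u)) * lap A \<theta> u
    + integral {u..t} (\<lambda>s. 2 * \<theta>\<^sup>2 * exp (- \<theta> * \<delta> * (t - s)) * lap' A \<theta> s)"
proof -
  note AM[measurable] = F_sets_M[OF A]
  have lapn: "(\<integral>\<^sup>+\<omega>. indicator A \<omega> * ennreal (c * exp (- \<theta> * Y s \<omega>)) \<partial>M) = ennreal (c * lap A \<theta> s)"
    if "0 \<le> s" "0 \<le> c" for c s
  proof -
    have "(\<integral>\<^sup>+\<omega>. indicator A \<omega> * ennreal (c * exp (- \<theta> * Y s \<omega>)) \<partial>M) =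
      (\<integral>\<^sup>+\<omega>. ennreal (c * (indicator A \<omega> * exp (- \<theta> * Y s \<omega>))) \<partial>M)"
      by (intro nn_integral_cong) (auto simp: indicator_def)
    also have "\<dots> = ennreal (c * lap A \<theta> s)"
      unfolding lap_def integral_mult_right_zero[symmetric]
      using that \<theta> by (intro nn_integral_eq_integral integrable_mult_right lap_integrable AM) auto
    finally show ?thesis .
  qed
  have lapn': "(\<integral>\<^sup>+\<omega>. indicator A \<omega> * ennreal (c * (Y s \<omega> * exp (- \<theta> * Y s \<omega>))) \<partial>M) = ennreal (c * lap' A \<theta> s)"
    if "0 \<le> s" "0 \<le> c" for c s
  proof -
    have "(\<integral>\<^sup>+\<omega>. indicator A \<omega> * ennreal (c * (Y s \<omega> * exp (- \<theta> * Y s \<omega>))) \<partial>M) =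
      (\<integral>\<^sup>+\<omega>. ennreal (c * (indicator A \<omega> * (Y s \<omega> * exp (- \<theta> * Y s \<omega>)))) \<partial>M)"
      by (intro nn_integral_cong) (auto simp: indicator_def)
    also have "\<dots> = ennreal (c * lap' A \<theta> s)"
      unfolding lap'_def integral_mult_right_zero[symmetric]
      using that \<theta> Y_nonneg by (intro nn_integral_eq_integral integrable_mult_right lap'_integrable AM) auto
    finally show ?thesis .
  qed
  let ?g = "\<lambda>s. 2 * \<theta>\<^sup>2 * exp (- \<theta> * \<delta> * (t - s)) * lap' A \<theta> s"
  have g0: "0 \<le> ?g s" for s using lap'_nonneg[OF AM] by simp
  have cont: "continuous_on {u..t} (\<lambda>s. lap' A \<theta> s)"
    unfolding continuous_on_sequentially o_def
  proof safe
    fix x a assume "\<forall>n. x n \<in> {u..t}" "a \<in> {u..t}" "x \<longlonglongrightarrow> a"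
    then show "(\<lambda>n. lap' A \<theta> (x n)) \<longlonglongrightarrow> lap' A \<theta> a"
      using \<theta> u(1) by (intro lap'_tendsto[OF AM, of \<theta>]) (auto intro: order_trans[of 0 u])
  qed
  have "((\<lambda>s. ?g s) has_integral integral {u..t} ?g) {u..t}"
    by (intro integrable_integral integrable_continuous_real continuous_intros cont)
  then have gpos: "0 \<le> integral {u..t} ?g" and "((\<lambda>s. ?g s) has_integral integral {u..t} ?g) {u..t}"
    using g0 by (auto intro: has_integral_nonneg)
  from nn_integral_has_integral_lebesgue'[OF g0 this(2)]
  have gi: "(\<integral>\<^sup>+s\<in>{u..t}. ennreal (?g s) \<partial>lborel) = ennreal (integral {u..t} ?g)" .
  have "ennreal (lap A \<theta> t) = (\<integral>\<^sup>+\<omega>. indicator A \<omega> * ennreal (exp (- \<theta> * Y t \<omega>)) \<partial>M)"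
    using lapn[of t 1] u by simp
  also have "\<dots> = (\<integral>\<^sup>+\<omega>. indicator A \<omega> * ennreal (exp (- \<theta> * \<delta> * (t - u)) * exp (- \<theta> * Y u \<omega>)) \<partial>M)
    + (\<integral>\<^sup>+s\<in>{u..t}. (\<integral>\<^sup>+\<omega>. indicator A \<omega> * ennreal (2 * \<theta>\<^sup>2 * exp (- \<theta> * \<delta> * (t - s)) * (Y s \<omega> * exp (- \<theta> * Y s \<omega>))) \<partial>M) \<partial>lborel)"
    using A \<theta> by (intro laplace_duhamel u) auto
  also have "(\<integral>\<^sup>+s\<in>{u..t}. (\<integral>\<^sup>+\<omega>. indicator A \<omega> * ennreal (2 * \<theta>\<^sup>2 * exp (- \<theta> * \<delta> * (t - s)) * (Y s \<omega> * exp (- \<theta> * Y s \<omega>))) \<partial>M) \<partial>lborel)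
    = (\<integral>\<^sup>+s\<in>{u..t}. ennreal (?g s) \<partial>lborel)"
  proof (rule nn_integral_cong)
    fix s
    show "(\<integral>\<^sup>+\<omega>. indicator A \<omega> * ennreal (2 * \<theta>\<^sup>2 * exp (- \<theta> * \<delta> * (t - s)) * (Y s \<omega> * exp (- \<theta> * Y s \<omega>))) \<partial>M) * indicator {u..t} s
       = ennreal (?g s) * indicator {u..t} s"
    proof (cases "s \<in> {u..t}")
      case True
      then have "0 \<le> s" using u by simp
      then show ?thesis by (subst lapn') auto
    qed simp
  qed
  also have "(\<integral>\<^sup>+\<omega>. indicator A \<omega> * ennreal (exp (- \<theta> * \<delta> * (t - u)) * exp (- \<theta> * Y u \<omega>)) \<partial>M)
     = ennreal (exp (- \<theta> * \<delta> * (t - u)) * lap A \<theta> u)"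
    using u by (intro lapn) auto
  finally have e: "ennreal (lap A \<theta> t) = ennreal (exp (- \<theta> * \<delta> * (t - u)) * lap A \<theta> u + integral {u..t} ?g)"
    unfolding gi using lap_nonneg[OF AM] gpos by (subst ennreal_plus) auto
  then show ?thesis using lap_nonneg[OF AM] gpos by (subst (asm) ennreal_inj) auto
qed

text \<open>The integrand in \<open>lap_duhamel\<close> depends on the final time through an
  exponential factor. Pulling out \<open>exp (- \<theta> * \<delta> * r)\<close> leaves an
  indefinite integral, to which the fundamental theorem applies.\<close>

lemma lap_has_derivative_time:
  assumes u: "0 \<le> u" "s \<in> {u..t}" and A: "A \<in> sets (F u)" and \<theta>: "0 < \<theta>"
  shows "((\<lambda>s. lap A \<theta> s) has_real_derivative - \<theta> * \<delta> * lap A \<theta> s + 2 * \<theta>\<^sup>2 * lap' A \<theta> s) (at s within {u..t})"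
proof -
  note AM = F_sets_M[OF A]
  define K where "K = lap A \<theta> u"
  let ?G = "\<lambda>r. exp (\<theta> * \<delta> * u) * K + integral {u..r} (\<lambda>s. 2 * \<theta>\<^sup>2 * exp (\<theta> * \<delta> * s) * lap' A \<theta> s)"
  have cont: "continuous_on {u..t} (\<lambda>s. lap' A \<theta> s)" for t
    unfolding continuous_on_sequentially o_def
  proof safe
    fix x a assume "\<forall>n. x n \<in> {u..t}" "a \<in> {u..t}" "x \<longlonglongrightarrow> a"
    then show "(\<lambda>n. lap' A \<theta> (x n)) \<longlonglongrightarrow> lap' A \<theta> a"
      using \<theta> u(1) by (intro lap'_tendsto[OF AM, of \<theta>]) (auto intro: order_trans[of 0 u])
  qed
  have eq: "lap A \<theta> r = exp (- \<theta> * \<delta> * r) * ?G r" if "r \<in> {u..t}" for r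
  proof -
    have "lap A \<theta> r = exp (- \<theta> * \<delta> * (r - u)) * K
      + integral {u..r} (\<lambda>s. 2 * \<theta>\<^sup>2 * exp (- \<theta> * \<delta> * (r - s)) * lap' A \<theta> s)"
      unfolding K_def using that u by (intro lap_duhamel A \<theta>) auto
    also have "(\<lambda>s. 2 * \<theta>\<^sup>2 * exp (- \<theta> * \<delta> * (r - s)) * lap' A \<theta> s) = 
       (\<lambda>s. exp (- \<theta> * \<delta> * r) * (2 * \<theta>\<^sup>2 * exp (\<theta> * \<delta> * s) * lap' A \<theta> s))"
    proof
      fix s
      have "exp (- \<theta> * \<delta> * (r - s)) = exp (- \<theta> * \<delta> * r) * exp (\<theta> * \<delta> * s)"
        by (simp add: algebra_simps flip: exp_add)
      then show "2 * \<theta>\<^sup>2 * exp (- \<theta> * \<delta> * (r - s)) * lap' A \<theta> s =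
        exp (- \<theta> * \<delta> * r) * (2 * \<theta>\<^sup>2 * exp (\<theta> * \<delta> * s) * lap' A \<theta> s)" by simp
    qed
    also have "exp (- \<theta> * \<delta> * (r - u)) = exp (- \<theta> * \<delta> * r) * exp (\<theta> * \<delta> * u)"
      by (simp add: algebra_simps flip: exp_add)
    finally show ?thesis by (simp add: distrib_left mult.assoc)
  qed
  have d0: "((\<lambda>r. integral {u..r} (\<lambda>s. 2 * \<theta>\<^sup>2 * exp (\<theta> * \<delta> * s) * lap' A \<theta> s)) has_real_derivative
      2 * \<theta>\<^sup>2 * exp (\<theta> * \<delta> * s) * lap' A \<theta> s) (at s within {u..t})"
    by (intro integral_has_real_derivative continuous_intros cont u)
  have "((\<lambda>r. exp (- \<theta> * \<delta> * r) * ?G r) has_real_derivative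
     (- \<theta> * \<delta>) * (exp (- \<theta> * \<delta> * s) * ?G s) + (exp (- \<theta> * \<delta> * s) * exp (\<theta> * \<delta> * s)) * (2 * \<theta>\<^sup>2 * lap' A \<theta> s)) (at s within {u..t})"
    by (rule d0 derivative_eq_intros refl | simp)+
  also have "exp (- \<theta> * \<delta> * s) * exp (\<theta> * \<delta> * s) = 1" by (simp flip: exp_add)
  also have "exp (- \<theta> * \<delta> * s) * ?G s = lap A \<theta> s" using eq[OF u(2)] ..
  finally have "((\<lambda>r. exp (- \<theta> * \<delta> * r) * ?G r) has_real_derivative - \<theta> * \<delta> * lap A \<theta> s + 2 * \<theta>\<^sup>2 * lap' A \<theta> s) (at s within {u..t})"
    by simp
  then show ?thesis
    by (rule has_field_derivative_transform_within[OF _ zero_less_one u(2)]) (simp add: eq)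
qed

lemma conditional_laplace_set:
  assumes u: "0 \<le> u" "u \<le> t" and A: "A \<in> sets (F u)" and l: "0 < l"
  shows "lap A l t = (1 + 2 * l * (t - u)) powr (- \<delta> / 2) * lap A (l / (1 + 2 * l * (t - u))) u"
proof -
  note AM = F_sets_M[OF A]
  define b where "b v = 1 + 2 * l * (t - v)" for v
  define \<theta> where "\<theta> v = l / b v" for v \<comment> \<open>characteristic curve, with \<open>\<theta>' = 2 \<theta>\<^sup>2\<close> and \<open>\<theta> t = l\<close>\<close>
  \<comment> \<open>\<theta> increases along the curve, so its value at \<open>u\<close> is the
    smallest; the curve stays away from 0, where \<open>lap'\<close> has no uniform bound.\<close>
  define m where "m = \<theta> u"
  have b: "0 < b v" if "v \<in> {u..t}" for v
    using that l by (auto simp: b_def intro!: add_pos_nonneg)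
  have m0: "0 < m" using b[of u] u l by (simp add: m_def \<theta>_def)
  have \<theta>m: "m \<le> \<theta> v" if "v \<in> {u..t}" for v
    unfolding m_def \<theta>_def using that b[of v] b[of u] l by (intro divide_left_mono) (auto simp: b_def)
  have \<theta>': "(\<theta> has_real_derivative 2 * (\<theta> v)\<^sup>2) (at v within {u..t})" if "v \<in> {u..t}" for v
  proof -
    have "((\<lambda>v. l / (1 + 2 * l * (t - v))) has_real_derivative 2 * (\<theta> v)\<^sup>2) (at v within {u..t})"
      using b[OF that] by (auto intro!: derivative_eq_intros simp: \<theta>_def b_def power2_eq_square)
    then show ?thesis by (simp add: \<theta>_def[abs_def] b_def)
  qed
  have c': "((\<lambda>v. b v powr (- \<delta> / 2)) has_real_derivative \<delta> * \<theta> v * b v powr (- \<delta> / 2)) (at v within {u..t})"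
    if "v \<in> {u..t}" for v
  proof -
    have "(b has_real_derivative - 2 * l) (at v within {u..t})"
      unfolding b_def by (auto intro!: derivative_eq_intros)
    from DERIV_chain2[OF has_real_derivative_powr[OF b[OF that], of "- \<delta> / 2"] this]
    have "((\<lambda>v. b v powr (- \<delta> / 2)) has_real_derivative
        - \<delta> / 2 * b v powr (- \<delta> / 2 - 1) * (- 2 * l)) (at v within {u..t})" .
    also have "- \<delta> / 2 * b v powr (- \<delta> / 2 - 1) * (- 2 * l) = \<delta> * \<theta> v * b v powr (- \<delta> / 2)"
      using b[OF that] by (simp add: powr_diff \<theta>_def)
    finally show ?thesis .
  qed
  \<comment> \<open>Partial derivatives give a total one if one of them is jointly continuous; here
    it is the one in the parameter, by \<open>lap'_tendsto\<close>.\<close>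
  have joint: "((\<lambda>(x, y). lap A y x) has_derivative
      (\<lambda>(tx, ty). (- y * \<delta> * lap A y x + 2 * y\<^sup>2 * lap' A y x) * tx + blinfun_mult_right (- lap' A y x) ty))
      (at (x, y) within {u..t} \<times> {m..})" if x: "x \<in> {u..t}" and y: "y \<in> {m..}" for x y
  proof (rule has_derivative_partialsI)
    show "((\<lambda>x. lap A y x) has_derivative (\<lambda>tx. (- y * \<delta> * lap A y x + 2 * y\<^sup>2 * lap' A y x) * tx)) (at x within {u..t})"
      using lap_has_derivative_time[OF u(1) x A, of y] m0 y by (simp add: has_field_derivative_def)
    show "((\<lambda>y. lap A y x) has_derivative blinfun_mult_right (- lap' A y x)) (at y within {m..})"
      if "x \<in> {u..t}" "y \<in> {m..}" for x y
      using lap_has_derivative_parameter[OF AM m0, of y x] that u by (simp add: has_field_derivative_def)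
    have "continuous (at (x, y) within {u..t} \<times> {m..}) (\<lambda>z. - lap' A (snd z) (fst z))"
      unfolding continuous_within_sequentially
    proof safe
      fix z :: "nat \<Rightarrow> real \<times> real" assume z: "\<forall>n. z n \<in> {u..t} \<times> {m..}" "z \<longlonglongrightarrow> (x, y)"
      have "(\<lambda>n. lap' A (snd (z n)) (fst (z n))) \<longlonglongrightarrow> lap' A y x"
        using z(1) x y u tendsto_snd[OF z(2)] tendsto_fst[OF z(2)]
        by (intro lap'_tendsto[OF AM m0]) (auto simp: mem_Times_iff intro: order_trans)
      then show "((\<lambda>z. - lap' A (snd z) (fst z)) \<circ> z) \<longlonglongrightarrow> - lap' A (snd (x, y)) (fst (x, y))"
        by (simp add: o_def tendsto_minus)
    qed
    from bounded_linear.continuous[OF bounded_linear_blinfun_mult_right this]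
    show "continuous (at (x, y) within {u..t} \<times> {m..}) (\<lambda>(x, y). blinfun_mult_right (- lap' A y x))"
      unfolding case_prod_unfold .
  qed (use y in auto)
  \<comment> \<open>Along the curve the term with \<open>lap'\<close> cancels because of
    \<open>\<theta>' = 2 * \<theta>\<^sup>2\<close>. What is left is
    \<open>- \<theta> * \<delta> * lap\<close>, and the power of \<open>b\<close> is the integrating
    factor for it, so \<open>q\<close> is constant.\<close>
  define q where "q v = b v powr (- \<delta> / 2) * lap A (\<theta> v) v" for v
  have q': "(q has_derivative (\<lambda>h. 0)) (at v within {u..t})" if v: "v \<in> {u..t}" for v
  proof -
    have D1: "((\<lambda>v. (v, \<theta> v)) has_derivative (\<lambda>h. (h, 2 * (\<theta> v)\<^sup>2 * h))) (at v within {u..t})"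
      by (intro has_derivative_Pair has_derivative_ident \<theta>'[OF v, unfolded has_field_derivative_def])
    have D2: "((\<lambda>(x, y). lap A y x) has_derivative
        (\<lambda>(tx, ty). (- \<theta> v * \<delta> * lap A (\<theta> v) v + 2 * (\<theta> v)\<^sup>2 * lap' A (\<theta> v) v) * tx
          + blinfun_mult_right (- lap' A (\<theta> v) v) ty)) (at (v, \<theta> v) within (\<lambda>v. (v, \<theta> v)) ` {u..t})"
      by (rule has_derivative_subset[OF joint]) (use v \<theta>m in auto)
    have "((\<lambda>v. lap A (\<theta> v) v) has_derivative
        (\<lambda>h. (- \<theta> v * \<delta> * lap A (\<theta> v) v + 2 * (\<theta> v)\<^sup>2 * lap' A (\<theta> v) v) * h
          + (- lap' A (\<theta> v) v) * (2 * (\<theta> v)\<^sup>2 * h))) (at v within {u..t})"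
      using has_derivative_in_compose[OF D1 D2] by simp
    then have "((\<lambda>v. lap A (\<theta> v) v) has_real_derivative - \<theta> v * \<delta> * lap A (\<theta> v) v) (at v within {u..t})"
      unfolding has_field_derivative_def by (rule has_derivative_eq_rhs) (auto simp: fun_eq_iff algebra_simps)
    from DERIV_mult[OF c'[OF v] this]
    have "(q has_real_derivative 0) (at v within {u..t})"
      unfolding q_def by (simp add: algebra_simps)
    then show ?thesis by (simp add: has_field_derivative_def lambda_zero)
  qed
  have "\<exists>c. \<forall>v\<in>{u..t}. q v = c"
    by (rule has_derivative_zero_constant) (use q' in auto)
  then have "q u = q t" using u by auto
  then show ?thesis by (simp add: q_def \<theta>_def b_def)
qed

lemma conditional_laplace:
  assumes u: "0 \<le> u" "u \<le> t" and h: "h \<in> borel_measurable (F u)" and l: "0 \<le> l"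
  shows "(\<integral>\<^sup>+\<omega>. h \<omega> * ennreal (exp (- l * Y t \<omega>)) \<partial>M) =
    (\<integral>\<^sup>+\<omega>. h \<omega> * ennreal ((1 + 2 * l * (t - u)) powr (- \<delta> / 2) * exp (- (l / (1 + 2 * l * (t - u))) * Y u \<omega>)) \<partial>M)"
\<comment> \<open>The characteristic curve through 0 stays at 0, outside the range of the derivative
  lemmas; both sides then reduce to the integral of \<open>h\<close>.\<close>
proof (cases "l = 0")
  case False
  with l have l: "0 < l" by simp
  have b: "0 < 1 + 2 * l * (t - u)" using u l by (auto intro!: add_pos_nonneg)
  show ?thesis
  proof (rule nn_integral_eq_subalgebraI[OF subalg _ _ _ h])
    show "(\<lambda>\<omega>. ennreal (exp (- l * Y t \<omega>))) \<in> borel_measurable M"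
      "(\<lambda>\<omega>. ennreal ((1 + 2 * l * (t - u)) powr (- \<delta> / 2) * exp (- (l / (1 + 2 * l * (t - u))) * Y u \<omega>))) \<in> borel_measurable M"
      using Y_measurable u by auto
    fix A assume A: "A \<in> sets (F u)"
    have e: "(\<integral>\<^sup>+\<omega>. indicator A \<omega> * ennreal (c * exp (- \<theta> * Y s \<omega>)) \<partial>M) = ennreal (c * lap A \<theta> s)"
      if "0 \<le> s" "0 \<le> c" "0 \<le> \<theta>" for c s \<theta>
    proof -
      have "(\<integral>\<^sup>+\<omega>. indicator A \<omega> * ennreal (c * exp (- \<theta> * Y s \<omega>)) \<partial>M) =
        (\<integral>\<^sup>+\<omega>. ennreal (c * (indicator A \<omega> * exp (- \<theta> * Y s \<omega>))) \<partial>M)"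
        by (intro nn_integral_cong) (auto simp: indicator_def)
      also have "\<dots> = ennreal (c * lap A \<theta> s)"
        unfolding lap_def integral_mult_right_zero[symmetric]
        using that by (intro nn_integral_eq_integral integrable_mult_right lap_integrable F_sets_M[OF A]) auto
      finally show ?thesis .
    qed
    show "(\<integral>\<^sup>+\<omega>. indicator A \<omega> * ennreal (exp (- l * Y t \<omega>)) \<partial>M) =
     (\<integral>\<^sup>+\<omega>. indicator A \<omega> * ennreal ((1 + 2 * l * (t - u)) powr (- \<delta> / 2) * exp (- (l / (1 + 2 * l * (t - u))) * Y u \<omega>)) \<partial>M)"
      using e[of t 1 l] l u b conditional_laplace_set[OF u A l] by (subst e) auto
  qed
qed simp

end

subsection \<open>Uniqueness of Laplace transforms and the gamma law\<close>

text \<open>Equal moments give equal integrals of polynomials, hence of continuous functions by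
  Weierstrass on the unit interval, hence of indicators of half lines by approximation with
  ramps.\<close>

lemma finite_measure_eq_of_moments:
  fixes M N :: "real measure"
  assumes "finite_measure M" "finite_measure N" and sM: "sets M = sets borel" and sN: "sets N = sets borel"
    and M01: "AE x in M. x \<in> {0..1}" and N01: "AE x in N. x \<in> {0..1}"
    and moments: "\<And>n::nat. (\<integral>x. x ^ n \<partial>M) = (\<integral>x. x ^ n \<partial>N)"
  shows "M = N"
proof -
  interpret M: finite_measure M by fact
  interpret N: finite_measure N by fact
  note [measurable_cong] = sM sN
  have int: "integrable P f" if "finite_measure P" "sets P = sets borel" "AE x in P. x \<in> {0..1}"
      "continuous_on UNIV f" for P :: "real measure" and f :: "real \<Rightarrow> real"
  proof -
    interpret P: finite_measure P by fact
    have "compact (f ` {0..1})"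
      by (intro compact_continuous_image continuous_on_subset[OF that(4)]) auto
    then obtain c where "\<forall>x\<in>{0..1}. \<bar>f x\<bar> \<le> c"
      by (auto dest!: compact_imp_bounded simp: bounded_iff)
    then have "AE x in P. norm (f x) \<le> c" using that(3) by auto
    moreover have "f \<in> borel_measurable P"
      using borel_measurable_continuous_onI[OF that(4)] measurable_cong_sets[OF that(2) refl] by auto
    ultimately show ?thesis by (rule P.integrable_const_bound)
  qed
  note intM = int[OF \<open>finite_measure M\<close> sM M01] and intN = int[OF \<open>finite_measure N\<close> sN N01]
  have cont: "(\<integral>x. f x \<partial>M) = (\<integral>x. f x \<partial>N)" if f: "continuous_on UNIV f" for f :: "real \<Rightarrow> real"
  proof (rule ccontr)
    assume ne: "(\<integral>x. f x \<partial>M) \<noteq> (\<integral>x. f x \<partial>N)"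
    define d where "d = \<bar>(\<integral>x. f x \<partial>M) - (\<integral>x. f x \<partial>N)\<bar>"
    \<comment> \<open>The summand 1 keeps \<open>K\<close> positive for null measures and makes the
      final inequality strict.\<close>
    define K where "K = measure M (space M) + measure N (space N) + 1"
    have K: "0 < K" by (simp add: K_def add_nonneg_pos)
    have d: "0 < d" using ne by (simp add: d_def)
    obtain g where "real_polynomial_function g" and g: "\<And>x. x \<in> {0..1} \<Longrightarrow> \<bar>f x - g x\<bar> < d / K"
      using Stone_Weierstrass_real_polynomial_function[of "{0..1}" f "d / K"] f d K
      by (auto intro: continuous_on_subset)
    then obtain a n where ga: "g = (\<lambda>x. \<Sum>i\<le>n. a i * x ^ i)"
      unfolding real_polynomial_function_iff_sum by auto
    have gc: "continuous_on UNIV g" unfolding ga by (intro continuous_intros)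
    have eqg: "(\<integral>x. g x \<partial>M) = (\<integral>x. g x \<partial>N)"
      unfolding ga using moments
      by (subst (1 2) Bochner_Integration.integral_sum)
        (auto intro!: integrable_mult_right intM intN continuous_intros)
    have bnd: "\<bar>(\<integral>x. f x \<partial>P) - (\<integral>x. g x \<partial>P)\<bar> \<le> d / K * measure P (space P)"
      if P: "finite_measure P" "sets P = sets borel" "AE x in P. x \<in> {0..1}" for P
    proof -
      interpret P: finite_measure P by fact
      have "\<bar>(\<integral>x. f x \<partial>P) - (\<integral>x. g x \<partial>P)\<bar> = \<bar>\<integral>x. f x - g x \<partial>P\<bar>"
        by (subst Bochner_Integration.integral_diff[OF int[OF P f] int[OF P gc]]) simp
      also have "\<dots> \<le> (\<integral>x. \<bar>f x - g x\<bar> \<partial>P)" by (rule integral_abs_bound)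
      also have "\<dots> \<le> (\<integral>x. d / K \<partial>P)"
      proof (rule integral_mono_AE)
        show "AE x in P. \<bar>f x - g x\<bar> \<le> d / K" using P(3) by eventually_elim (use g in force)
        show "integrable P (\<lambda>x. \<bar>f x - g x\<bar>)"
          by (intro integrable_abs Bochner_Integration.integrable_diff int[OF P f] int[OF P gc])
      qed simp
      finally show ?thesis by (simp add: mult.commute)
    qed
    have "d \<le> d / K * measure M (space M) + d / K * measure N (space N)"
      using bnd[OF \<open>finite_measure M\<close> sM M01] bnd[OF \<open>finite_measure N\<close> sN N01] eqg
      unfolding d_def[symmetric] by (subst (1) d_def) linarith
    also have "\<dots> < d / K * K" using d K by (simp only: distrib_left[symmetric], intro mult_strict_left_mono) (auto simp: K_def)
    finally show False using K by simp
  qed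
  show "M = N"
  proof (rule measure_eqI_lessThan)
    fix b :: real
    \<comment> \<open>Ramps of slope \<open>j\<close> starting at \<open>b\<close> increase to the
      indicator of the open half line.\<close>
    have lim: "(\<lambda>j. \<integral>x. max 0 (min 1 (real j * (x - b))) \<partial>P) \<longlonglongrightarrow> measure P {b<..}"
      if P: "finite_measure P" "sets P = sets borel" for P
    proof -
      interpret P: finite_measure P by fact
      note [measurable_cong] = P(2)
      have "(\<lambda>j. \<integral>x. max 0 (min 1 (real j * (x - b))) \<partial>P) \<longlonglongrightarrow> (\<integral>x. indicator {b<..} x \<partial>P)"
      proof (rule integral_dominated_convergence[where w = "\<lambda>_. 1"])
        show "AE x in P. (\<lambda>j. max 0 (min 1 (real j * (x - b)))) \<longlonglongrightarrow> indicator {b<..} x"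
        proof (rule AE_I2)
          fix x
          show "(\<lambda>j. max 0 (min 1 (real j * (x - b)))) \<longlonglongrightarrow> indicator {b<..} x"
          proof (cases "b < x")
            case True
            obtain j0 :: nat where j0: "1 / (x - b) \<le> real j0" using real_arch_simple by blast
            have "\<forall>\<^sub>F j in sequentially. max 0 (min 1 (real j * (x - b))) = 1"
              using eventually_ge_at_top[of j0]
            proof eventually_elim
              fix j assume "j0 \<le> j"
              then have "1 / (x - b) \<le> real j" using j0 by linarith
              then have "1 \<le> real j * (x - b)" using True by (simp add: field_simps)
              then show "max 0 (min 1 (real j * (x - b))) = 1" by simp
            qed
            then show ?thesis using True by (simp add: tendsto_eventually)
          next
            case False
            then have "max 0 (min 1 (real j * (x - b))) = 0" for j
              using mult_nonneg_nonpos[of "real j" "x - b"] by simp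
            then show ?thesis using False by simp
          qed
        qed
      qed auto
      then show ?thesis using P(2) by simp
    qed
    have "(\<lambda>j. \<integral>x. max 0 (min 1 (real j * (x - b))) \<partial>M) = (\<lambda>j. \<integral>x. max 0 (min 1 (real j * (x - b))) \<partial>N)"
      by (intro ext cont continuous_intros)
    with lim[OF \<open>finite_measure M\<close> sM] lim[OF \<open>finite_measure N\<close> sN]
    have "measure M {b<..} = measure N {b<..}" by (metis LIMSEQ_unique)
    then show "emeasure M {b<..} = emeasure N {b<..}"
      by (simp add: M.emeasure_eq_measure N.emeasure_eq_measure)
    show "emeasure M {b<..} < \<infinity>" by (simp add: M.emeasure_eq_measure)
  qed (use sM sN in auto)
qed

text \<open>The substitution \<open>exp (- x)\<close> maps the nonnegative half line into the unit
  interval and turns Laplace transforms at integers into moments. It is undone by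
  \<open>- ln x\<close>.\<close>

lemma finite_measure_eq_of_laplace:
  fixes M N :: "real measure"
  assumes M: "finite_measure M" and N: "finite_measure N" and sM: "sets M = sets borel" and sN: "sets N = sets borel"
    and M0: "AE x in M. 0 \<le> x" and N0: "AE x in N. 0 \<le> x"
    and laplace: "\<And>l. 0 \<le> l \<Longrightarrow> (\<integral>\<^sup>+x. ennreal (exp (- l * x)) \<partial>M) = (\<integral>\<^sup>+x. ennreal (exp (- l * x)) \<partial>N)"
  shows "M = N"
proof -
  note [measurable_cong] = sM sN
  have mom: "(\<integral>x. x ^ n \<partial>distr P borel (\<lambda>x. exp (- x))) = enn2real (\<integral>\<^sup>+x. ennreal (exp (- real n * x)) \<partial>P)"
    if [measurable_cong]: "sets P = sets borel" for P n
  proof -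
    have "(\<integral>x. x ^ n \<partial>distr P borel (\<lambda>x. exp (- x))) = (\<integral>x. exp (- real n * x) \<partial>P)"
      by (subst integral_distr) (auto simp flip: exp_of_nat_mult)
    also have "\<dots> = enn2real (\<integral>\<^sup>+x. ennreal (exp (- real n * x)) \<partial>P)"
      by (rule integral_eq_nn_integral) auto
    finally show ?thesis .
  qed
  have "distr M borel (\<lambda>x. exp (- x)) = distr N borel (\<lambda>x. exp (- x))"
  proof (rule finite_measure_eq_of_moments)
    show "finite_measure (distr M borel (\<lambda>x. exp (- x)))" "finite_measure (distr N borel (\<lambda>x. exp (- x)))"
      by (auto intro: finite_measure.finite_measure_distr M N)
    show "AE x in distr M borel (\<lambda>x. exp (- x)). x \<in> {0..1}" "AE x in distr N borel (\<lambda>x. exp (- x)). x \<in> {0..1}"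
      using M0 N0 by (auto simp: AE_distr_iff)
    show "(\<integral>x. x ^ n \<partial>distr M borel (\<lambda>x. exp (- x))) = (\<integral>x. x ^ n \<partial>distr N borel (\<lambda>x. exp (- x)))" for n
      using mom[OF sM, of n] mom[OF sN, of n] laplace[of "real n"] by simp
  qed auto
  then have "distr (distr M borel (\<lambda>x. exp (- x))) borel (\<lambda>x. - ln x) = distr (distr N borel (\<lambda>x. exp (- x))) borel (\<lambda>x. - ln x)"
    by simp
  moreover have "distr (distr P borel (\<lambda>x. exp (- x))) borel (\<lambda>x. - ln x) = P"
    if [measurable_cong]: "sets P = sets borel" for P :: "real measure"
  proof -
    have "distr (distr P borel (\<lambda>x. exp (- x))) borel (\<lambda>x. - ln x) = distr P borel (\<lambda>x. x)"
      by (subst distr_distr) (auto simp: o_def)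
    also have "\<dots> = P" using that by (simp add: distr_id2)
    finally show ?thesis .
  qed
  ultimately show ?thesis using sM sN by simp
qed

section \<open>The gamma law with scale 1\<close>

definition gamma_density :: "real \<Rightarrow> real \<Rightarrow> real" where
  "gamma_density k x = indicator {0..} x * x powr (k - 1) * exp (- x) / Gamma k"

lemma gamma_density_measurable[measurable]: "gamma_density k \<in> borel_measurable borel"
  unfolding gamma_density_def[abs_def] by measurable

lemma gamma_density_nonneg: "0 < k \<Longrightarrow> 0 \<le> gamma_density k x"
  using Gamma_real_pos[of k] by (simp add: gamma_density_def)

text \<open>The substitution \<open>(1 + \<mu>) * t\<close> in the integral of the Gamma function.
  Negative \<mu> above -1 are included because the image ratio grows exponentially in y.\<close>

lemma gamma_laplace:
  assumes k: "0 < k" and m: "- 1 < \<mu>"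
  shows "(\<integral>\<^sup>+x. ennreal (exp (- \<mu> * x)) \<partial>density lborel (\<lambda>x. ennreal (gamma_density k x))) = ennreal ((1 + \<mu>) powr (- k))"
proof -
  let ?c = "1 + \<mu>"
  have c: "0 < ?c" using m by simp
  have Gk: "0 < Gamma k" by (rule Gamma_real_pos[OF k])
  have "ennreal (Gamma k) = (\<integral>\<^sup>+t. ennreal (indicator {0..} t * t powr (k - 1) / exp t) \<partial>lborel)"
    by (rule Gamma_conv_nn_integral_real[OF k])
  also have "\<dots> = ennreal ?c * (\<integral>\<^sup>+t. ennreal (indicator {0..} (?c * t) * (?c * t) powr (k - 1) / exp (?c * t)) \<partial>lborel)"
    using c by (subst nn_integral_real_affine[where c = ?c and t = 0]) auto
  also have "(\<integral>\<^sup>+t. ennreal (indicator {0..} (?c * t) * (?c * t) powr (k - 1) / exp (?c * t)) \<partial>lborel)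
    = (\<integral>\<^sup>+t. ennreal (?c powr (k - 1) * Gamma k) * ennreal (gamma_density k t * exp (- \<mu> * t)) \<partial>lborel)"
  proof (rule nn_integral_cong)
    fix t :: real
    have "indicator {0..} (?c * t) * (?c * t) powr (k - 1) / exp (?c * t) = ?c powr (k - 1) * Gamma k * (gamma_density k t * exp (- \<mu> * t))"
    proof (cases "0 \<le> t")
      case True
      have "(?c * t) powr (k - 1) = ?c powr (k - 1) * t powr (k - 1)" using c True by (simp add: powr_mult)
      moreover have "exp (?c * t) = exp t * exp (\<mu> * t)" by (simp add: distrib_right exp_add)
      moreover have "indicator {0..} (?c * t) = (1::real)" "indicator {0..} t = (1::real)"
        using True c by auto
      ultimately show ?thesis using Gk unfolding gamma_density_def
        by (simp only: exp_minus mult_minus_left) (simp add: divide_inverse)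
    next
      case False
      then have "\<not> 0 \<le> ?c * t" using c by (simp add: zero_le_mult_iff)
      with False show ?thesis by (simp add: gamma_density_def)
    qed
    then show "ennreal (indicator {0..} (?c * t) * (?c * t) powr (k - 1) / exp (?c * t)) = 
      ennreal (?c powr (k - 1) * Gamma k) * ennreal (gamma_density k t * exp (- \<mu> * t))"
      using Gk gamma_density_nonneg[OF k] by (simp add: ennreal_mult)
  qed
  also have "\<dots> = ennreal (?c powr (k - 1) * Gamma k) * (\<integral>\<^sup>+t. ennreal (gamma_density k t * exp (- \<mu> * t)) \<partial>lborel)"
    by (rule nn_integral_cmult) simp
  also have "(\<integral>\<^sup>+t. ennreal (gamma_density k t * exp (- \<mu> * t)) \<partial>lborel) = (\<integral>\<^sup>+x. ennreal (exp (- \<mu> * x)) \<partial>density lborel (\<lambda>x. ennreal (gamma_density k x)))"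
    using gamma_density_nonneg[OF k] by (subst nn_integral_density) (auto simp: ennreal_mult)
  finally have e: "ennreal (Gamma k) = ennreal ?c * (ennreal (?c powr (k - 1) * Gamma k) * (\<integral>\<^sup>+x. ennreal (exp (- \<mu> * x)) \<partial>density lborel (\<lambda>x. ennreal (gamma_density k x))))" (is "_ = _ * (_ * ?I)") .
  have pk: "?c * ?c powr (k - 1) = ?c powr k" using c by (simp add: powr_diff)
  have "ennreal (?c powr (- k)) = ennreal (?c powr (- k) / Gamma k) * ennreal (Gamma k)"
    using Gk by (simp flip: ennreal_mult)
  also have "\<dots> = ennreal (?c powr (- k) / Gamma k * (?c * (?c powr (k - 1) * Gamma k))) * ?I"
  proof -
    have "0 \<le> ?c powr (- k) / Gamma k" "0 \<le> ?c" "0 \<le> ?c powr (k - 1) * Gamma k" using Gk c by auto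
    then show ?thesis by (subst e) (simp only: ennreal_mult mult_nonneg_nonneg mult.assoc)
  qed
  also have "?c powr (- k) / Gamma k * (?c * (?c powr (k - 1) * Gamma k)) = 1"
    unfolding mult.assoc[symmetric] using Gk c pk by (simp add: powr_minus field_simps)
  finally show ?thesis by simp
qed

subsection \<open>The image ratio as a change of measure\<close>

definition image_ratio :: "real \<Rightarrow> real \<Rightarrow> real \<Rightarrow> real \<Rightarrow> real" where
  "image_ratio k s t y = (t / (t + s)) powr k * exp (y * s / (2 * t * (t + s)))"

lemma image_ratio_nonneg: "0 \<le> image_ratio k s t y"
  by (simp add: image_ratio_def)

lemma image_ratio_measurable[measurable]: "image_ratio k s t \<in> borel_measurable borel"
  unfolding image_ratio_def[abs_def] by measurable

context squared_bessel_setting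
begin

lemma laplace_Y:
  assumes "0 \<le> t" "0 \<le> l"
  shows "(\<integral>\<^sup>+\<omega>. ennreal (exp (- l * Y t \<omega>)) \<partial>M) = ennreal ((1 + 2 * l * t) powr (- (\<delta> / 2)))"
proof -
  have "(\<integral>\<^sup>+\<omega>. ennreal (exp (- l * Y t \<omega>)) \<partial>M) =
     (\<integral>\<^sup>+\<omega>. ennreal ((1 + 2 * l * t) powr (- (\<delta> / 2)) * exp (- (l / (1 + 2 * l * t)) * Y 0 \<omega>)) \<partial>M)"
    using conditional_laplace[of 0 t "\<lambda>_. 1" l] assms by simp
  also have "\<dots> = (\<integral>\<^sup>+\<omega>. ennreal ((1 + 2 * l * t) powr (- (\<delta> / 2))) \<partial>M)"
    by (rule nn_integral_cong_AE) (use Y_0 in eventually_elim, simp)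
  finally show ?thesis by (simp add: emeasure_space_1)
qed

text \<open>Dividing by \<open>2 * t\<close> turns the Laplace transform into
  \<open>(1 + l) powr (- (\<delta> / 2))\<close>, the same for all \<open>t\<close>.\<close>

lemma Y_gamma:
  assumes t: "0 < t"
  shows "distr M borel (\<lambda>\<omega>. Y t \<omega> / (2 * t)) = density lborel (\<lambda>x. ennreal (gamma_density (\<delta> / 2) x))"
proof (rule finite_measure_eq_of_laplace)
  have [measurable]: "Y t \<in> borel_measurable M" using Y_measurable t by simp
  show "finite_measure (distr M borel (\<lambda>\<omega>. Y t \<omega> / (2 * t)))"
    by (rule finite_measure_distr) simp
  show "finite_measure (density lborel (\<lambda>x. ennreal (gamma_density (\<delta> / 2) x)))"
  proof (rule finite_measureI)
    show "emeasure (density lborel (\<lambda>x. ennreal (gamma_density (\<delta> / 2) x))) (space (density lborel (\<lambda>x. ennreal (gamma_density (\<delta> / 2) x)))) \<noteq> \<infinity>"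
      using gamma_laplace[of "\<delta> / 2" 0] \<delta>_pos by simp
  qed
  show "AE x in distr M borel (\<lambda>\<omega>. Y t \<omega> / (2 * t)). 0 \<le> x"
    using t Y_nonneg by (subst AE_distr_iff) auto
  show "AE x in density lborel (\<lambda>x. ennreal (gamma_density (\<delta> / 2) x)). 0 \<le> x"
    by (subst AE_density) (simp, rule AE_I2, auto simp: gamma_density_def indicator_def)
  fix l :: real assume l: "0 \<le> l"
  have "(\<integral>\<^sup>+x. ennreal (exp (- l * x)) \<partial>distr M borel (\<lambda>\<omega>. Y t \<omega> / (2 * t))) = (\<integral>\<^sup>+\<omega>. ennreal (exp (- (l / (2 * t)) * Y t \<omega>)) \<partial>M)"
    by (subst nn_integral_distr) auto
  also have "\<dots> = ennreal ((1 + l) powr (- (\<delta> / 2)))"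
    using t l by (subst laplace_Y) auto
  also have "\<dots> = (\<integral>\<^sup>+x. ennreal (exp (- l * x)) \<partial>density lborel (\<lambda>x. ennreal (gamma_density (\<delta> / 2) x)))"
    using gamma_laplace[of "\<delta> / 2" l] \<delta>_pos l by simp
  finally show "(\<integral>\<^sup>+x. ennreal (exp (- l * x)) \<partial>distr M borel (\<lambda>\<omega>. Y t \<omega> / (2 * t))) =
    (\<integral>\<^sup>+x. ennreal (exp (- l * x)) \<partial>density lborel (\<lambda>x. ennreal (gamma_density (\<delta> / 2) x)))" .
qed auto

lemma laplace_image_ratio:
  assumes t: "0 < t" and s: "0 < s" and l: "0 \<le> l"
  shows "(\<integral>\<^sup>+\<omega>. ennreal (image_ratio (\<delta> / 2) s t (Y t \<omega>)) * ennreal (exp (- l * Y t \<omega>)) \<partial>M)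
    = (\<integral>\<^sup>+\<omega>. ennreal (exp (- l * Y (t + s) \<omega>)) \<partial>M)"
proof -
  have [measurable]: "Y t \<in> borel_measurable M" using Y_measurable t by simp
  \<comment> \<open>The exponent in the variable \<open>Y t / (2 * t)\<close>:
    \<open>2 * t * l\<close> comes from the Laplace variable, \<open>s / (t + s)\<close> from the
    image ratio. The factor \<open>t / (t + s)\<close> in \<open>1 + \<mu>\<close> will cancel the
    power in the ratio.\<close>
  define \<mu> where "\<mu> = 2 * t * l - s / (t + s)"
  have \<mu>1: "1 + \<mu> = t / (t + s) * (1 + 2 * l * (t + s))"
    using t s by (simp add: \<mu>_def field_simps)
  have \<mu>: "- 1 < \<mu>"
  proof -
    have "0 < t / (t + s) * (1 + 2 * l * (t + s))" using t s l by (intro mult_pos_pos add_pos_nonneg) auto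
    then show ?thesis using \<mu>1 by linarith
  qed
  have e: "image_ratio (\<delta> / 2) s t y * exp (- l * y) = (t / (t + s)) powr (\<delta> / 2) * exp (- \<mu> * (y / (2 * t)))" for y
  proof -
    have "y * s / (2 * t * (t + s)) + (- l * y) = - \<mu> * (y / (2 * t))"
    proof -
      have "2 * t * l * (y / (2 * t)) = l * y" "s / (t + s) * (y / (2 * t)) = y * s / (2 * t * (t + s))"
        using t s by (simp_all add: mult_ac)
      then show ?thesis unfolding \<mu>_def by (simp only: left_diff_distrib mult_minus_left)
    qed
    then show ?thesis by (simp add: image_ratio_def mult.assoc flip: exp_add)
  qed
  have "(\<integral>\<^sup>+\<omega>. ennreal (image_ratio (\<delta> / 2) s t (Y t \<omega>)) * ennreal (exp (- l * Y t \<omega>)) \<partial>M)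
     = (\<integral>\<^sup>+\<omega>. ennreal ((t / (t + s)) powr (\<delta> / 2)) * ennreal (exp (- \<mu> * (Y t \<omega> / (2 * t)))) \<partial>M)"
    using e by (intro nn_integral_cong) (simp add: image_ratio_nonneg flip: ennreal_mult)
  also have "\<dots> = ennreal ((t / (t + s)) powr (\<delta> / 2)) * (\<integral>\<^sup>+x. ennreal (exp (- \<mu> * x)) \<partial>distr M borel (\<lambda>\<omega>. Y t \<omega> / (2 * t)))"
    by (subst nn_integral_cmult) (auto simp: nn_integral_distr)
  also have "\<dots> = ennreal ((t / (t + s)) powr (\<delta> / 2) * (1 + \<mu>) powr (- (\<delta> / 2)))"
    unfolding Y_gamma[OF t] using \<delta>_pos \<mu> by (subst gamma_laplace) (auto simp flip: ennreal_mult)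
  also have "(t / (t + s)) powr (\<delta> / 2) * (1 + \<mu>) powr (- (\<delta> / 2)) = (1 + 2 * l * (t + s)) powr (- (\<delta> / 2))"
    unfolding \<mu>1 using t s l by (subst powr_mult) (auto simp: powr_minus field_simps)
  also have "ennreal \<dots> = (\<integral>\<^sup>+\<omega>. ennreal (exp (- l * Y (t + s) \<omega>)) \<partial>M)"
    using laplace_Y[of "t + s" l] t s l by simp
  finally show ?thesis .
qed

text \<open>\<open>g\<close> and \<open>h\<close> act as densities on the sample space; they will
  carry the factors belonging to earlier times.\<close>

lemma nn_integral_eq_of_laplace:
  assumes [measurable]: "V \<in> borel_measurable M" "W \<in> borel_measurable M" "g \<in> borel_measurable M" "h \<in> borel_measurable M"
    and pos: "\<And>\<omega>. 0 \<le> V \<omega>" "\<And>\<omega>. 0 \<le> W \<omega>"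
    and fin: "(\<integral>\<^sup>+\<omega>. g \<omega> \<partial>M) \<noteq> \<infinity>" "(\<integral>\<^sup>+\<omega>. h \<omega> \<partial>M) \<noteq> \<infinity>"
    and laplace: "\<And>l. 0 \<le> l \<Longrightarrow> (\<integral>\<^sup>+\<omega>. g \<omega> * ennreal (exp (- l * V \<omega>)) \<partial>M) = (\<integral>\<^sup>+\<omega>. h \<omega> * ennreal (exp (- l * W \<omega>)) \<partial>M)"
    and f[measurable]: "f \<in> borel_measurable borel"
  shows "(\<integral>\<^sup>+\<omega>. g \<omega> * f (V \<omega>) \<partial>M) = (\<integral>\<^sup>+\<omega>. h \<omega> * f (W \<omega>) \<partial>M)"
proof -
  have i: "(\<integral>\<^sup>+x. f x \<partial>distr (density M g) borel V) = (\<integral>\<^sup>+\<omega>. g \<omega> * f (V \<omega>) \<partial>M)"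
    if [measurable]: "g \<in> borel_measurable M" "V \<in> borel_measurable M" "f \<in> borel_measurable borel" for g V and f :: "real \<Rightarrow> ennreal"
    by (subst nn_integral_distr, simp, simp, subst nn_integral_density) auto
  have "distr (density M g) borel V = distr (density M h) borel W"
  proof (rule finite_measure_eq_of_laplace)
    have "finite_measure (density M g)" if "g \<in> borel_measurable M" "(\<integral>\<^sup>+\<omega>. g \<omega> \<partial>M) \<noteq> \<infinity>" for g
      using that by (intro finite_measureI) (simp add: emeasure_density cong: nn_integral_cong)
    then show "finite_measure (distr (density M g) borel V)" "finite_measure (distr (density M h) borel W)"
      using fin by (auto intro!: finite_measure.finite_measure_distr)
    show "AE x in distr (density M g) borel V. 0 \<le> x" "AE x in distr (density M h) borel W. 0 \<le> x"
      using pos by (simp_all add: AE_distr_iff)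
    show "(\<integral>\<^sup>+x. ennreal (exp (- l * x)) \<partial>distr (density M g) borel V) = (\<integral>\<^sup>+x. ennreal (exp (- l * x)) \<partial>distr (density M h) borel W)"
      if "0 \<le> l" for l
      using laplace[OF that] by (simp add: i)
  qed auto
  then show ?thesis using i[of g V f] i[of h W f] by simp
qed

lemma nn_integral_image_ratio:
  assumes t: "0 < t" and s: "0 < s" and f: "f \<in> borel_measurable borel"
  shows "(\<integral>\<^sup>+\<omega>. ennreal (image_ratio (\<delta> / 2) s t (Y t \<omega>)) * f (Y t \<omega>) \<partial>M) = (\<integral>\<^sup>+\<omega>. f (Y (t + s) \<omega>) \<partial>M)"
proof -
  have [measurable]: "Y t \<in> borel_measurable M" "Y (t + s) \<in> borel_measurable M"
    using Y_measurable t s by auto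
  have "(\<integral>\<^sup>+\<omega>. ennreal (image_ratio (\<delta> / 2) s t (Y t \<omega>)) * f (Y t \<omega>) \<partial>M) = (\<integral>\<^sup>+\<omega>. 1 * f (Y (t + s) \<omega>) \<partial>M)"
  proof (rule nn_integral_eq_of_laplace)
    show "(\<integral>\<^sup>+\<omega>. ennreal (image_ratio (\<delta> / 2) s t (Y t \<omega>)) \<partial>M) \<noteq> \<infinity>"
      using laplace_image_ratio[OF t s, of 0] by (simp add: emeasure_space_1)
    show "(\<integral>\<^sup>+\<omega>. ennreal (image_ratio (\<delta> / 2) s t (Y t \<omega>)) * ennreal (exp (- l * Y t \<omega>)) \<partial>M) =
      (\<integral>\<^sup>+\<omega>. 1 * ennreal (exp (- l * Y (t + s) \<omega>)) \<partial>M)" if "0 \<le> l" for l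
      using laplace_image_ratio[OF t s that] by simp
  qed (use Y_nonneg f in \<open>auto simp: emeasure_space_1\<close>)
  then show ?thesis by simp
qed

text \<open>
  Both sides, as functions of the last factor, are integrals with respect to finite measures,
  whose Laplace transforms agree by the conditional Laplace transform and the case of one factor less.
\<close>

lemma nn_integral_image_ratio_prod:
  fixes f :: "nat \<Rightarrow> real \<Rightarrow> ennreal" and \<tau> :: "nat \<Rightarrow> real"
  assumes s: "0 < s" and \<tau>: "0 < \<tau> 0" "\<And>i. \<tau> i \<le> \<tau> (Suc i)"
    and f: "\<And>i. f i \<in> borel_measurable borel" and f1: "\<And>i y. f i y \<le> 1"
  shows "(\<integral>\<^sup>+\<omega>. ennreal (image_ratio (\<delta> / 2) s (\<tau> 0) (Y (\<tau> 0) \<omega>)) * (\<Prod>i\<le>m. f i (Y (\<tau> i) \<omega>)) \<partial>M)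
    = (\<integral>\<^sup>+\<omega>. (\<Prod>i\<le>m. f i (Y (\<tau> i + s) \<omega>)) \<partial>M)"
  using f f1
proof (induction m arbitrary: f)
  case 0
  then show ?case using nn_integral_image_ratio[OF \<tau>(1) s, of "f 0"] by simp
next
  case (Suc m)
  note [measurable] = Suc.prems(1)
  have mono: "i \<le> j \<Longrightarrow> \<tau> i \<le> \<tau> j" for i j using \<tau>(2) by (rule lift_Suc_mono_le)
  have \<tau>0: "0 < \<tau> i" for i using mono[of 0 i] \<tau>(1) by simp
  let ?g = "\<lambda>\<omega>. ennreal (image_ratio (\<delta> / 2) s (\<tau> 0) (Y (\<tau> 0) \<omega>)) * (\<Prod>i\<le>m. f i (Y (\<tau> i) \<omega>))"
  let ?h = "\<lambda>\<omega>. (\<Prod>i\<le>m. f i (Y (\<tau> i + s) \<omega>))"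
  have Ym: "i \<le> j \<Longrightarrow> 0 \<le> r \<Longrightarrow> Y (\<tau> i + r) \<in> borel_measurable (F (\<tau> j + r))" for i j r
    using mono[of i j] \<tau>0[of i] by (intro F_measurable_mono[OF Y_F_measurable]) auto
  have fm: "i \<le> j \<Longrightarrow> 0 \<le> r \<Longrightarrow> (\<lambda>\<omega>. f i (Y (\<tau> i + r) \<omega>)) \<in> borel_measurable (F (\<tau> j + r))" for i j r
    by (rule measurable_compose[OF Ym Suc.prems(1)])
  have pm: "0 \<le> r \<Longrightarrow> (\<lambda>\<omega>. \<Prod>i\<le>m. f i (Y (\<tau> i + r) \<omega>)) \<in> borel_measurable (F (\<tau> m + r))" for r
    by (intro borel_measurable_prod_ennreal fm) auto
  have gF: "?g \<in> borel_measurable (F (\<tau> m))"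
    using pm[of 0] Ym[of 0 m 0] by (intro borel_measurable_times_ennreal) auto
  have hF: "?h \<in> borel_measurable (F (\<tau> m + s))" using pm[of s] s by simp
  have prod1: "(\<Prod>i\<le>m. f i (x i)) \<le> 1" for x
    using Suc.prems(2) by (intro prod_le_1) auto
  have "(\<integral>\<^sup>+\<omega>. ?g \<omega> * f (Suc m) (Y (\<tau> (Suc m)) \<omega>) \<partial>M) = (\<integral>\<^sup>+\<omega>. ?h \<omega> * f (Suc m) (Y (\<tau> (Suc m) + s) \<omega>) \<partial>M)"
  proof (rule nn_integral_eq_of_laplace)
    show "Y (\<tau> (Suc m)) \<in> borel_measurable M" "Y (\<tau> (Suc m) + s) \<in> borel_measurable M"
      using \<tau>0[of "Suc m"] s by (auto intro: Y_measurable)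
    show "?g \<in> borel_measurable M" "?h \<in> borel_measurable M"
      by (rule F_measurable_M[OF gF], rule F_measurable_M[OF hF])
    have "(\<integral>\<^sup>+\<omega>. ?g \<omega> \<partial>M) \<le> (\<integral>\<^sup>+\<omega>. ennreal (image_ratio (\<delta> / 2) s (\<tau> 0) (Y (\<tau> 0) \<omega>)) * 1 \<partial>M)"
      by (intro nn_integral_mono mult_left_mono prod1) auto
    also have "\<dots> = 1" using nn_integral_image_ratio[OF \<tau>(1) s, of "\<lambda>_. 1"] by (simp add: emeasure_space_1)
    finally show "(\<integral>\<^sup>+\<omega>. ?g \<omega> \<partial>M) \<noteq> \<infinity>" by (auto simp: top_unique)
    have "(\<integral>\<^sup>+\<omega>. ?h \<omega> \<partial>M) \<le> (\<integral>\<^sup>+\<omega>. 1 \<partial>M)" by (intro nn_integral_mono prod1)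
    then show "(\<integral>\<^sup>+\<omega>. ?h \<omega> \<partial>M) \<noteq> \<infinity>" by (auto simp: emeasure_space_1 top_unique)
    fix l :: real assume l: "0 \<le> l"
    \<comment> \<open>\<open>c\<close> and \<theta> depend on the time gap alone, and a shift of all
      times by \<open>s\<close> preserves gaps. One modified family \<open>f'\<close> therefore
      serves both sides.\<close>
    define d where "d = \<tau> (Suc m) - \<tau> m"
    have d: "0 \<le> d" using \<tau>(2)[of m] by (simp add: d_def)
    define c where "c = (1 + 2 * l * d) powr (- \<delta> / 2)"
    define \<theta> where "\<theta> = l / (1 + 2 * l * d)"
    have den: "1 \<le> 1 + 2 * l * d" using l d by simp
    have \<theta>: "0 \<le> \<theta>" using l den by (simp add: \<theta>_def)
    have c1: "c \<le> 1" using den \<delta>_pos powr_mono[of "- \<delta> / 2" 0 "1 + 2 * l * d"] by (simp add: c_def split: if_splits)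
    \<comment> \<open>the absolute value only serves to keep \<open>f'\<close> below \<open>1\<close> at negative arguments\<close>
    define f' where "f' i y = (if i = m then f m y * ennreal (c * exp (- \<theta> * \<bar>y\<bar>)) else f i y)" for i y
    have f'_meas: "f' i \<in> borel_measurable borel" for i
      unfolding f'_def by (cases "i = m") auto
    have f'1: "f' i y \<le> 1" for i y
    proof (cases "i = m")
      case True
      have "c * exp (- \<theta> * \<bar>y\<bar>) \<le> 1 * 1" using c1 \<theta> by (intro mult_mono) (auto simp: c_def)
      then have "ennreal (c * exp (- \<theta> * \<bar>y\<bar>)) \<le> 1" by (simp add: ennreal_le_1)
      then have "f m y * ennreal (c * exp (- \<theta> * \<bar>y\<bar>)) \<le> 1 * 1" by (intro mult_mono Suc.prems(2)) auto
      then show ?thesis using True by (simp add: f'_def)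
    qed (simp add: f'_def Suc.prems(2))
    have f'p: "(\<Prod>i\<le>m. f' i (x i)) = (\<Prod>i\<le>m. f i (x i)) * ennreal (c * exp (- \<theta> * \<bar>x m\<bar>))" for x
    proof -
      have "(\<Prod>i\<le>m. f' i (x i)) = (\<Prod>i<m. f' i (x i)) * f' m (x m)" by (simp add: lessThan_Suc_atMost[symmetric])
      also have "(\<Prod>i<m. f' i (x i)) = (\<Prod>i<m. f i (x i))" by (intro prod.cong) (auto simp: f'_def)
      finally show ?thesis by (simp add: lessThan_Suc_atMost[symmetric] f'_def mult.assoc)
    qed
    have "(\<integral>\<^sup>+\<omega>. ?g \<omega> * ennreal (exp (- l * Y (\<tau> (Suc m)) \<omega>)) \<partial>M) = (\<integral>\<^sup>+\<omega>. ?g \<omega> * ennreal (c * exp (- \<theta> * Y (\<tau> m) \<omega>)) \<partial>M)"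
      using conditional_laplace[of "\<tau> m" "\<tau> (Suc m)" ?g l] gF l \<tau>0[of m] \<tau>(2)[of m] by (simp add: c_def \<theta>_def d_def)
    also have "\<dots> = (\<integral>\<^sup>+\<omega>. ennreal (image_ratio (\<delta> / 2) s (\<tau> 0) (Y (\<tau> 0) \<omega>)) * (\<Prod>i\<le>m. f' i (Y (\<tau> i) \<omega>)) \<partial>M)"
      unfolding f'p using Y_nonneg by (simp add: mult.assoc)
    also have "\<dots> = (\<integral>\<^sup>+\<omega>. (\<Prod>i\<le>m. f' i (Y (\<tau> i + s) \<omega>)) \<partial>M)"
      by (rule Suc.IH[OF f'_meas f'1])
    also have "\<dots> = (\<integral>\<^sup>+\<omega>. ?h \<omega> * ennreal (c * exp (- \<theta> * Y (\<tau> m + s) \<omega>)) \<partial>M)"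
      unfolding f'p using Y_nonneg by simp
    also have "\<dots> = (\<integral>\<^sup>+\<omega>. ?h \<omega> * ennreal (exp (- l * Y (\<tau> (Suc m) + s) \<omega>)) \<partial>M)"
      using conditional_laplace[of "\<tau> m + s" "\<tau> (Suc m) + s" ?h l] hF l \<tau>0[of m] \<tau>(2)[of m] s by (simp add: c_def \<theta>_def d_def)
    finally show "(\<integral>\<^sup>+\<omega>. ?g \<omega> * ennreal (exp (- l * Y (\<tau> (Suc m)) \<omega>)) \<partial>M) = (\<integral>\<^sup>+\<omega>. ?h \<omega> * ennreal (exp (- l * Y (\<tau> (Suc m) + s) \<omega>)) \<partial>M)" .
  qed (use Y_nonneg Suc.prems in auto)
  then show ?case by (simp add: mult.assoc)
qed

end

subsection \<open>Passage from grids to continuous time\<close>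

text \<open>For a fine mesh the grid point just before \<open>u\<close> still lies in the
  neighbourhood where \<open>f\<close> exceeds \<open>x\<close>; \<open>u < t\<close> keeps its
  index below \<open>n\<close>.\<close>

lemma grid_hits:
  fixes f :: "real \<Rightarrow> real"
  assumes f: "continuous_on {e..t} f" and u: "e \<le> u" "u < t" and x: "x < f u"
  shows "\<forall>\<^sub>F n in sequentially. \<exists>i<n. x < f (e + (t - e) * real i / real n)"
proof -
  have "e < t" using u by simp
  have "(f \<longlongrightarrow> f u) (at u within {e..t})" using f u by (auto simp: continuous_on_def)
  from order_tendstoD(1)[OF this x] obtain d where d: "d > 0"
    "\<And>v. v \<in> {e..t} \<Longrightarrow> v \<noteq> u \<Longrightarrow> dist v u < d \<Longrightarrow> x < f v"
    unfolding eventually_at by auto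
  obtain n0 :: nat where n0: "(t - e) / d < real n0" using reals_Archimedean2 by blast
  show ?thesis
    using eventually_ge_at_top[of "Suc n0"]
  proof eventually_elim
    fix n assume n: "Suc n0 \<le> n"
    then have npos: "0 < real n" by simp
    have "(t - e) / d < real n" using n0 n by linarith
    then have nd: "(t - e) / real n < d" using d npos by (simp add: field_simps)
    \<comment> \<open>Index of the last grid point not after \<open>u\<close>.\<close>
    define i where "i = nat \<lfloor>(u - e) * real n / (t - e)\<rfloor>"
    have r0: "0 \<le> (u - e) * real n / (t - e)" using u by simp
    then have i: "real i \<le> (u - e) * real n / (t - e)" "(u - e) * real n / (t - e) < real i + 1"
      unfolding i_def by linarith+
    have "(u - e) * real n / (t - e) < real n" using u npos by (simp add: field_simps)
    with i(1) have "i < n" by linarith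
    define v where "v = e + (t - e) * real i / real n"
    have v1: "v \<le> u" using i(1) npos u unfolding v_def by (simp add: field_simps)
    have "u - e < (t - e) / real n * (real i + 1)" using i(2) npos u by (simp add: field_simps)
    also have "\<dots> = (v - e) + (t - e) / real n" unfolding v_def by (simp add: algebra_simps add_divide_distrib diff_divide_distrib)
    finally have "u - v < (t - e) / real n" by simp
    then have "dist v u < d" using nd v1 by (simp add: dist_real_def)
    moreover have "v \<in> {e..t}" using v1 u npos unfolding v_def by simp
    ultimately have "x < f v" using d(2)[of v] x by (cases "v = u") auto
    then show "\<exists>i<n. x < f (e + (t - e) * real i / real n)" using \<open>i < n\<close> by (auto simp: v_def)
  qed
qed

text \<open>Uniform continuity: once the mesh is small, no single step can bridge the gap between
  \<open>c\<close> and \<open>b\<close>. Path by path this disposes of the overshoot event of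
  \<open>grid_lower\<close>.\<close>

lemma grid_no_jump:
  fixes f :: "real \<Rightarrow> real"
  assumes f: "continuous_on {e..t} f" and et: "e \<le> t" and bc: "b < c"
  shows "\<forall>\<^sub>F n in sequentially. \<not> (\<exists>i<n. c < f (e + (t - e) * real i / real n) \<and> f (e + (t - e) * real (Suc i) / real n) < b)"
proof -
  have "uniformly_continuous_on {e..t} f" by (rule compact_uniformly_continuous[OF f]) simp
  then obtain d where d: "d > 0" "\<And>v w. v \<in> {e..t} \<Longrightarrow> w \<in> {e..t} \<Longrightarrow> dist w v < d \<Longrightarrow> dist (f w) (f v) < c - b"
    unfolding uniformly_continuous_on_def using bc by (meson diff_gt_0_iff_gt)
  obtain n0 :: nat where n0: "(t - e) / d < real n0" using reals_Archimedean2 by blast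
  show ?thesis
    using eventually_ge_at_top[of "Suc n0"]
  proof (eventually_elim, safe)
    fix n i assume n: "Suc n0 \<le> n" and i: "i < n" and 
      fi: "c < f (e + (t - e) * real i / real n)" "f (e + (t - e) * real (Suc i) / real n) < b"
    have npos: "0 < real n" using n by simp
    have "(t - e) / d < real n" using n0 n by linarith
    then have nd: "(t - e) / real n < d" using d npos by (simp add: field_simps)
    have mem: "e + (t - e) * real j / real n \<in> {e..t}" if "j \<le> n" for j
    proof -
      have "real j / real n \<le> 1" using that npos by simp
      then have "(t - e) * (real j / real n) \<le> t - e" using et by (intro mult_left_le) auto
      then show ?thesis using et by simp
    qed
    have "e + (t - e) * real (Suc i) / real n - (e + (t - e) * real i / real n) = (t - e) / real n"
      by (simp add: algebra_simps add_divide_distrib diff_divide_distrib)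
    then have "dist (e + (t - e) * real (Suc i) / real n) (e + (t - e) * real i / real n) < d"
      using nd et by (simp add: dist_real_def)
    from d(2)[OF mem mem this] i fi bc show False by (simp add: dist_real_def)
  qed
qed

text \<open>A continuous function attains its maximum on a compact interval, so exceeding every
  smaller level forces the level to be reached. Closed events thus reduce to open ones.\<close>

lemma ex_ge_iff_ex_greater:
  fixes f :: "real \<Rightarrow> real"
  assumes f: "continuous_on {a..b} f"
  shows "(\<exists>t\<in>{a..b}. x \<le> f t) \<longleftrightarrow> (\<forall>j::nat. \<exists>t\<in>{a..b}. x - 1 / real (Suc j) < f t)"
proof safe
  fix t j assume "t \<in> {a..b}" "x \<le> f t"
  then show "\<exists>t\<in>{a..b}. x - 1 / real (Suc j) < f t" by (intro bexI[of _ t]) (auto intro: less_le_trans[of _ x])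
next
  assume all: "\<forall>j. \<exists>t\<in>{a..b}. x - 1 / real (Suc j) < f t"
  then have "{a..b} \<noteq> {}" by blast
  from continuous_attains_sup[OF compact_Icc this f]
  obtain m where m: "m \<in> {a..b}" "\<And>t. t \<in> {a..b} \<Longrightarrow> f t \<le> f m" by blast
  have "x - 1 / real (Suc j) \<le> f m" for j using all m(2) by (meson less_le_trans less_imp_le)
  moreover have "(\<lambda>j. x - 1 / real (Suc j)) \<longlonglongrightarrow> x - 0"
    by (intro tendsto_intros LIMSEQ_Suc[OF lim_1_over_n])
  ultimately have "x \<le> f m" using LIMSEQ_le_const2[of _ "x - 0" "f m"] by auto
  then show "\<exists>t\<in>{a..b}. x \<le> f t" using m(1) by blast
qed

lemma sets_Collect_ex_ge:
  fixes f :: "real \<Rightarrow> 'a \<Rightarrow> real"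
  assumes "\<And>\<omega>. \<omega> \<in> space M \<Longrightarrow> continuous_on {a..b} (\<lambda>t. f t \<omega>)"
    and f: "\<And>t. t \<in> {a..b} \<Longrightarrow> f t \<in> borel_measurable M"
  shows "{\<omega>\<in>space M. \<exists>t\<in>{a..b}. x \<le> f t \<omega>} \<in> sets M"
proof (cases "a \<le> b")
  case True
  have "{\<omega>\<in>space M. \<exists>t\<in>{a..b}. x \<le> f t \<omega>} = {\<omega>\<in>space M. \<forall>j::nat. \<exists>t\<in>{a..b}. x - 1 / real (Suc j) < f t \<omega>}"
    by (rule Collect_cong) (use ex_ge_iff_ex_greater[OF assms(1)] in blast)
  also have "\<dots> = (\<Inter>j::nat. {\<omega>\<in>space M. \<exists>t\<in>{a..b}. x - 1 / real (Suc j) < f t \<omega>})"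
    by auto
  also have "\<dots> \<in> sets M"
  proof (rule sets.countable_INT')
    have "{\<omega>\<in>space M. \<exists>t\<in>{a..b}. x - 1 / real (Suc j) < f t \<omega>} \<in> sets M" for j
      by (rule sets_Collect_ex_greater[OF assms(1) True f])
    then show "(\<lambda>j. {\<omega>\<in>space M. \<exists>t\<in>{a..b}. x - 1 / real (Suc j) < f t \<omega>}) ` UNIV \<subseteq> sets M" by blast
  qed auto
  finally show ?thesis .
qed simp

text \<open>Equidistant grids are not nested, so grid events are not monotone; dominated convergence
  of the indicators takes the place of continuity along monotone sequences.\<close>

lemma (in finite_measure) measure_tendsto_eventually_mem:
  assumes [measurable]: "S \<in> sets M" "\<And>n::nat. H n \<in> sets M" and ev: "AE \<omega> in M. \<omega> \<in> S \<longrightarrow> (\<forall>\<^sub>F n in sequentially. \<omega> \<in> H n)"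
  shows "(\<lambda>n. measure M (S \<inter> H n)) \<longlonglongrightarrow> measure M S"
proof -
  have "(\<lambda>n. \<integral>\<omega>. indicator (S \<inter> H n) \<omega> \<partial>M) \<longlonglongrightarrow> (\<integral>\<omega>. indicator S \<omega> \<partial>M :: real)"
  proof (rule integral_dominated_convergence[where w = "\<lambda>_. 1"])
    show "AE \<omega> in M. (\<lambda>n. indicator (S \<inter> H n) \<omega>) \<longlonglongrightarrow> (indicator S \<omega> :: real)"
      using ev
    proof eventually_elim
      fix \<omega> assume e: "\<omega> \<in> S \<longrightarrow> (\<forall>\<^sub>F n in sequentially. \<omega> \<in> H n)"
      show "(\<lambda>n. indicator (S \<inter> H n) \<omega>) \<longlonglongrightarrow> (indicator S \<omega> :: real)"
      proof (cases "\<omega> \<in> S")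
        case True
        with e have "\<forall>\<^sub>F n in sequentially. indicator (S \<inter> H n) \<omega> = (1 :: real)"
          by (auto elim: eventually_mono)
        with True show ?thesis by (simp add: tendsto_eventually)
      qed simp
    qed
  qed (auto simp: indicator_def)
  then show ?thesis by simp
qed

lemma (in finite_measure) measure_le_of_eventually_mem:
  assumes S: "S \<in> sets M" and H: "\<And>n::nat. H n \<in> sets M"
    and ev: "AE \<omega> in M. \<omega> \<in> S \<longrightarrow> (\<forall>\<^sub>F n in sequentially. \<omega> \<in> H n)"
    and le: "\<And>n. measure M (H n) \<le> c + b n" and b: "b \<longlonglongrightarrow> 0"
  shows "measure M S \<le> c"
proof (rule LIMSEQ_le[OF measure_tendsto_eventually_mem[OF S H ev]])
  show "(\<lambda>n. c + b n) \<longlonglongrightarrow> c" using tendsto_add[OF tendsto_const b] by simp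
  have "measure M (S \<inter> H n) \<le> c + b n" for n
    using finite_measure_mono[of "S \<inter> H n" "H n"] H le[of n] by auto
  then show "\<exists>N. \<forall>n\<ge>N. measure M (S \<inter> H n) \<le> c + b n" by blast
qed

lemma (in finite_measure) measure_tendsto_0_of_eventually_notin:
  assumes [measurable]: "\<And>n::nat. H n \<in> sets M" and ev: "\<And>\<omega>. \<omega> \<in> space M \<Longrightarrow> \<forall>\<^sub>F n in sequentially. \<omega> \<notin> H n"
  shows "(\<lambda>n. measure M (H n)) \<longlonglongrightarrow> 0"
proof -
  have "(\<lambda>n. measure M (space M \<inter> (space M - H n))) \<longlonglongrightarrow> measure M (space M)"
    using ev by (intro measure_tendsto_eventually_mem AE_I2) auto
  moreover have "measure M (space M \<inter> (space M - H n)) = measure M (space M) - measure M (H n)" for n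
    using finite_measure_compl[of "H n"] by (simp add: Int_absorb1)
  ultimately have "(\<lambda>n. measure M (space M) - (measure M (space M) - measure M (H n))) \<longlonglongrightarrow> measure M (space M) - measure M (space M)"
    by (intro tendsto_diff tendsto_const) simp
  then show ?thesis by simp
qed

text \<open>Splitting by the last index, not the first: each piece then constrains only time
  \<open>i\<close> and later times, and such events are transformed by the weight at time
  \<open>i\<close>.\<close>

lemma last_index_disjoint_union:
  fixes x :: "nat \<Rightarrow> 'a \<Rightarrow> real"
  shows "(\<Union>i<n. {\<omega>\<in>S. a \<le> x i \<omega> \<and> (\<forall>j\<in>{i<..n}. x j \<omega> < a)}) = {\<omega>\<in>S. x n \<omega> < a \<and> (\<exists>i<n. a \<le> x i \<omega>)}" (is ?U)
    and "disjoint_family_on (\<lambda>i. {\<omega>\<in>S. a \<le> x i \<omega> \<and> (\<forall>j\<in>{i<..n}. x j \<omega> < a)}) {..<n}" (is ?D)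
proof -
  show ?D
  proof (unfold disjoint_family_on_def, intro ballI impI)
    fix i j assume "i \<in> {..<n}" "j \<in> {..<n}" "i \<noteq> j"
    then show "{\<omega>\<in>S. a \<le> x i \<omega> \<and> (\<forall>j\<in>{i<..n}. x j \<omega> < a)} \<inter> {\<omega>\<in>S. a \<le> x j \<omega> \<and> (\<forall>k\<in>{j<..n}. x k \<omega> < a)} = {}"
      by (cases "i < j") (force simp: not_le[symmetric])+
  qed
  show ?U
  proof safe
    fix \<omega> i assume \<omega>: "\<omega> \<in> S" "x n \<omega> < a" and i: "i < n" "a \<le> x i \<omega>"
    define I where "I = {i. i < n \<and> a \<le> x i \<omega>}"
    have "finite I" "I \<noteq> {}" using i by (auto simp: I_def)
    then have m: "Max I \<in> I" "\<And>j. j \<in> I \<Longrightarrow> j \<le> Max I" by auto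
    have "x j \<omega> < a" if "j \<in> {Max I<..n}" for j
    proof (rule ccontr)
      assume "\<not> x j \<omega> < a"
      with that \<omega> have "j \<in> I" by (cases "j = n") (auto simp: I_def)
      with m(2) that show False by fastforce
    qed
    with m(1) \<omega> show "\<omega> \<in> (\<Union>i<n. {\<omega>\<in>S. a \<le> x i \<omega> \<and> (\<forall>j\<in>{i<..n}. x j \<omega> < a)})"
      by (auto simp: I_def)
  qed auto
qed

section \<open>Last-passage decomposition on a finite grid\<close>

context squared_bessel_setting
begin

abbreviation R :: "real \<Rightarrow> real \<Rightarrow> 'a \<Rightarrow> real" where
  "R s t \<omega> \<equiv> image_ratio (\<delta> / 2) s t (Y t \<omega>)"

text \<open>The ratio keeps the clock \<open>t\<close> but reads the path at \<open>t + s\<close>: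
  this is what \<open>R\<close> becomes under the change of measure.\<close>

abbreviation R' :: "real \<Rightarrow> real \<Rightarrow> 'a \<Rightarrow> real" where
  "R' s t \<omega> \<equiv> image_ratio (\<delta> / 2) s t (Y (t + s) \<omega>)"

context
  fixes s :: real assumes s: "0 < s"
begin

lemma R_measurable: "0 < t \<Longrightarrow> R s t \<in> borel_measurable M" "0 < t \<Longrightarrow> R' s t \<in> borel_measurable M"
  using s by (auto intro!: measurable_compose[OF Y_measurable image_ratio_measurable])

lemma image_ratio_continuous:
  assumes \<omega>: "\<omega> \<in> space M" and "0 < e" "0 \<le> r"
  shows "continuous_on {e..t} (\<lambda>u. image_ratio (\<delta> / 2) s u (Y (u + r) \<omega>))"
  unfolding image_ratio_def using assms s
  by (intro continuous_intros continuous_on_compose2[OF Y_continuous[OF \<omega>]]) auto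

lemma R_continuous: "\<omega> \<in> space M \<Longrightarrow> 0 < e \<Longrightarrow> continuous_on {e..t} (\<lambda>u. R s u \<omega>)"
  and R'_continuous: "\<omega> \<in> space M \<Longrightarrow> 0 < e \<Longrightarrow> continuous_on {e..t} (\<lambda>u. R' s u \<omega>)"
  using image_ratio_continuous[of \<omega> e 0] image_ratio_continuous[of \<omega> e s] s by auto

text \<open>The event is a product of indicators along the chain that starts at index
  \<open>i\<close>, so \<open>nn_integral_image_ratio_prod\<close> applies. The set \<open>A\<close>
  will be a half line for the upper estimate and a short interval above \<open>a\<close> for the
  lower one.\<close>

lemma last_passage_change_of_measure:
  fixes \<tau> :: "nat \<Rightarrow> real"
  assumes \<tau>: "0 < \<tau> 0" "\<And>i. \<tau> i \<le> \<tau> (Suc i)" and i: "i \<le> n" and A: "A \<in> sets borel"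
  shows "(\<integral>\<^sup>+\<omega>. ennreal (R s (\<tau> i) \<omega>) * indicator {\<omega>\<in>space M. R s (\<tau> i) \<omega> \<in> A \<and> (\<forall>j\<in>{i<..n}. R s (\<tau> j) \<omega> < a)} \<omega> \<partial>M)
    = emeasure M {\<omega>\<in>space M. R' s (\<tau> i) \<omega> \<in> A \<and> (\<forall>j\<in>{i<..n}. R' s (\<tau> j) \<omega> < a)}"
proof -
  note [measurable] = A
  have mono: "i \<le> j \<Longrightarrow> \<tau> i \<le> \<tau> j" for i j using \<tau>(2) by (rule lift_Suc_mono_le)
  have \<tau>0: "0 < \<tau> i" for i using mono[of 0 i] \<tau>(1) by simp
  \<comment> \<open>Indices are shifted by \<open>i\<close>, so that the weight sits at the first
    time of the product.\<close>
  define f :: "nat \<Rightarrow> real \<Rightarrow> ennreal" where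
    "f j = (if j = 0 then indicator {y. image_ratio (\<delta> / 2) s (\<tau> i) y \<in> A} else indicator {y. image_ratio (\<delta> / 2) s (\<tau> (i + j)) y < a})" for j
  have [measurable]: "{y. image_ratio (\<delta> / 2) s r y \<in> A} \<in> sets borel" for r
    using measurable_sets[OF image_ratio_measurable A, of "\<delta> / 2" s r] by (simp add: vimage_def)
  have f: "f j \<in> borel_measurable borel" for j
    unfolding f_def by (cases "j = 0") auto
  have f1: "f j y \<le> 1" for j y by (simp add: f_def indicator_def)
  have prod: "(\<Prod>j\<le>n - i. f j (Y (\<tau> (i + j) + r) \<omega>)) = indicator {\<omega>\<in>space M. image_ratio (\<delta> / 2) s (\<tau> i) (Y (\<tau> i + r) \<omega>) \<in> A \<and>
      (\<forall>j\<in>{i<..n}. image_ratio (\<delta> / 2) s (\<tau> j) (Y (\<tau> j + r) \<omega>) < a)} \<omega>" if "\<omega> \<in> space M" for r \<omega>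
  proof (cases "image_ratio (\<delta> / 2) s (\<tau> i) (Y (\<tau> i + r) \<omega>) \<in> A \<and> (\<forall>j\<in>{i<..n}. image_ratio (\<delta> / 2) s (\<tau> j) (Y (\<tau> j + r) \<omega>) < a)")
    case True
    then have "(\<Prod>j\<le>n - i. f j (Y (\<tau> (i + j) + r) \<omega>)) = 1"
      by (intro prod.neutral) (auto simp: f_def indicator_def)
    with True that show ?thesis by simp
  next
    case False
    then have "\<exists>j\<le>n - i. f j (Y (\<tau> (i + j) + r) \<omega>) = 0"
    proof (cases "image_ratio (\<delta> / 2) s (\<tau> i) (Y (\<tau> i + r) \<omega>) \<in> A")
      case True
      with False obtain j where "j \<in> {i<..n}" "\<not> image_ratio (\<delta> / 2) s (\<tau> j) (Y (\<tau> j + r) \<omega>) < a" by auto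
      then show ?thesis by (intro exI[of _ "j - i"]) (auto simp: f_def)
    qed (intro exI[of _ 0], simp add: f_def)
    then have "(\<Prod>j\<le>n - i. f j (Y (\<tau> (i + j) + r) \<omega>)) = 0"
      by (auto simp: prod_zero_iff)
    then show ?thesis using False by simp
  qed
  have "(\<integral>\<^sup>+\<omega>. ennreal (R s (\<tau> i) \<omega>) * indicator {\<omega>\<in>space M. R s (\<tau> i) \<omega> \<in> A \<and> (\<forall>j\<in>{i<..n}. R s (\<tau> j) \<omega> < a)} \<omega> \<partial>M)
    = (\<integral>\<^sup>+\<omega>. ennreal (R s (\<tau> (i + 0)) \<omega>) * (\<Prod>j\<le>n - i. f j (Y (\<tau> (i + j)) \<omega>)) \<partial>M)"
    by (rule nn_integral_cong) (use prod[of _ 0] in simp)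
  also have "\<dots> = (\<integral>\<^sup>+\<omega>. (\<Prod>j\<le>n - i. f j (Y (\<tau> (i + j) + s) \<omega>)) \<partial>M)"
    using \<tau> \<tau>0 by (intro nn_integral_image_ratio_prod[OF s _ _ f f1]) auto
  also have "\<dots> = (\<integral>\<^sup>+\<omega>. indicator {\<omega>\<in>space M. R' s (\<tau> i) \<omega> \<in> A \<and> (\<forall>j\<in>{i<..n}. R' s (\<tau> j) \<omega> < a)} \<omega> \<partial>M)"
    by (rule nn_integral_cong) (rule prod)
  also have "\<dots> = emeasure M {\<omega>\<in>space M. R' s (\<tau> i) \<omega> \<in> A \<and> (\<forall>j\<in>{i<..n}. R' s (\<tau> j) \<omega> < a)}"
  proof (rule nn_integral_indicator)
    have [measurable]: "R' s (\<tau> j) \<in> borel_measurable M" for j using R_measurable(2)[OF \<tau>0] .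
    show "{\<omega>\<in>space M. R' s (\<tau> i) \<omega> \<in> A \<and> (\<forall>j\<in>{i<..n}. R' s (\<tau> j) \<omega> < a)} \<in> sets M"
      by measurable
  qed
  finally show ?thesis .
qed

context
  fixes \<tau> :: "nat \<Rightarrow> real" and a :: real and n :: nat
  assumes \<tau>: "0 < \<tau> 0" "\<And>i. \<tau> i \<le> \<tau> (Suc i)" and a: "0 < a"
begin

lemma \<tau>_pos: "0 < \<tau> i"
  using lift_Suc_mono_le[of \<tau> 0 i] \<tau> by (meson less_le_trans le0)

lemma grid_measurable: "R s (\<tau> i) \<in> borel_measurable M" "R' s (\<tau> i) \<in> borel_measurable M"
  using R_measurable[OF \<tau>_pos] by auto

text \<open>On the piece with last index \<open>i\<close> the weight is at least \<open>a\<close>,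
  so \<open>a\<close> times its probability is at most its weighted mass, that is, the probability
  of the shifted piece. The pieces are disjoint and the bounds add up.\<close>

lemma grid_upper:
  "a * prob {\<omega>\<in>space M. R s (\<tau> n) \<omega> < a \<and> (\<exists>i<n. a \<le> R s (\<tau> i) \<omega>)}
    \<le> prob {\<omega>\<in>space M. R' s (\<tau> n) \<omega> < a \<and> (\<exists>i<n. a \<le> R' s (\<tau> i) \<omega>)}"
proof -
  note [measurable] = grid_measurable
  let ?G = "\<lambda>i. {\<omega>\<in>space M. a \<le> R s (\<tau> i) \<omega> \<and> (\<forall>j\<in>{i<..n}. R s (\<tau> j) \<omega> < a)}"
  let ?G' = "\<lambda>i. {\<omega>\<in>space M. a \<le> R' s (\<tau> i) \<omega> \<and> (\<forall>j\<in>{i<..n}. R' s (\<tau> j) \<omega> < a)}"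
  have le: "a * prob (?G i) \<le> prob (?G' i)" if "i < n" for i
  proof -
    have "ennreal a * emeasure M (?G i) = (\<integral>\<^sup>+\<omega>. ennreal a * indicator (?G i) \<omega> \<partial>M)"
      by (subst nn_integral_cmult_indicator) auto
    also have "\<dots> \<le> (\<integral>\<^sup>+\<omega>. ennreal (R s (\<tau> i) \<omega>) * indicator {\<omega>\<in>space M. R s (\<tau> i) \<omega> \<in> {a..} \<and> (\<forall>j\<in>{i<..n}. R s (\<tau> j) \<omega> < a)} \<omega> \<partial>M)"
      by (intro nn_integral_mono) (auto simp: indicator_def ennreal_leI)
    also have "\<dots> = emeasure M (?G' i)"
      using that by (subst last_passage_change_of_measure[OF \<tau>]) auto
    finally show ?thesis using a by (simp add: emeasure_eq_measure flip: ennreal_mult)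
  qed
  have "a * prob {\<omega>\<in>space M. R s (\<tau> n) \<omega> < a \<and> (\<exists>i<n. a \<le> R s (\<tau> i) \<omega>)} = a * (\<Sum>i<n. prob (?G i))"
    unfolding last_index_disjoint_union(1)[where x = "\<lambda>i. R s (\<tau> i)", symmetric]
    by (subst finite_measure_finite_Union) (auto intro: last_index_disjoint_union(2))
  also have "\<dots> \<le> (\<Sum>i<n. prob (?G' i))"
    unfolding sum_distrib_left by (intro sum_mono le) auto
  also have "\<dots> = prob {\<omega>\<in>space M. R' s (\<tau> n) \<omega> < a \<and> (\<exists>i<n. a \<le> R' s (\<tau> i) \<omega>)}"
    unfolding last_index_disjoint_union(1)[where x = "\<lambda>i. R' s (\<tau> i)", symmetric]
    by (subst finite_measure_finite_Union) (auto intro: last_index_disjoint_union(2))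
  finally show ?thesis .
qed

text \<open>
  The last term bounds the overshoot: if \<open>R' > a + \<eta>\<close> at the last grid time with \<open>R' \<ge> a\<close>, then \<open>R'\<close>
  drops below \<open>a\<close> within one step.
\<close>

lemma grid_lower:
  assumes \<eta>: "0 < \<eta>"
  shows "prob {\<omega>\<in>space M. R' s (\<tau> n) \<omega> < a \<and> (\<exists>i<n. a \<le> R' s (\<tau> i) \<omega>)}
    \<le> (a + \<eta>) * prob {\<omega>\<in>space M. R s (\<tau> n) \<omega> < a \<and> (\<exists>i<n. a \<le> R s (\<tau> i) \<omega>)}
      + prob {\<omega>\<in>space M. \<exists>i<n. a + \<eta> < R' s (\<tau> i) \<omega> \<and> R' s (\<tau> (Suc i)) \<omega> < a}"
proof -
  note [measurable] = grid_measurable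
  let ?b = "a + \<eta>"
  let ?G = "\<lambda>i. {\<omega>\<in>space M. a \<le> R s (\<tau> i) \<omega> \<and> (\<forall>j\<in>{i<..n}. R s (\<tau> j) \<omega> < a)}"
  let ?G' = "\<lambda>i. {\<omega>\<in>space M. R' s (\<tau> i) \<omega> \<in> {a..?b} \<and> (\<forall>j\<in>{i<..n}. R' s (\<tau> j) \<omega> < a)}"
  let ?bad = "{\<omega>\<in>space M. \<exists>i<n. a + \<eta> < R' s (\<tau> i) \<omega> \<and> R' s (\<tau> (Suc i)) \<omega> < a}"
  have le: "prob (?G' i) \<le> ?b * prob (?G i)" if "i < n" for i
  proof -
    have "emeasure M (?G' i) = (\<integral>\<^sup>+\<omega>. ennreal (R s (\<tau> i) \<omega>) * indicator {\<omega>\<in>space M. R s (\<tau> i) \<omega> \<in> {a..?b} \<and> (\<forall>j\<in>{i<..n}. R s (\<tau> j) \<omega> < a)} \<omega> \<partial>M)"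
      using that by (subst last_passage_change_of_measure[OF \<tau>]) auto
    also have "\<dots> \<le> (\<integral>\<^sup>+\<omega>. ennreal ?b * indicator (?G i) \<omega> \<partial>M)"
      by (intro nn_integral_mono) (auto simp: indicator_def ennreal_leI)
    also have "\<dots> = ennreal ?b * emeasure M (?G i)"
      by (subst nn_integral_cmult_indicator) auto
    finally have le: "emeasure M (?G' i) \<le> ennreal ?b * emeasure M (?G i)" .
    have b: "0 \<le> ?b" using a \<eta> by simp
    show ?thesis
      using le b unfolding emeasure_eq_measure ennreal_mult[OF b measure_nonneg, symmetric]
      by (subst (asm) ennreal_le_iff) auto
  qed
  have "{\<omega>\<in>space M. R' s (\<tau> n) \<omega> < a \<and> (\<exists>i<n. a \<le> R' s (\<tau> i) \<omega>)} \<subseteq> (\<Union>i<n. ?G' i) \<union> ?bad"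
  proof
    fix \<omega> assume "\<omega> \<in> {\<omega>\<in>space M. R' s (\<tau> n) \<omega> < a \<and> (\<exists>i<n. a \<le> R' s (\<tau> i) \<omega>)}"
    then have "\<omega> \<in> (\<Union>i<n. {\<omega>\<in>space M. a \<le> R' s (\<tau> i) \<omega> \<and> (\<forall>j\<in>{i<..n}. R' s (\<tau> j) \<omega> < a)})"
      unfolding last_index_disjoint_union(1)[where x = "\<lambda>i. R' s (\<tau> i)"] .
    then obtain i where i: "i < n" "\<omega> \<in> space M" "a \<le> R' s (\<tau> i) \<omega>" "\<forall>j\<in>{i<..n}. R' s (\<tau> j) \<omega> < a" by auto
    then have "R' s (\<tau> (Suc i)) \<omega> < a" by auto
    with i show "\<omega> \<in> (\<Union>i<n. ?G' i) \<union> ?bad" by (cases "R' s (\<tau> i) \<omega> \<le> ?b") auto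
  qed
  then have "prob {\<omega>\<in>space M. R' s (\<tau> n) \<omega> < a \<and> (\<exists>i<n. a \<le> R' s (\<tau> i) \<omega>)} \<le> prob ((\<Union>i<n. ?G' i) \<union> ?bad)"
    by (intro finite_measure_mono) auto
  also have "\<dots> \<le> prob (\<Union>i<n. ?G' i) + prob ?bad"
    by (intro measure_Un_le) auto
  also have "prob (\<Union>i<n. ?G' i) \<le> (\<Sum>i<n. prob (?G' i))"
    by (intro finite_measure_subadditive_finite) auto
  also have "\<dots> \<le> (\<Sum>i<n. ?b * prob (?G i))"
    by (intro sum_mono le) auto
  also have "\<dots> = ?b * prob {\<omega>\<in>space M. R s (\<tau> n) \<omega> < a \<and> (\<exists>i<n. a \<le> R s (\<tau> i) \<omega>)}"
    unfolding last_index_disjoint_union(1)[where x = "\<lambda>i. R s (\<tau> i)", symmetric] sum_distrib_left[symmetric]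
    by (subst finite_measure_finite_Union) (auto intro: last_index_disjoint_union(2))
  finally show ?thesis by simp
qed

end

lemma R_hit_sets: 
  assumes "0 < e" shows "{\<omega>\<in>space M. \<exists>u\<in>{e..t}. x \<le> R s u \<omega>} \<in> sets M"
  using assms by (intro sets_Collect_ex_ge R_continuous R_measurable) auto

text \<open>Continuity of \<open>R\<close> is available away from time 0 only, hence the exhaustion
  by compact intervals.\<close>

lemma R_hit_sets': "{\<omega>\<in>space M. \<exists>u\<in>{0<..t}. x \<le> R s u \<omega>} \<in> sets M"
proof -
  have "{\<omega>\<in>space M. \<exists>u\<in>{0<..t}. x \<le> R s u \<omega>} = (\<Union>j::nat. {\<omega>\<in>space M. \<exists>u\<in>{1 / real (Suc j)..t}. x \<le> R s u \<omega>})"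
  proof safe
    fix \<omega> u assume "\<omega> \<in> space M" "u \<in> {0<..t}" "x \<le> R s u \<omega>"
    moreover obtain j where "inverse (real (Suc j)) < u" using reals_Archimedean[of u] \<open>u \<in> {0<..t}\<close> by auto
    ultimately show "\<omega> \<in> (\<Union>j::nat. {\<omega>\<in>space M. \<exists>u\<in>{1 / real (Suc j)..t}. x \<le> R s u \<omega>})"
      by (intro UN_I[of j]) (auto simp: inverse_eq_divide intro!: bexI[of _ u])
  next
    fix j \<omega> u assume "u \<in> {1 / real (Suc j)..t}" "x \<le> R s u \<omega>"
    moreover have "0 < 1 / real (Suc j)" by simp
    ultimately have "0 < u" by (meson atLeastAtMost_iff less_le_trans)
    with \<open>u \<in> {1 / real (Suc j)..t}\<close> \<open>x \<le> R s u \<omega>\<close> show "\<exists>u\<in>{0<..t}. x \<le> R s u \<omega>"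
      by (intro bexI[of _ u]) auto
  qed
  also have "\<dots> \<in> sets M" by (intro sets.countable_UN image_subsetI R_hit_sets) (simp del: of_nat_Suc)
  finally show ?thesis .
qed

lemma crossing_sets:
  assumes "0 < e" "e \<le> t"
  shows "{\<omega>\<in>space M. R s t \<omega> < a \<and> (\<exists>u\<in>{e..t}. a < R s u \<omega>)} \<in> sets M" 
    "{\<omega>\<in>space M. R' s t \<omega> < a \<and> (\<exists>u\<in>{e..t}. a < R' s u \<omega>)} \<in> sets M"
proof -
  have [measurable]: "R s t \<in> borel_measurable M" "R' s t \<in> borel_measurable M" using R_measurable assms by auto
  have [measurable]: "{\<omega>\<in>space M. \<exists>u\<in>{e..t}. a < R s u \<omega>} \<in> sets M" "{\<omega>\<in>space M. \<exists>u\<in>{e..t}. a < R' s u \<omega>} \<in> sets M"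
    using assms by (auto intro!: sets_Collect_ex_greater R_continuous R'_continuous R_measurable)
  show "{\<omega>\<in>space M. R s t \<omega> < a \<and> (\<exists>u\<in>{e..t}. a < R s u \<omega>)} \<in> sets M" 
    "{\<omega>\<in>space M. R' s t \<omega> < a \<and> (\<exists>u\<in>{e..t}. a < R' s u \<omega>)} \<in> sets M"
    by measurable
qed

end
end

lemma image_ratio_small_time:
  assumes k: "0 < k" and s: "0 < s" and f: "(f \<longlongrightarrow> l) (at_right 0)" and l: "0 < l" and t: "0 < t"
  shows "\<exists>u\<in>{0<..<t}. a < image_ratio k s u (f u)"
proof -
  \<comment> \<open>For small \<open>u\<close> both \<open>u + s <= 2 * s\<close> and
    \<open>f u > l / 2\<close> hold; inserting them into the ratio gives this minorant, in which the
    exponential of \<open>1 / u\<close> beats the power.\<close>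
  have top: "filterlim (\<lambda>u. (u / (2 * s)) powr k * exp (l / 2 / (4 * u))) at_top (at_right 0)"
    using k s l by real_asymp
  have "\<forall>\<^sub>F u in at_right 0. a < (u / (2 * s)) powr k * exp (l / 2 / (4 * u))"
    using top by (simp add: filterlim_at_top_dense)
  moreover have "\<forall>\<^sub>F u in at_right 0. l / 2 < f u"
    using l by (intro order_tendstoD(1)[OF f]) simp
  moreover have "\<forall>\<^sub>F u in at_right 0. u \<in> {0<..<min s t}"
    using s t by (intro eventually_at_right_real) simp
  ultimately have "\<forall>\<^sub>F u in at_right 0. u \<in> {0<..<t} \<and> a < image_ratio k s u (f u)"
  proof eventually_elim
    fix u assume u: "a < (u / (2 * s)) powr k * exp (l / 2 / (4 * u))" "l / 2 < f u" "u \<in> {0<..<min s t}"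
    have "(u / (2 * s)) powr k \<le> (u / (u + s)) powr k"
      using u s k by (intro powr_mono2 divide_left_mono) auto
    moreover have "l / 2 / (4 * u) \<le> f u * s / (2 * u * (u + s))"
    proof -
      have "l / 2 / (4 * u) = l / 2 * s / (2 * u * (s + s))" using s u by (simp add: field_simps)
      also have "\<dots> \<le> f u * s / (2 * u * (u + s))"
        using u s l by (intro frac_le mult_right_mono mult_left_mono) auto
      finally show ?thesis .
    qed
    ultimately have "(u / (2 * s)) powr k * exp (l / 2 / (4 * u)) \<le> image_ratio k s u (f u)"
      unfolding image_ratio_def by (intro mult_mono) auto
    with u show "u \<in> {0<..<t} \<and> a < image_ratio k s u (f u)" by auto
  qed
  then have "\<exists>u. u \<in> {0<..<t} \<and> a < image_ratio k s u (f u)"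
    by (rule eventually_happens'[OF trivial_limit_at_right_real])
  then show ?thesis by blast
qed

section \<open>Limits over grids, levels and starting times\<close>

context squared_bessel_setting
begin

lemma AE_Y_pos:
  assumes t: "0 < t" shows "AE \<omega> in M. 0 < Y t \<omega>"
proof -
  have [measurable]: "Y t \<in> borel_measurable M" using Y_measurable t by simp
  have "AE x in density lborel (\<lambda>x. ennreal (gamma_density (\<delta> / 2) x)). x \<noteq> 0"
    using AE_lborel_singleton[of "0::real"] by (subst AE_density) auto
  then have "AE x in distr M borel (\<lambda>\<omega>. Y t \<omega> / (2 * t)). x \<noteq> 0"
    unfolding Y_gamma[OF t] .
  then have "AE \<omega> in M. Y t \<omega> / (2 * t) \<noteq> 0" by (subst (asm) AE_distr_iff) auto
  then show ?thesis
  proof eventually_elim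
    fix \<omega> assume "Y t \<omega> / (2 * t) \<noteq> 0"
    then show "0 < Y t \<omega>" using Y_nonneg[of t \<omega>] by (cases "Y t \<omega> = 0") auto
  qed
qed

context
  fixes s a t :: real assumes s: "0 < s" and a: "0 < a" and t: "0 < t"
begin

lemma hit_event_sets: "{\<omega>\<in>space M. R s t \<omega> < a \<and> (\<exists>u\<in>{0<..t}. a \<le> R s u \<omega>)} \<in> sets M"
proof -
  have [measurable]: "R s t \<in> borel_measurable M" using R_measurable s t by simp
  have [measurable]: "{\<omega>\<in>space M. \<exists>u\<in>{0<..t}. a \<le> R s u \<omega>} \<in> sets M" by (rule R_hit_sets'[OF s])
  show ?thesis by measurable
qed

lemma R'_below_sets: "{\<omega>\<in>space M. R' s t \<omega> < a} \<in> sets M"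
  using R_measurable(2)[OF s t] by measurable

text \<open>With \<open>Suc n\<close> steps the divisor never vanishes, and index
  \<open>Suc n\<close> is the final time \<open>t\<close>.\<close>

definition grid :: "real \<Rightarrow> nat \<Rightarrow> nat \<Rightarrow> real" where
  "grid e n i = e + (t - e) * real i / real (Suc n)"

lemma grid_props:
  assumes "0 < e" "e < t"
  shows "0 < grid e n 0" "grid e n i \<le> grid e n (Suc i)" "grid e n (Suc n) = t" "i < Suc n \<Longrightarrow> grid e n i \<in> {e..t}" "0 < grid e n i"
proof -
  show "0 < grid e n 0" "grid e n (Suc n) = t" using assms by (auto simp: grid_def)
  show "0 < grid e n i" unfolding grid_def using assms by (intro add_pos_nonneg) auto
  show mono: "grid e n i \<le> grid e n (Suc i)" for i
    using assms unfolding grid_def by (intro add_left_mono divide_right_mono mult_left_mono) auto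
  assume "i < Suc n"
  then have "grid e n i \<le> grid e n (Suc n)" "grid e n 0 \<le> grid e n i"
    by (auto intro: lift_Suc_mono_le[of "grid e n", OF mono])
  moreover have "grid e n (Suc n) = t" "grid e n 0 = e" by (auto simp: grid_def)
  ultimately show "grid e n i \<in> {e..t}" by simp
qed

lemma grid_hit_sets:
  assumes "0 < e" "e < t" 
  shows "{\<omega>\<in>space M. R s t \<omega> < x \<and> (\<exists>i<Suc n. x \<le> R s (grid e n i) \<omega>)} \<in> sets M"
    "{\<omega>\<in>space M. R' s t \<omega> < x \<and> (\<exists>i<Suc n. x \<le> R' s (grid e n i) \<omega>)} \<in> sets M"
    "{\<omega>\<in>space M. \<exists>i<Suc n. y < R' s (grid e n i) \<omega> \<and> R' s (grid e n (Suc i)) \<omega> < x} \<in> sets M"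
proof -
  have [measurable]: "R s (grid e n i) \<in> borel_measurable M" "R' s (grid e n i) \<in> borel_measurable M" for i
    using grid_props(5)[OF assms] by (auto intro!: R_measurable[OF s])
  have [measurable]: "R s t \<in> borel_measurable M" "R' s t \<in> borel_measurable M" using R_measurable s t by auto
  show "{\<omega>\<in>space M. R s t \<omega> < x \<and> (\<exists>i<Suc n. x \<le> R s (grid e n i) \<omega>)} \<in> sets M"
    "{\<omega>\<in>space M. R' s t \<omega> < x \<and> (\<exists>i<Suc n. x \<le> R' s (grid e n i) \<omega>)} \<in> sets M"
    "{\<omega>\<in>space M. \<exists>i<Suc n. y < R' s (grid e n i) \<omega> \<and> R' s (grid e n (Suc i)) \<omega> < x} \<in> sets M"
    by measurable
qed

text \<open>A strict crossing after time \<open>e\<close> is seen by all fine grids, so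
  \<open>grid_upper\<close> passes to the limit. The level \<open>b\<close> may lie below
  \<open>a\<close>: the right side only grows when its level is raised.\<close>

lemma hit_upper_open:
  assumes b: "0 < b" "b \<le> a" and e: "0 < e" "e < t"
  shows "b * prob {\<omega>\<in>space M. R s t \<omega> < b \<and> (\<exists>u\<in>{e..t}. b < R s u \<omega>)} \<le> prob {\<omega>\<in>space M. R' s t \<omega> < a}"
proof -
  let ?p = "prob {\<omega>\<in>space M. R' s t \<omega> < a}"
  have "prob {\<omega>\<in>space M. R s t \<omega> < b \<and> (\<exists>u\<in>{e..t}. b < R s u \<omega>)} \<le> ?p / b"
  proof (rule measure_le_of_eventually_mem[where b = "\<lambda>_. 0"])
    show "{\<omega>\<in>space M. R s t \<omega> < b \<and> (\<exists>u\<in>{e..t}. b < R s u \<omega>)} \<in> sets M"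
      using e by (intro crossing_sets s) auto
    show "{\<omega>\<in>space M. R s t \<omega> < b \<and> (\<exists>i<Suc n. b \<le> R s (grid e n i) \<omega>)} \<in> sets M" for n
      by (rule grid_hit_sets[OF e])
    show "AE \<omega> in M. \<omega> \<in> {\<omega>\<in>space M. R s t \<omega> < b \<and> (\<exists>u\<in>{e..t}. b < R s u \<omega>)} \<longrightarrow>
      (\<forall>\<^sub>F n in sequentially. \<omega> \<in> {\<omega>\<in>space M. R s t \<omega> < b \<and> (\<exists>i<Suc n. b \<le> R s (grid e n i) \<omega>)})"
    proof (rule AE_I2, rule impI)
      fix \<omega> assume \<omega>: "\<omega> \<in> space M" and "\<omega> \<in> {\<omega>\<in>space M. R s t \<omega> < b \<and> (\<exists>u\<in>{e..t}. b < R s u \<omega>)}"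
      then obtain u where u: "R s t \<omega> < b" "u \<in> {e..t}" "b < R s u \<omega>" by auto
      then have "u < t" by (cases "u = t") auto
      with u have "\<forall>\<^sub>F n in sequentially. \<exists>i<n. b < R s (e + (t - e) * real i / real n) \<omega>"
        by (intro grid_hits[OF R_continuous[OF s \<omega> e(1)]]) auto
      then have "\<forall>\<^sub>F n in sequentially. \<exists>i<Suc n. b < R s (grid e n i) \<omega>"
        unfolding grid_def by (subst (asm) eventually_sequentially_Suc[symmetric])
      then show "\<forall>\<^sub>F n in sequentially. \<omega> \<in> {\<omega>\<in>space M. R s t \<omega> < b \<and> (\<exists>i<Suc n. b \<le> R s (grid e n i) \<omega>)}"
        by eventually_elim (use u \<omega> in \<open>auto intro: less_imp_le\<close>)
    qed
    fix n
    have "b * prob {\<omega>\<in>space M. R s t \<omega> < b \<and> (\<exists>i<Suc n. b \<le> R s (grid e n i) \<omega>)}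
      \<le> prob {\<omega>\<in>space M. R' s t \<omega> < b \<and> (\<exists>i<Suc n. b \<le> R' s (grid e n i) \<omega>)}"
      using grid_upper[OF s, of "grid e n" b "Suc n"] grid_props[OF e, of n] b by simp
    also have "\<dots> \<le> ?p" using b R'_below_sets by (intro finite_measure_mono) auto
    finally show "prob {\<omega>\<in>space M. R s t \<omega> < b \<and> (\<exists>i<Suc n. b \<le> R s (grid e n i) \<omega>)} \<le> ?p / b + 0"
      using b by (simp add: field_simps)
  qed simp
  then show ?thesis using b by (simp add: field_simps)
qed

text \<open>A path may touch the level \<open>a\<close> without exceeding it. Lowering the level to
  \<open>b j\<close> and starting at \<open>e j\<close> makes every hit a strict crossing for large
  \<open>j\<close>, to which the open version applies.\<close>

lemma hit_upper:
  "a * prob {\<omega>\<in>space M. R s t \<omega> < a \<and> (\<exists>u\<in>{0<..t}. a \<le> R s u \<omega>)} \<le> prob {\<omega>\<in>space M. R' s t \<omega> < a}"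
proof -
  let ?H = "{\<omega>\<in>space M. R s t \<omega> < a \<and> (\<exists>u\<in>{0<..t}. a \<le> R s u \<omega>)}"
  \<comment> \<open>\<open>Suc (Suc j)\<close> makes \<open>b j\<close> positive and, below,
    \<open>e j\<close> smaller than \<open>t\<close> from \<open>j = 0\<close> on.\<close>
  define b where "b j = a - a / real (Suc (Suc j))" for j :: nat
  define e where "e j = t / real (Suc (Suc j))" for j :: nat
  let ?S = "\<lambda>j. {\<omega>\<in>space M. R s t \<omega> < b j \<and> (\<exists>u\<in>{e j..t}. b j < R s u \<omega>)}"
  have b: "0 < b j" "b j < a" for j using a by (auto simp: b_def field_simps intro!: add_pos_nonneg)
  have e: "0 < e j" "e j < t" for j using t by (auto simp: e_def field_simps intro!: add_pos_nonneg)
  have blim: "b \<longlonglongrightarrow> a"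
  proof -
    have "(\<lambda>j. a - a * (1 / real (Suc (Suc j)))) \<longlonglongrightarrow> a - a * 0"
      by (intro tendsto_intros LIMSEQ_Suc[OF LIMSEQ_Suc[OF lim_1_over_n]])
    then show ?thesis by (simp add: b_def[abs_def])
  qed
  have elim: "e \<longlonglongrightarrow> 0"
  proof -
    have "(\<lambda>j. t * (1 / real (Suc (Suc j)))) \<longlonglongrightarrow> t * 0"
      by (intro tendsto_intros LIMSEQ_Suc[OF LIMSEQ_Suc[OF lim_1_over_n]])
    then show ?thesis by (simp add: e_def[abs_def])
  qed
  have S: "?S j \<in> sets M" for j using e[of j] by (intro crossing_sets s) auto
  have "(\<lambda>j. prob (?H \<inter> ?S j)) \<longlonglongrightarrow> prob ?H"
  proof (rule measure_tendsto_eventually_mem[OF hit_event_sets S], rule AE_I2, rule impI)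
    fix \<omega> assume \<omega>: "\<omega> \<in> space M" and "\<omega> \<in> ?H"
    then obtain u where u: "R s t \<omega> < a" "u \<in> {0<..t}" "a \<le> R s u \<omega>" by auto
    have "\<forall>\<^sub>F j in sequentially. R s t \<omega> < b j" by (rule order_tendstoD(1)[OF blim u(1)])
    moreover have "\<forall>\<^sub>F j in sequentially. e j < u" using u by (intro order_tendstoD(2)[OF elim]) auto
    ultimately show "\<forall>\<^sub>F j in sequentially. \<omega> \<in> ?S j"
    proof eventually_elim
      fix j assume "R s t \<omega> < b j" "e j < u"
      moreover have "b j < R s u \<omega>" using b(2)[of j] u by simp
      ultimately show "\<omega> \<in> ?S j" using \<omega> u by (auto intro!: bexI[of _ u])
    qed
  qed
  from tendsto_mult[OF blim this]
  have lim: "(\<lambda>j. b j * prob (?H \<inter> ?S j)) \<longlonglongrightarrow> a * prob ?H" .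
  have "b j * prob (?H \<inter> ?S j) \<le> prob {\<omega>\<in>space M. R' s t \<omega> < a}" for j
  proof -
    have "b j * prob (?H \<inter> ?S j) \<le> b j * prob (?S j)"
      using b[of j] S by (intro mult_left_mono finite_measure_mono) auto
    also have "\<dots> \<le> prob {\<omega>\<in>space M. R' s t \<omega> < a}"
      using b[of j] e[of j] by (intro hit_upper_open) auto
    finally show ?thesis .
  qed
  then show ?thesis by (intro LIMSEQ_le_const2[OF lim]) auto
qed

text \<open>The shifted path starts from \<open>Y s > 0\<close>, so \<open>R'\<close> strictly
  exceeds \<open>a\<close> near time 0 and fine grids see it; the level can stay at
  \<open>a\<close>. The mesh tends to 0 first, then the overshoot \<eta>, then the starting time
  \<open>e\<close>.\<close>

lemma hit_lower:
  "prob {\<omega>\<in>space M. R' s t \<omega> < a} \<le> a * prob {\<omega>\<in>space M. R s t \<omega> < a \<and> (\<exists>u\<in>{0<..t}. a \<le> R s u \<omega>)}"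
proof -
  let ?H = "{\<omega>\<in>space M. R s t \<omega> < a \<and> (\<exists>u\<in>{0<..t}. a \<le> R s u \<omega>)}"
  let ?T = "\<lambda>e. {\<omega>\<in>space M. R' s t \<omega> < a \<and> (\<exists>u\<in>{e..t}. a < R' s u \<omega>)}"
  have 1: "prob (?T e) \<le> (a + \<eta>) * prob ?H" if e: "0 < e" "e < t" and \<eta>: "0 < \<eta>" for e \<eta>
  proof (rule measure_le_of_eventually_mem)
    let ?bad = "\<lambda>n. {\<omega>\<in>space M. \<exists>i<Suc n. a + \<eta> < R' s (grid e n i) \<omega> \<and> R' s (grid e n (Suc i)) \<omega> < a}"
    show "?T e \<in> sets M" using e by (intro crossing_sets s) auto
    show "{\<omega>\<in>space M. R' s t \<omega> < a \<and> (\<exists>i<Suc n. a \<le> R' s (grid e n i) \<omega>)} \<in> sets M" for n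
      by (rule grid_hit_sets[OF e])
    show "AE \<omega> in M. \<omega> \<in> ?T e \<longrightarrow>
      (\<forall>\<^sub>F n in sequentially. \<omega> \<in> {\<omega>\<in>space M. R' s t \<omega> < a \<and> (\<exists>i<Suc n. a \<le> R' s (grid e n i) \<omega>)})"
    proof (rule AE_I2, rule impI)
      fix \<omega> assume \<omega>: "\<omega> \<in> space M" and "\<omega> \<in> ?T e"
      then obtain u where u: "R' s t \<omega> < a" "u \<in> {e..t}" "a < R' s u \<omega>" by auto
      then have "u < t" by (cases "u = t") auto
      with u have "\<forall>\<^sub>F n in sequentially. \<exists>i<n. a < R' s (e + (t - e) * real i / real n) \<omega>"
        by (intro grid_hits[OF R'_continuous[OF s \<omega> e(1)]]) auto
      then have "\<forall>\<^sub>F n in sequentially. \<exists>i<Suc n. a < R' s (grid e n i) \<omega>"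
        unfolding grid_def by (subst (asm) eventually_sequentially_Suc[symmetric])
      then show "\<forall>\<^sub>F n in sequentially. \<omega> \<in> {\<omega>\<in>space M. R' s t \<omega> < a \<and> (\<exists>i<Suc n. a \<le> R' s (grid e n i) \<omega>)}"
        by eventually_elim (use u \<omega> in \<open>auto intro: less_imp_le\<close>)
    qed
    show "(\<lambda>n. prob (?bad n)) \<longlonglongrightarrow> 0"
    proof (rule measure_tendsto_0_of_eventually_notin)
      show "?bad n \<in> sets M" for n by (rule grid_hit_sets[OF e])
      fix \<omega> assume \<omega>: "\<omega> \<in> space M"
      have "\<forall>\<^sub>F n in sequentially. \<not> (\<exists>i<n. a + \<eta> < R' s (e + (t - e) * real i / real n) \<omega> \<and> R' s (e + (t - e) * real (Suc i) / real n) \<omega> < a)"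
        using e \<eta> by (intro grid_no_jump[OF R'_continuous[OF s \<omega> e(1)]]) auto
      then have "\<forall>\<^sub>F n in sequentially. \<not> (\<exists>i<Suc n. a + \<eta> < R' s (grid e n i) \<omega> \<and> R' s (grid e n (Suc i)) \<omega> < a)"
        unfolding grid_def by (subst (asm) eventually_sequentially_Suc[symmetric])
      then show "\<forall>\<^sub>F n in sequentially. \<omega> \<notin> ?bad n" by eventually_elim auto
    qed
    fix n
    have "prob {\<omega>\<in>space M. R' s t \<omega> < a \<and> (\<exists>i<Suc n. a \<le> R' s (grid e n i) \<omega>)}
      \<le> (a + \<eta>) * prob {\<omega>\<in>space M. R s t \<omega> < a \<and> (\<exists>i<Suc n. a \<le> R s (grid e n i) \<omega>)} + prob (?bad n)"
      using grid_lower[OF s, of "grid e n" a \<eta> "Suc n"] grid_props[OF e, of n] a \<eta> by simp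
    also have "\<dots> \<le> (a + \<eta>) * prob ?H + prob (?bad n)"
    proof -
      have "{\<omega>\<in>space M. R s t \<omega> < a \<and> (\<exists>i<Suc n. a \<le> R s (grid e n i) \<omega>)} \<subseteq> ?H"
        using grid_props(4)[OF e] e by fastforce
      then show ?thesis
        using a \<eta> hit_event_sets by (intro add_right_mono mult_left_mono finite_measure_mono) auto
    qed
    finally show "prob {\<omega>\<in>space M. R' s t \<omega> < a \<and> (\<exists>i<Suc n. a \<le> R' s (grid e n i) \<omega>)} \<le> (a + \<eta>) * prob ?H + prob (?bad n)" .
  qed
  have 2: "prob (?T e) \<le> a * prob ?H" if e: "0 < e" "e < t" for e
  proof (rule field_le_epsilon)
    fix \<eta> :: real assume \<eta>: "0 < \<eta>"
    have "\<eta> * prob ?H \<le> \<eta> * 1" using \<eta> by (intro mult_left_mono) auto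
    then show "prob (?T e) \<le> a * prob ?H + \<eta>" using 1[OF e \<eta>] by (simp add: distrib_right)
  qed
  define e where "e j = t / real (Suc (Suc j))" for j :: nat
  have e: "0 < e j" "e j < t" for j using t by (auto simp: e_def field_simps intro!: add_pos_nonneg)
  have elim: "e \<longlonglongrightarrow> 0"
  proof -
    have "(\<lambda>j. t * (1 / real (Suc (Suc j)))) \<longlonglongrightarrow> t * 0"
      by (intro tendsto_intros LIMSEQ_Suc[OF LIMSEQ_Suc[OF lim_1_over_n]])
    then show ?thesis by (simp add: e_def[abs_def])
  qed
  show ?thesis
  proof (rule measure_le_of_eventually_mem[OF R'_below_sets, where b = "\<lambda>_. 0"])
    show "?T (e j) \<in> sets M" for j using e[of j] by (intro crossing_sets s) auto
    show "prob (?T (e j)) \<le> a * prob ?H + 0" for j using 2[OF e] by simp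
    show "AE \<omega> in M. \<omega> \<in> {\<omega>\<in>space M. R' s t \<omega> < a} \<longrightarrow> (\<forall>\<^sub>F j in sequentially. \<omega> \<in> ?T (e j))"
      using AE_Y_pos[OF s] AE_space
    proof (eventually_elim, intro impI)
      fix \<omega> assume Y: "0 < Y s \<omega>" and \<omega>: "\<omega> \<in> space M" and R': "\<omega> \<in> {\<omega>\<in>space M. R' s t \<omega> < a}"
      have "continuous_on {0..} (\<lambda>u. Y (u + s) \<omega>)"
        using s by (intro continuous_on_compose2[OF Y_continuous[OF \<omega>]] continuous_intros) auto
      from bspec[OF this[unfolded continuous_on_def], of 0]
      have "((\<lambda>u. Y (u + s) \<omega>) \<longlongrightarrow> Y s \<omega>) (at 0 within {0..})" by simp
      then have "((\<lambda>u. Y (u + s) \<omega>) \<longlongrightarrow> Y s \<omega>) (at_right 0)"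
        by (rule tendsto_within_subset) auto
      from image_ratio_small_time[OF _ s this Y t, of "\<delta> / 2" a] \<delta>_pos
      obtain u where u: "u \<in> {0<..<t}" "a < R' s u \<omega>" by auto
      have "\<forall>\<^sub>F j in sequentially. e j < u" using u by (intro order_tendstoD(2)[OF elim]) auto
      then show "\<forall>\<^sub>F j in sequentially. \<omega> \<in> ?T (e j)"
        by eventually_elim (use u R' in \<open>auto intro!: bexI[of _ u]\<close>)
    qed
  qed simp
qed

theorem hit_probability:
  "prob {\<omega>\<in>space M. \<exists>u\<in>{0<..t}. a \<le> R s u \<omega>} = prob {\<omega>\<in>space M. a \<le> R s t \<omega>} + prob {\<omega>\<in>space M. R' s t \<omega> < a} / a"
proof -
  have [measurable]: "R s t \<in> borel_measurable M" using R_measurable s t by simp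
  let ?H = "{\<omega>\<in>space M. R s t \<omega> < a \<and> (\<exists>u\<in>{0<..t}. a \<le> R s u \<omega>)}"
  have "{\<omega>\<in>space M. \<exists>u\<in>{0<..t}. a \<le> R s u \<omega>} = {\<omega>\<in>space M. a \<le> R s t \<omega>} \<union> ?H"
    using t by (auto simp: not_le intro: bexI[of _ t])
  moreover have "prob ({\<omega>\<in>space M. a \<le> R s t \<omega>} \<union> ?H) = prob {\<omega>\<in>space M. a \<le> R s t \<omega>} + prob ?H"
    using hit_event_sets by (intro finite_measure_Union) auto
  moreover have "a * prob ?H = prob {\<omega>\<in>space M. R' s t \<omega> < a}"
    using hit_upper hit_lower by simp
  ultimately show ?thesis using a by (simp add: field_simps)
qed

end
end

subsection \<open>The distribution function and its derivative\<close>

text \<open>Logarithm of \<open>a\<close> over the power in front of the image ratio: the ratio is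
  at least \<open>a\<close> when its exponent is at least this. It is also the bracket under the
  root in \<open>psi\<close>.\<close>

definition log_ratio :: "real \<Rightarrow> real \<Rightarrow> real \<Rightarrow> real \<Rightarrow> real" where
  "log_ratio k s a t = ln (a * ((t + s) / t) powr k)"

text \<open>The two gamma integrals are P(Y < threshold) at times \<open>t\<close> and
  \<open>t + s\<close>; the thresholds solve \<open>image_ratio = a\<close> for
  \<open>y / (2 * t)\<close> and for \<open>y / (2 * (t + s))\<close>. If \<open>log_ratio\<close>
  is 0 both integrals vanish and the value is 1.\<close>

definition hitting_cdf :: "real \<Rightarrow> real \<Rightarrow> real \<Rightarrow> real \<Rightarrow> real" where
  "hitting_cdf k s a t =
     1 - integral {0..(t + s) / s * log_ratio k s a t} (gamma_density k)
       + integral {0..t / s * log_ratio k s a t} (gamma_density k) / a"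

lemma log_ratio_eq:
  assumes "0 < s" "0 < a" "0 < t"
  shows "log_ratio k s a t = k * ln (1 + s / t) + ln a"
proof -
  have "(t + s) / t = 1 + s / t" "0 < 1 + s / t" using assms by (auto simp: field_simps)
  then show ?thesis using assms by (simp add: log_ratio_def ln_mult ln_powr)
qed

lemma log_ratio_has_derivative:
  assumes "0 < s" "0 < a" "0 < t"
  shows "((\<lambda>t. log_ratio k s a t) has_real_derivative - k * s / (t * (t + s))) (at t)"
proof -
  have "0 < 1 + s / t" using assms by (auto intro: add_pos_pos)
  then have "((\<lambda>t. k * ln (1 + s / t) + ln a) has_real_derivative - k * s / (t * (t + s))) (at t)"
    using assms by (auto intro!: derivative_eq_intros simp: field_simps power2_eq_square)
  then show ?thesis
    by (rule has_field_derivative_transform_within[of _ _ _ _ t]) (use assms in \<open>auto simp: log_ratio_eq dist_real_def\<close>)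
qed

lemma exp_log_ratio:
  assumes "0 < s" "0 < a" "0 < t"
  shows "exp (log_ratio k s a t) = a * ((t + s) / t) powr k"
  using assms by (simp add: log_ratio_def)

lemma gamma_density_integrable:
  assumes k: "0 < k"
  shows "gamma_density k integrable_on {0..z}" "integrable lborel (gamma_density k)"
proof -
  have "(\<integral>\<^sup>+x. ennreal (gamma_density k x) \<partial>lborel) = 1"
    using gamma_laplace[OF k, of 0] by (simp add: emeasure_density)
  then show i: "integrable lborel (gamma_density k)"
    using gamma_density_nonneg[OF k] by (intro integrableI_nonneg) auto
  have "gamma_density k integrable_on UNIV"
    using integrable_on_lborel[OF i] .
  then show "gamma_density k integrable_on {0..z}"
    by (rule integrable_on_subinterval[of _ UNIV]) auto
qed

lemma gamma_cdf:
  assumes k: "0 < k"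
  shows "emeasure (density lborel (\<lambda>x. ennreal (gamma_density k x))) {..z} = ennreal (integral {0..z} (gamma_density k))"
    and "emeasure (density lborel (\<lambda>x. ennreal (gamma_density k x))) {..<z} = ennreal (integral {0..z} (gamma_density k))"
proof -
  have ae: "AE x in lborel. x \<noteq> z" by (rule AE_lborel_singleton)
  have "(\<integral>\<^sup>+x. ennreal (gamma_density k x) * indicator {..z} x \<partial>lborel) = (\<integral>\<^sup>+x. ennreal (gamma_density k x) * indicator {0..z} x \<partial>lborel)"
    by (rule nn_integral_cong) (auto simp: indicator_def gamma_density_def)
  also have "\<dots> = ennreal (integral {0..z} (gamma_density k))"
    using gamma_density_nonneg[OF k] gamma_density_integrable[OF k]
    by (intro nn_integral_has_integral_lebesgue' integrable_integral) auto
  finally have i: "(\<integral>\<^sup>+x. ennreal (gamma_density k x) * indicator {..z} x \<partial>lborel) = ennreal (integral {0..z} (gamma_density k))" .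
  then show "emeasure (density lborel (\<lambda>x. ennreal (gamma_density k x))) {..z} = ennreal (integral {0..z} (gamma_density k))"
    by (subst emeasure_density) auto
  have "(\<integral>\<^sup>+x. ennreal (gamma_density k x) * indicator {..<z} x \<partial>lborel) = (\<integral>\<^sup>+x. ennreal (gamma_density k x) * indicator {..z} x \<partial>lborel)"
    by (rule nn_integral_cong_AE, use ae in eventually_elim) (auto simp: indicator_def)
  then show "emeasure (density lborel (\<lambda>x. ennreal (gamma_density k x))) {..<z} = ennreal (integral {0..z} (gamma_density k))"
    using i by (subst emeasure_density) auto
qed

text \<open>For \<open>k < 1\<close> the density is unbounded near 0. The fundamental theorem is
  therefore applied on an interval around \<open>z\<close> that stays away from 0, and the rest is a
  constant.\<close>

lemma gamma_cdf_has_derivative: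
  assumes k: "0 < k" and z: "0 < z"
  shows "((\<lambda>z. integral {0..z} (gamma_density k)) has_real_derivative z powr (k - 1) * exp (- z) / Gamma k) (at z)"
proof -
  have c: "continuous_on {z / 2..2 * z} (\<lambda>x. x powr (k - 1) * exp (- x) / Gamma k)"
    using z Gamma_real_pos[OF k] by (intro continuous_intros) auto
  have "((\<lambda>w. integral {z / 2..w} (\<lambda>x. x powr (k - 1) * exp (- x) / Gamma k)) has_real_derivative z powr (k - 1) * exp (- z) / Gamma k) (at z within {z / 2..2 * z})"
    using z by (intro integral_has_real_derivative[OF c]) auto
  moreover have "at z within {z / 2..2 * z} = at z" using z by (intro at_within_Icc_at) auto
  ultimately have "((\<lambda>w. integral {z / 2..w} (\<lambda>x. x powr (k - 1) * exp (- x) / Gamma k)) has_real_derivative z powr (k - 1) * exp (- z) / Gamma k) (at z)"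
    by (simp only:)
  from DERIV_add[OF DERIV_const this, of "integral {0..z / 2} (gamma_density k)"]
  have "((\<lambda>w. integral {0..z / 2} (gamma_density k) + integral {z / 2..w} (\<lambda>x. x powr (k - 1) * exp (- x) / Gamma k)) has_real_derivative z powr (k - 1) * exp (- z) / Gamma k) (at z)"
    by (simp only: add_0)
  then show ?thesis
  proof (rule has_field_derivative_transform_within[where d = "z / 2"])
    fix w assume "dist w z < z / 2"
    then have w: "z / 2 \<le> w" unfolding dist_real_def by linarith
    have "integral {z / 2..w} (\<lambda>x. x powr (k - 1) * exp (- x) / Gamma k) = integral {z / 2..w} (gamma_density k)"
      using z by (intro integral_cong) (auto simp: gamma_density_def)
    then show "integral {0..z / 2} (gamma_density k) + integral {z / 2..w} (\<lambda>x. x powr (k - 1) * exp (- x) / Gamma k) = integral {0..w} (gamma_density k)"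
      using w z gamma_density_integrable[OF k]
        Henstock_Kurzweil_Integration.integral_combine[where a = 0 and c = "z / 2" and b = w and f = "gamma_density k"] by simp
  qed (use z in auto)
qed

text \<open>The moving thresholds contribute terms with the derivative of \<open>log_ratio\<close>.
  They cancel because the two gamma densities at the thresholds are proportional with the right
  factor.\<close>

lemma hitting_cdf_has_derivative:
  assumes k: "0 < k" and s: "0 < s" and a: "0 < a" and t: "0 < t" and L: "0 < log_ratio k s a t"
  shows "((\<lambda>t. hitting_cdf k s a t) has_real_derivative
    1 / Gamma k * (1 / t) * ((t + s) / s) powr (k - 1) * log_ratio k s a t powr k * exp (- ((t + s) / s) * log_ratio k s a t)) (at t)"
proof -
  let ?L = "log_ratio k s a" and ?g = "\<lambda>z. z powr (k - 1) * exp (- z) / Gamma k"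
  define l where "l = ?L t"
  define l' where "l' = - k * s / (t * (t + s))"
  have dL: "(?L has_real_derivative l') (at t)"
    unfolding l'_def using log_ratio_has_derivative[OF s a t] by simp
  have l: "0 < l" using L by (simp add: l_def)
  have dA: "((\<lambda>t. (t + s) / s * ?L t) has_real_derivative l / s + (t + s) / s * l') (at t)"
    using s by (auto intro!: derivative_eq_intros dL simp: l_def add_divide_distrib mult.commute)
  have dB: "((\<lambda>t. t / s * ?L t) has_real_derivative l / s + t / s * l') (at t)"
    using s by (auto intro!: derivative_eq_intros dL simp: l_def add_divide_distrib mult.commute)
  have A: "0 < (t + s) / s * l" and B: "0 < t / s * l" using s t l by auto
  note DA = DERIV_chain2[OF gamma_cdf_has_derivative[OF k A[unfolded l_def]] dA, folded l_def]
  note DB = DERIV_chain2[OF gamma_cdf_has_derivative[OF k B[unfolded l_def]] dB, folded l_def]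
  have D: "((\<lambda>t. hitting_cdf k s a t) has_real_derivative
     - (?g ((t + s) / s * l) * (l / s + (t + s) / s * l')) + ?g (t / s * l) * (l / s + t / s * l') / a) (at t)"
    unfolding hitting_cdf_def by (rule derivative_eq_intros DA DB refl | use a in simp)+
  \<comment> \<open>The thresholds differ by \<open>l\<close>, and \<open>exp l\<close> is
    \<open>a\<close> times a power of \<open>(t + s) / t\<close> by definition of
    \<open>log_ratio\<close>. The quotient of the power factors of the densities removes all but one
    power.\<close>
  have gB: "?g (t / s * l) = ?g ((t + s) / s * l) * (a * ((t + s) / t))"
  proof -
    have "(t + s) / s * l = t / s * l + l" using s by (simp add: field_simps)
    then have e: "exp (- ((t + s) / s * l)) = exp (- (t / s * l)) * exp (- l)" by (simp flip: exp_add)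
    have "exp l = a * ((t + s) / t) powr k" using exp_log_ratio[OF s a t] by (simp add: l_def)
    then have el: "exp (- l) * (a * ((t + s) / t) powr k) = 1" by (metis exp_minus_inverse mult.commute)
    have "((t + s) / s * l) powr (k - 1) = ((t + s) / t) powr (k - 1) * (t / s * l) powr (k - 1)"
    proof -
      have "(t + s) / s * l = (t + s) / t * (t / s * l)" using t by simp
      then show ?thesis using s t l by (simp only: powr_mult)
    qed
    moreover have "((t + s) / t) powr (k - 1) * ((t + s) / t) = ((t + s) / t) powr k"
      using s t by (simp add: powr_diff)
    ultimately have "((t + s) / s * l) powr (k - 1) * ((t + s) / t) = ((t + s) / t) powr k * (t / s * l) powr (k - 1)"
      by (metis (no_types, lifting) mult.assoc mult.commute)
    moreover have "P * (E1 * E2) / G * (a * Q) = (E2 * (a * W)) * (V * E1 / G)" if "P * Q = W * V" for P Q W V E1 E2 G :: real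
    proof -
      have "P * (E1 * E2) / G * (a * Q) = (P * Q) * (E1 * E2 * a / G)" by simp
      then show ?thesis unfolding that by simp
    qed
    ultimately have "?g ((t + s) / s * l) * (a * ((t + s) / t)) = (exp (- l) * (a * ((t + s) / t) powr k)) * ?g (t / s * l)"
      unfolding e by blast
    then show ?thesis unfolding el by simp
  qed
  have "- (?g ((t + s) / s * l) * (l / s + (t + s) / s * l')) + ?g (t / s * l) * (l / s + t / s * l') / a
     = ?g ((t + s) / s * l) * (- (l / s + (t + s) / s * l') + (t + s) / t * (l / s + t / s * l'))"
  proof -
    have "- (c * x) + (c * (a * Q)) * y / a = c * (- x + Q * y)" for c x y Q :: real
      using a by (simp add: field_simps)
    then show ?thesis unfolding gB .
  qed
  \<comment> \<open>The terms with \<open>l'\<close> drop out, leaving \<open>l / s\<close> times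
    \<open>(t + s) / t - 1\<close>.\<close>
  also have "- (l / s + (t + s) / s * l') + (t + s) / t * (l / s + t / s * l') = l / t"
    using s t by (simp add: field_simps)
  also have "?g ((t + s) / s * l) * (l / t) = 1 / Gamma k * (1 / t) * ((t + s) / s) powr (k - 1) * l powr k * exp (- ((t + s) / s) * l)"
  proof -
    have "((t + s) / s * l) powr (k - 1) = ((t + s) / s) powr (k - 1) * l powr (k - 1)"
      by (rule powr_mult)
    moreover have "l powr (k - 1) * l = l powr k" using l by (simp add: powr_diff)
    moreover have "- ((t + s) / s * l) = - ((t + s) / s) * l" by simp
    ultimately show ?thesis by (simp add: mult_ac)
  qed
  finally show ?thesis using D by (simp add: l_def)
qed

lemma gamma_cdf_total:
  assumes k: "0 < k"
  shows "((\<lambda>z. integral {0..z} (gamma_density k)) \<longlongrightarrow> 1) at_top" "((\<lambda>z. integral {0..z} (gamma_density k)) \<longlongrightarrow> 0) (at_right 0)"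
    "integral {0..0} (gamma_density k) = 0"
proof -
  let ?G = "density lborel (\<lambda>x. ennreal (gamma_density k x))"
  interpret G: prob_space ?G
    by (rule prob_spaceI) (use gamma_laplace[OF k, of 0] in simp)
  interpret G: real_distribution ?G by unfold_locales simp_all
  have "0 \<le> integral {0..z} (gamma_density k)" for z
    using gamma_density_nonneg[OF k] by (intro integral_nonneg gamma_density_integrable[OF k]) auto
  then have "cdf ?G = (\<lambda>z. integral {0..z} (gamma_density k))"
    by (auto simp: fun_eq_iff cdf_def measure_def gamma_cdf[OF k])
  with G.cdf_lim_at_top_prob show "((\<lambda>z. integral {0..z} (gamma_density k)) \<longlongrightarrow> 1) at_top" by simp
  have "continuous_on {0..1} (\<lambda>z. integral {0..z} (gamma_density k))"
    by (intro indefinite_integral_continuous_1 gamma_density_integrable[OF k])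
  then have "((\<lambda>z. integral {0..z} (gamma_density k)) \<longlongrightarrow> integral {0..0} (gamma_density k)) (at 0 within {0..1})"
    unfolding continuous_on_def by (rule bspec) simp
  then show "((\<lambda>z. integral {0..z} (gamma_density k)) \<longlongrightarrow> 0) (at_right 0)"
    by (simp add: at_within_Icc_at_right)
qed simp

lemma le_image_ratio_iff:
  assumes "0 < s" "0 < a" "0 < t"
  shows "a \<le> image_ratio k s t y \<longleftrightarrow> log_ratio k s a t \<le> y * s / (2 * t * (t + s))"
proof -
  have p: "0 < ((t + s) / t) powr k" using assms by simp
  have "(t / (t + s)) powr k * ((t + s) / t) powr k = (t / (t + s) * ((t + s) / t)) powr k"
    by (rule powr_mult[symmetric])
  also have "t / (t + s) * ((t + s) / t) = 1" using assms by simp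
  finally have PW: "(t / (t + s)) powr k * ((t + s) / t) powr k = 1" by simp
  have "image_ratio k s t y * ((t + s) / t) powr k =
      ((t / (t + s)) powr k * ((t + s) / t) powr k) * exp (y * s / (2 * t * (t + s)))"
    by (simp only: image_ratio_def mult_ac)
  then have e: "image_ratio k s t y * ((t + s) / t) powr k = exp (y * s / (2 * t * (t + s)))"
    unfolding PW by simp
  have "a \<le> image_ratio k s t y \<longleftrightarrow> a * ((t + s) / t) powr k \<le> image_ratio k s t y * ((t + s) / t) powr k"
    using p by simp
  also have "\<dots> \<longleftrightarrow> exp (log_ratio k s a t) \<le> exp (y * s / (2 * t * (t + s)))"
    unfolding e exp_log_ratio[OF assms] ..
  finally show ?thesis by simp
qed

lemma log_ratio_strict_antimono:
  assumes "0 < k" "0 < s" "0 < a" "0 < u" "u < t"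
  shows "log_ratio k s a t < log_ratio k s a u"
proof -
  have "s / t < s / u" using assms by (intro divide_strict_left_mono) auto
  then have "ln (1 + s / t) < ln (1 + s / u)" using assms by (subst ln_less_cancel_iff) (auto intro: add_pos_pos)
  then show ?thesis using assms by (simp add: log_ratio_eq)
qed

text \<open>The domain is where the radicand of \<open>psi\<close> is nonnegative; for
  \<open>a < 1\<close> its right end solves
  \<open>(1 + s / t) powr (\<nu> + 1) = 1 / a\<close>.\<close>

lemma psi_domain_iff:
  assumes k: "0 < \<nu> + 1" and s: "0 < s" and a: "0 < a" and t: "0 < t"
  shows "t \<in> psi_domain \<nu> s a \<longleftrightarrow> 0 \<le> log_ratio (\<nu> + 1) s a t"
proof (cases "a \<ge> 1")
  case True
  have "0 < ln (1 + s / t)" using s t by (intro ln_gt_zero) simp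
  then show ?thesis using True k t a s by (auto simp: psi_domain_def log_ratio_eq intro!: add_nonneg_nonneg)
next
  case False
  define c where "c = (1 / a) powr (1 / (\<nu> + 1))"
  have c: "1 < c" unfolding c_def using False a k by (intro gr_one_powr) auto
  have lnc: "(\<nu> + 1) * ln c = - ln a" using a k by (simp add: c_def ln_powr ln_div)
  have "t \<in> psi_domain \<nu> s a \<longleftrightarrow> t \<le> s / (c - 1)" using False t by (simp add: psi_domain_def c_def)
  also have "\<dots> \<longleftrightarrow> c \<le> 1 + s / t" using c t by (simp add: field_simps)
  also have "\<dots> \<longleftrightarrow> ln c \<le> ln (1 + s / t)" using c s t by (intro ln_le_cancel_iff[symmetric]) (auto intro: add_pos_pos)
  also have "\<dots> \<longleftrightarrow> (\<nu> + 1) * ln c \<le> (\<nu> + 1) * ln (1 + s / t)" using k by simp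
  also have "\<dots> \<longleftrightarrow> 0 \<le> log_ratio (\<nu> + 1) s a t" unfolding lnc log_ratio_eq[OF s a t] by linarith
  finally show ?thesis .
qed

lemma psi_eq:
  assumes "0 < s" "0 < a" "0 < t"
  shows "psi \<nu> s a t = sqrt (2 * t * (t + s) / s * log_ratio (\<nu> + 1) s a t)"
  using assms by (simp add: psi_def log_ratio_eq)

lemma psi_le_iff:
  assumes k: "0 < \<nu> + 1" and s: "0 < s" and a: "0 < a" and t: "0 < t" and "t \<in> psi_domain \<nu> s a" and z: "0 \<le> z"
  shows "psi \<nu> s a t \<le> z \<longleftrightarrow> a \<le> image_ratio (\<nu> + 1) s t (z\<^sup>2)"
proof -
  let ?L = "log_ratio (\<nu> + 1) s a t"
  have L: "0 \<le> ?L" using assms psi_domain_iff by blast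
  have "psi \<nu> s a t \<le> z \<longleftrightarrow> 2 * t * (t + s) / s * ?L \<le> z\<^sup>2"
  proof -
    have "z = sqrt (z\<^sup>2)" using z by simp
    then show ?thesis unfolding psi_eq[OF s a t] by (metis real_sqrt_le_iff)
  qed
  also have "\<dots> \<longleftrightarrow> ?L \<le> z\<^sup>2 * s / (2 * t * (t + s))"
  proof -
    have "q / s * l \<le> w \<longleftrightarrow> l \<le> w * s / q" if "0 < q" for q l w :: real
      using that s by (simp add: field_simps)
    moreover have "0 < 2 * t * (t + s)" using s t by simp
    ultimately show ?thesis .
  qed
  also have "\<dots> \<longleftrightarrow> a \<le> image_ratio (\<nu> + 1) s t (z\<^sup>2)" using le_image_ratio_iff[OF s a t] by simp
  finally show ?thesis .
qed

lemma psi_domain_downward: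
  assumes "t \<in> psi_domain \<nu> s a" "0 \<le> u" "u \<le> t" shows "u \<in> psi_domain \<nu> s a"
  using assms by (auto simp: psi_domain_def split: if_splits)

text \<open>An \<open>r\<close> below \<open>e\<close> encodes the empty intersection. The form of
  an interval is what the measurability of hits on compact intervals asks for.\<close>

lemma psi_domain_inter_Icc:
  assumes "0 < e"
  shows "\<exists>r. {e..t} \<inter> psi_domain \<nu> s a = {e..r}"
proof (cases "a \<ge> 1")
  case True
  with assms have "{e..t} \<inter> psi_domain \<nu> s a = {e..t}" by (auto simp: psi_domain_def)
  then show ?thesis by blast
next
  case False
  with assms have "{e..t} \<inter> psi_domain \<nu> s a = {e..min t (s / ((1 / a) powr (1 / (\<nu> + 1)) - 1))}" by (auto simp: psi_domain_def)
  then show ?thesis by blast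
qed

lemma hitting_density_eq:
  assumes "0 < t" 
  shows "hitting_density \<nu> s a t = 1 / Gamma (\<nu> + 1) * (1 / t) * ((t + s) / s) powr (\<nu> + 1 - 1) *
     log_ratio (\<nu> + 1) s a t powr (\<nu> + 1) * exp (- ((t + s) / s) * log_ratio (\<nu> + 1) s a t) * indicator (psi_domain \<nu> s a) t"
  by (simp add: hitting_density_def log_ratio_def)

lemma hitting_density_nonpos: 
  assumes "0 < s" "0 < \<nu> + 1" "0 < a" "t \<le> 0" shows "hitting_density \<nu> s a t = 0"
proof (cases "t = 0")
  case False
  with assms show ?thesis by (simp add: hitting_density_def psi_domain_def)
\<comment> \<open>At \<open>t = 0\<close> the factor \<open>1 / t\<close> is 0 by the convention for
  division.\<close>
qed (simp add: hitting_density_def)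

lemma hitting_density_nonneg:
  assumes k: "0 < \<nu> + 1" and s: "0 < s" and a: "0 < a"
  shows "0 \<le> hitting_density \<nu> s a t"
proof (cases "0 < t")
  case True
  then show ?thesis using Gamma_real_pos[OF k] by (simp add: hitting_density_def)
qed (use hitting_density_nonpos assms in auto)

lemma hitting_density_measurable[measurable]: "hitting_density \<nu> s a \<in> borel_measurable borel"
proof -
  have [measurable]: "psi_domain \<nu> s a \<in> sets borel" by (simp add: psi_domain_def)
  show ?thesis unfolding hitting_density_def[abs_def] by measurable
qed

text \<open>At the right end of the domain \<open>log_ratio\<close> may be 0, where the derivative
  lemma does not apply. Continuity up to the end allows the fundamental theorem with derivatives in
  the interior only.\<close>

lemma hitting_cdf_continuous:
  assumes k: "0 < k" and s: "0 < s" and a: "0 < a" and e: "0 < e" and L: "0 \<le> log_ratio k s a t"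
  shows "continuous_on {e..t} (hitting_cdf k s a)"
proof -
  have L0: "0 \<le> log_ratio k s a u" if "u \<in> {e..t}" for u
    using log_ratio_strict_antimono[OF k s a, of u t] that e L by (cases "u = t") auto
  have Lc: "continuous_on {e..t} (log_ratio k s a)"
  proof (intro continuous_at_imp_continuous_on ballI)
    fix u assume "u \<in> {e..t}"
    then have "0 < u" using e by simp
    from DERIV_isCont[OF log_ratio_has_derivative[OF s a this]] show "isCont (log_ratio k s a) u" .
  qed
  have C: "continuous_on {0..} (\<lambda>z. integral {0..z} (gamma_density k))"
    unfolding continuous_on_eq_continuous_within
  proof
    fix z :: real assume "z \<in> {0..}"
    have "continuous_on {0..z + 1} (\<lambda>z. integral {0..z} (gamma_density k))"
      by (intro indefinite_integral_continuous_1 gamma_density_integrable[OF k])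
    then have "continuous (at z within {0..z + 1}) (\<lambda>z. integral {0..z} (gamma_density k))"
      using \<open>z \<in> {0..}\<close> by (auto simp: continuous_on_eq_continuous_within)
    moreover have "at z within {0..z + 1} = at z within {0..}"
      by (rule at_within_nhd[of z "{z - 1<..<z + 1}"]) auto
    ultimately show "continuous (at z within {0..}) (\<lambda>z. integral {0..z} (gamma_density k))" by simp
  qed
  show ?thesis
    unfolding hitting_cdf_def
    using a s e L0 by (intro continuous_intros continuous_on_compose2[OF C] Lc) auto
qed

text \<open>As \<open>t\<close> tends to 0 the first threshold grows like \<open>ln (1 / t)\<close>,
  and the second, of order \<open>t * ln (1 / t)\<close>, tends to 0. The limit is therefore 1 - 1 +
  0.\<close>

lemma hitting_cdf_at_0:
  assumes k: "0 < k" and s: "0 < s" and a: "0 < a"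
  shows "(hitting_cdf k s a \<longlongrightarrow> 0) (at_right 0)"
proof -
  have "\<forall>\<^sub>F t in at_right 0. (0::real) < t" by (simp add: eventually_at_right_less)
  then have ev: "\<forall>\<^sub>F t in at_right 0. c t * (k * ln (1 + s / t) + ln a) = c t * log_ratio k s a t" for c
    by eventually_elim (simp add: log_ratio_eq[OF s a])
  have "filterlim (\<lambda>t. (t + s) / s * (k * ln (1 + s / t) + ln a)) at_top (at_right 0)"
    using k s by real_asymp
  also have "?this \<longleftrightarrow> filterlim (\<lambda>t. (t + s) / s * log_ratio k s a t) at_top (at_right 0)"
    by (rule filterlim_cong[OF refl refl ev])
  finally have A: "filterlim (\<lambda>t. (t + s) / s * log_ratio k s a t) at_top (at_right 0)" .
  have "filterlim (\<lambda>t. t / s * (k * ln (1 + s / t) + ln a)) (at_right 0) (at_right 0)"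
    using k s by real_asymp
  also have "?this \<longleftrightarrow> filterlim (\<lambda>t. t / s * log_ratio k s a t) (at_right 0) (at_right 0)"
    by (rule filterlim_cong[OF refl refl ev])
  finally have B: "filterlim (\<lambda>t. t / s * log_ratio k s a t) (at_right 0) (at_right 0)" .
  have "((\<lambda>t. 1 - integral {0..(t + s) / s * log_ratio k s a t} (gamma_density k) + integral {0..t / s * log_ratio k s a t} (gamma_density k) / a)
     \<longlongrightarrow> 1 - 1 + 0 / a) (at_right 0)"
    using a by (intro tendsto_intros filterlim_compose[OF gamma_cdf_total(1)[OF k] A] filterlim_compose[OF gamma_cdf_total(2)[OF k] B]) auto
  then show ?thesis by (simp add: hitting_cdf_def[abs_def])
qed

lemma hitting_density_integral:
  assumes k: "0 < \<nu> + 1" and s: "0 < s" and a: "0 < a" and t: "0 < t" "t \<in> psi_domain \<nu> s a"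
  shows "emeasure (density lborel (\<lambda>x. ennreal (hitting_density \<nu> s a x))) {..t} = ennreal (hitting_cdf (\<nu> + 1) s a t)"
proof -
  let ?N = "density lborel (\<lambda>x. ennreal (hitting_density \<nu> s a x))" and ?F = "hitting_cdf (\<nu> + 1) s a"
  have Lt: "0 \<le> log_ratio (\<nu> + 1) s a t" using psi_domain_iff[OF k s a t(1)] t(2) by simp
  have Icc: "emeasure ?N {e..t} = ennreal (?F t - ?F e)" if e: "0 < e" "e \<le> t" for e
  proof -
    have "(hitting_density \<nu> s a has_integral ?F t - ?F e) {e..t}"
    proof (rule fundamental_theorem_of_calculus_interior[OF e(2)])
      show "continuous_on {e..t} ?F" by (rule hitting_cdf_continuous[OF k s a e(1) Lt])
      fix x assume x: "x \<in> {e<..<t}"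
      then have L: "0 < log_ratio (\<nu> + 1) s a x" using log_ratio_strict_antimono[OF k s a, of x t] e Lt by simp
      have x0: "0 < x" using x e by simp
      have "x \<in> psi_domain \<nu> s a" using psi_domain_downward[OF t(2)] x e by auto
      then show "(?F has_vector_derivative hitting_density \<nu> s a x) (at x)"
        using hitting_cdf_has_derivative[OF k s a x0 L] hitting_density_eq[OF x0, of \<nu> s a]
        by (simp add: has_real_derivative_iff_has_vector_derivative)
    qed
    from nn_integral_has_integral_lebesgue'[OF hitting_density_nonneg[OF k s a] this]
    show ?thesis by (subst emeasure_density) auto
  qed
  \<comment> \<open>The density is handled as an improper integral at 0: compact intervals exhaust
    the range, and \<open>hitting_cdf_at_0\<close> removes the lower boundary term.\<close>
  define e where "e n = t / real (Suc n)" for n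
  have e: "0 < e n" "e n \<le> t" for n using t by (auto simp: e_def field_simps)
  have elim: "filterlim e (at_right 0) sequentially"
  proof -
    have "(\<lambda>n. t * (1 / real (Suc n))) \<longlonglongrightarrow> t * 0" by (intro tendsto_intros LIMSEQ_Suc[OF lim_1_over_n])
    then have "e \<longlonglongrightarrow> 0" by (simp add: e_def[abs_def])
    moreover have "e n \<noteq> 0" for n using e(1)[of n] by simp
    ultimately show ?thesis using e by (simp add: filterlim_at)
  qed
  have "(\<lambda>n. emeasure ?N {e n..t}) \<longlonglongrightarrow> emeasure ?N (\<Union>n. {e n..t})"
  proof (rule Lim_emeasure_incseq)
    have "e n \<le> e m" if "m \<le> n" for m n unfolding e_def using that t by (intro divide_left_mono) auto
    then show "incseq (\<lambda>n. {e n..t})" by (auto simp: incseq_def)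
  qed auto
  moreover have "(\<Union>n. {e n..t}) = {0<..t}"
  proof (intro set_eqI iffI)
    fix x assume x: "x \<in> {0<..t}"
    then have "\<forall>\<^sub>F n in sequentially. e n < x"
      using elim by (intro order_tendstoD(2)[of e 0]) (auto simp: filterlim_at)
    then obtain n where "e n < x" by (auto simp: eventually_sequentially)
    with x show "x \<in> (\<Union>n. {e n..t})" by (auto intro!: exI[of _ n])
  qed (use e(1) in \<open>auto intro: less_le_trans\<close>)
  moreover have "(\<lambda>n. emeasure ?N {e n..t}) \<longlonglongrightarrow> ennreal (?F t - 0)"
    unfolding Icc[OF e] by (intro tendsto_intros filterlim_compose[OF hitting_cdf_at_0[OF k s a] elim])
  ultimately have "emeasure ?N {0<..t} = ennreal (?F t)" by (metis LIMSEQ_unique diff_zero)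
  moreover have "emeasure ?N {..t} = emeasure ?N {0<..t}"
    using hitting_density_nonpos[OF s k a]
    by (simp add: emeasure_density) (intro nn_integral_cong, auto simp: indicator_def not_less)
  ultimately show ?thesis by simp
qed

subsection \<open>The law of the hitting time\<close>

context squared_bessel_setting
begin

lemma Y_cdf:
  assumes t: "0 < t"
  shows "prob {\<omega>\<in>space M. Y t \<omega> / (2 * t) < z} = integral {0..z} (gamma_density (\<delta> / 2))"
proof -
  have [measurable]: "Y t \<in> borel_measurable M" using Y_measurable t by simp
  have k: "0 < \<delta> / 2" using \<delta>_pos by simp
  have "emeasure M {\<omega>\<in>space M. Y t \<omega> / (2 * t) < z} = emeasure (distr M borel (\<lambda>\<omega>. Y t \<omega> / (2 * t))) {..<z}"
    by (subst emeasure_distr) (auto intro!: arg_cong[where f = "emeasure M"])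
  also have "\<dots> = ennreal (integral {0..z} (gamma_density (\<delta> / 2)))"
    unfolding Y_gamma[OF t] by (rule gamma_cdf(2)[OF k])
  finally show ?thesis
    using gamma_density_nonneg[OF k] gamma_density_integrable(1)[OF k, of z]
    by (simp add: measure_def integral_nonneg)
qed

lemma hit_probability_cdf:
  assumes s: "0 < s" and a: "0 < a" and t: "0 < t"
  shows "prob {\<omega>\<in>space M. \<exists>u\<in>{0<..t}. a \<le> R s u \<omega>} = hitting_cdf (\<delta> / 2) s a t"
proof -
  let ?L = "log_ratio (\<delta> / 2) s a t"
  have [measurable]: "Y t \<in> borel_measurable M" using Y_measurable t by simp
  have "a \<le> R s t \<omega> \<longleftrightarrow> \<not> Y t \<omega> / (2 * t) < (t + s) / s * ?L" for \<omega>
  proof -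
    have "Y t \<omega> * s / (2 * t * (t + s)) = Y t \<omega> / (2 * t) / ((t + s) / s)" using s t by simp
    then have "a \<le> R s t \<omega> \<longleftrightarrow> ?L \<le> Y t \<omega> / (2 * t) / ((t + s) / s)"
      using le_image_ratio_iff[OF s a t] by simp
    also have "\<dots> \<longleftrightarrow> ?L * ((t + s) / s) \<le> Y t \<omega> / (2 * t)"
      using s t by (intro pos_le_divide_eq) simp
    finally show ?thesis by (simp only: mult.commute not_less)
  qed
  then have "{\<omega>\<in>space M. a \<le> R s t \<omega>} = space M - {\<omega>\<in>space M. Y t \<omega> / (2 * t) < (t + s) / s * ?L}"
    by auto
  then have 1: "prob {\<omega>\<in>space M. a \<le> R s t \<omega>} = 1 - integral {0..(t + s) / s * ?L} (gamma_density (\<delta> / 2))"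
    by (simp add: prob_compl Y_cdf[OF t, symmetric])
  have ts: "0 < t + s" using s t by simp
  have "R' s t \<omega> < a \<longleftrightarrow> Y (t + s) \<omega> / (2 * (t + s)) < t / s * ?L" for \<omega>
  proof -
    have "R' s t \<omega> < a \<longleftrightarrow> Y (t + s) \<omega> * s / (2 * t * (t + s)) < ?L"
      using le_image_ratio_iff[OF s a t, of "\<delta> / 2" "Y (t + s) \<omega>"] by linarith
    also have "Y (t + s) \<omega> * s / (2 * t * (t + s)) = Y (t + s) \<omega> / (2 * (t + s)) / (t / s)"
      using s t by simp
    also have "\<dots> < ?L \<longleftrightarrow> Y (t + s) \<omega> / (2 * (t + s)) < ?L * (t / s)"
      using s t by (intro pos_divide_less_eq) simp
    finally show ?thesis by (simp only: mult.commute)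
  qed
  then have 2: "prob {\<omega>\<in>space M. R' s t \<omega> < a} = integral {0..t / s * ?L} (gamma_density (\<delta> / 2))"
    using Y_cdf[OF ts] by simp
  show ?thesis
    unfolding hit_probability[OF s a t] 1 2 hitting_cdf_def ..
qed

context
  fixes Z :: "real \<Rightarrow> 'a \<Rightarrow> real" and \<nu> s a :: real
  assumes \<nu>: "\<delta> = 2 * \<nu> + 2" and s: "0 < s" and a: "0 < a"
    and Z_adapted: "adapted (\<lambda>_. M) Z" and Z_paths: "continuous_paths M Z"
    and Z: "AE \<omega> in M. \<forall>t\<ge>0. 0 \<le> Z t \<omega> \<and> (Z t \<omega>)\<^sup>2 = Y t \<omega>"
begin

abbreviation \<tau> :: "'a \<Rightarrow> ereal" where
  "\<tau> \<equiv> hitting_time (psi_domain \<nu> s a) (psi \<nu> s a) Z"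

lemma \<nu>_pos: "0 < \<nu> + 1" and \<nu>_eq: "\<delta> / 2 = \<nu> + 1"
  using \<nu> \<delta>_pos by auto

lemma \<tau>_nonneg: "0 \<le> \<tau> \<omega>"
  unfolding hitting_time_def by (auto intro!: Inf_greatest)

lemma psi_continuous: "0 < e \<Longrightarrow> continuous_on {e..r} (psi \<nu> s a)"
proof -
  assume e: "0 < e"
  have "continuous_on {e..r} (\<lambda>t. sqrt (2 * t * (t + s) / s * ((\<nu> + 1) * ln (1 + s / t) + ln a)))"
  proof (intro continuous_intros ballI)
    fix t assume "t \<in> {e..r}"
    then have "0 < 1 + s / t" using e s by (intro add_pos_pos) auto
    then show "1 + s / t \<noteq> 0" by simp
  qed (use e s in auto)
  then show ?thesis
    by (rule continuous_on_eq) (use e in \<open>auto simp: psi_def\<close>)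
qed

lemma psi_hit_sets:
  assumes e: "0 < e"
  shows "{\<omega>\<in>space M. \<exists>u\<in>{e..q} \<inter> psi_domain \<nu> s a. psi \<nu> s a u \<le> Z u \<omega>} \<in> sets M"
proof -
  obtain r where r: "{e..q} \<inter> psi_domain \<nu> s a = {e..r}" using psi_domain_inter_Icc[OF e] by blast
  have "{\<omega>\<in>space M. \<exists>u\<in>{e..r}. 0 \<le> Z u \<omega> - psi \<nu> s a u} \<in> sets M"
  proof (rule sets_Collect_ex_ge)
    show "continuous_on {e..r} (\<lambda>t. Z t \<omega> - psi \<nu> s a t)" if "\<omega> \<in> space M" for \<omega>
      using that Z_paths e
      by (intro continuous_intros psi_continuous) (auto simp: continuous_paths_def intro: continuous_on_subset)
    fix t assume "t \<in> {e..r}"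
    then have [measurable]: "Z t \<in> borel_measurable M" using Z_adapted e by (simp add: adapted_def)
    show "(\<lambda>\<omega>. Z t \<omega> - psi \<nu> s a t) \<in> borel_measurable M" by measurable
  qed
  then show ?thesis unfolding r by simp
qed

text \<open>An infimum below \<open>y\<close> is witnessed by one hit before \<open>y\<close>. A
  rational \<open>q\<close> above the witness and some \<open>1 / real (Suc j)\<close> below it
  enclose it in one of countably many compact windows.\<close>

lemma \<tau>_measurable: "\<tau> \<in> borel_measurable M"
proof (rule borel_measurableI_less)
  fix y :: ereal
  have "{\<omega>\<in>space M. \<tau> \<omega> < y} = (\<Union>q\<in>{q\<in>\<rat>. ereal q < y}. \<Union>j::nat. 
     {\<omega>\<in>space M. \<exists>u\<in>{1 / real (Suc j)..q} \<inter> psi_domain \<nu> s a. psi \<nu> s a u \<le> Z u \<omega>})"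
  proof (intro set_eqI iffI)
    fix \<omega> assume "\<omega> \<in> {\<omega>\<in>space M. \<tau> \<omega> < y}"
    then obtain u where \<omega>: "\<omega> \<in> space M" and u: "u \<in> psi_domain \<nu> s a" "0 < u" "psi \<nu> s a u \<le> Z u \<omega>" "ereal u < y"
      by (auto simp: hitting_time_def Inf_less_iff)
    obtain q where q: "q \<in> \<rat>" "u \<le> q" "ereal q < y"
    proof (cases y)
      case (real r)
      with u(4) have "u < r" by simp
      from Rats_dense_in_real[OF this] that real show ?thesis by auto
    next
      case PInf
      have "u < u + 1" by simp
      from Rats_dense_in_real[OF this] that PInf show ?thesis by auto
    qed (use u(4) in simp)
    obtain j where "inverse (real (Suc j)) < u" using reals_Archimedean u(2) by blast
    with \<omega> u q show "\<omega> \<in> (\<Union>q\<in>{q\<in>\<rat>. ereal q < y}. \<Union>j::nat. 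
     {\<omega>\<in>space M. \<exists>u\<in>{1 / real (Suc j)..q} \<inter> psi_domain \<nu> s a. psi \<nu> s a u \<le> Z u \<omega>})"
      by (intro UN_I[of q] UN_I[of j]) (auto simp: inverse_eq_divide intro!: bexI[of _ u])
  next
    fix \<omega> assume "\<omega> \<in> (\<Union>q\<in>{q\<in>\<rat>. ereal q < y}. \<Union>j::nat. 
     {\<omega>\<in>space M. \<exists>u\<in>{1 / real (Suc j)..q} \<inter> psi_domain \<nu> s a. psi \<nu> s a u \<le> Z u \<omega>})"
    then obtain q j u where *: "\<omega> \<in> space M" "ereal q < y" "1 / real (Suc j) \<le> u" "u \<le> q"
      "u \<in> psi_domain \<nu> s a" "psi \<nu> s a u \<le> Z u \<omega>" by (auto simp del: of_nat_Suc)
    have "0 < 1 / real (Suc j)" by simp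
    then have "0 < u" using *(3) by (rule less_le_trans)
    moreover have "ereal u < y" using *(2,4) by (meson ereal_less_eq(3) le_less_trans)
    ultimately show "\<omega> \<in> {\<omega>\<in>space M. \<tau> \<omega> < y}" using * by (auto simp: hitting_time_def Inf_less_iff)
  qed
  also have "\<dots> \<in> sets M"
  proof (intro sets.countable_UN' sets.countable_UN image_subsetI)
    show "countable {q \<in> \<rat>. ereal q < y}" by (rule countable_subset[OF _ countable_rat]) auto
    show "{\<omega>\<in>space M. \<exists>u\<in>{1 / real (Suc j)..q} \<inter> psi_domain \<nu> s a. psi \<nu> s a u \<le> Z u \<omega>} \<in> sets M" for q j
      by (rule psi_hit_sets) (simp del: of_nat_Suc)
  qed simp
  finally show "{\<omega>\<in>space M. \<tau> \<omega> < y} \<in> sets M" .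
qed

text \<open>The delicate direction is from the infimum to an actual hit: hits might accumulate at
  \<open>t\<close> from the right. If there is no hit up to \<open>t\<close>, then \<open>R\<close>
  is below \<open>a\<close> at \<open>t\<close> and, by continuity, on a short interval after
  it.\<close>

lemma \<tau>_le_iff:
  assumes \<omega>: "\<omega> \<in> space M" and Z\<omega>: "\<forall>t\<ge>0. 0 \<le> Z t \<omega> \<and> (Z t \<omega>)\<^sup>2 = Y t \<omega>"
    and t: "0 < t" "t \<in> psi_domain \<nu> s a"
  shows "\<tau> \<omega> \<le> ereal t \<longleftrightarrow> (\<exists>u\<in>{0<..t}. a \<le> R s u \<omega>)"
proof -
  have hit: "psi \<nu> s a u \<le> Z u \<omega> \<longleftrightarrow> a \<le> R s u \<omega>" if "0 < u" "u \<in> psi_domain \<nu> s a" for u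
    using psi_le_iff[OF \<nu>_pos s a that, of "Z u \<omega>"] Z\<omega> that(1) unfolding \<nu>_eq by simp
  show ?thesis
  proof
    assume "\<exists>u\<in>{0<..t}. a \<le> R s u \<omega>"
    then obtain u where u: "0 < u" "u \<le> t" "a \<le> R s u \<omega>" by auto
    then have uS: "u \<in> psi_domain \<nu> s a" using psi_domain_downward[OF t(2)] by simp
    then have "\<tau> \<omega> \<le> ereal u" unfolding hitting_time_def using u hit by (intro Inf_lower) auto
    then show "\<tau> \<omega> \<le> ereal t" using u(2) by (meson ereal_less_eq(3) order_trans)
  next
    assume \<tau>: "\<tau> \<omega> \<le> ereal t"
    show "\<exists>u\<in>{0<..t}. a \<le> R s u \<omega>"
    proof (rule ccontr)
      assume no: "\<not> (\<exists>u\<in>{0<..t}. a \<le> R s u \<omega>)"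
      then have "R s t \<omega> < a" using t by (auto simp: not_le)
      moreover have "continuous_on {t..t + 1} (\<lambda>u. R s u \<omega>)" by (rule R_continuous[OF s \<omega> t(1)])
      then have "((\<lambda>u. R s u \<omega>) \<longlongrightarrow> R s t \<omega>) (at t within {t..t + 1})" by (auto simp: continuous_on_def)
      ultimately have "\<forall>\<^sub>F u in at t within {t..t + 1}. R s u \<omega> < a" by (intro order_tendstoD(2))
      then obtain d where d: "0 < d" "\<And>u. u \<in> {t..t + 1} \<Longrightarrow> u \<noteq> t \<Longrightarrow> dist u t < d \<Longrightarrow> R s u \<omega> < a"
        unfolding eventually_at by auto
      \<comment> \<open>The minimum with 1 stays in the interval on which continuity was
        used.\<close>
      have "ereal (t + min d 1) \<le> \<tau> \<omega>"
        unfolding hitting_time_def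
      proof (rule Inf_greatest)
        fix x assume "x \<in> ereal ` {t \<in> psi_domain \<nu> s a. 0 < t \<and> psi \<nu> s a t \<le> Z t \<omega>}"
        then obtain u where u: "x = ereal u" "0 < u" "a \<le> R s u \<omega>" using hit by auto
        with no have "t < u" by force
        then have "t + min d 1 \<le> u" using d(2)[of u] u(3) by (force simp: dist_real_def)
        then show "ereal (t + min d 1) \<le> x" using u by simp
      qed
      with \<tau> have "ereal (t + min d 1) \<le> ereal t" by (rule order_trans[rotated])
      then show False using d(1) by simp
    qed
  qed
qed

lemma \<tau>_cdf:
  assumes t: "0 < t" "t \<in> psi_domain \<nu> s a"
  shows "emeasure M {\<omega>\<in>space M. \<tau> \<omega> \<le> ereal t} = ennreal (hitting_cdf (\<nu> + 1) s a t)"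
proof -
  note [measurable] = \<tau>_measurable R_hit_sets'[OF s]
  have "emeasure M {\<omega>\<in>space M. \<tau> \<omega> \<le> ereal t} = emeasure M {\<omega>\<in>space M. \<exists>u\<in>{0<..t}. a \<le> R s u \<omega>}"
  proof (rule emeasure_eq_AE)
    show "AE \<omega> in M. \<omega> \<in> {\<omega>\<in>space M. \<tau> \<omega> \<le> ereal t} \<longleftrightarrow> \<omega> \<in> {\<omega>\<in>space M. \<exists>u\<in>{0<..t}. a \<le> R s u \<omega>}"
      using Z AE_space by eventually_elim (use \<tau>_le_iff t in auto)
  qed measurable
  then show ?thesis
    using hit_probability_cdf[OF s a t(1)] by (simp add: emeasure_eq_measure \<nu>_eq)
qed

lemma \<tau>_le_eq_density:
  "emeasure M {\<omega>\<in>space M. \<tau> \<omega> \<le> ereal t} = emeasure (density lborel (\<lambda>x. ennreal (hitting_density \<nu> s a x))) {..t}"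
proof -
  note [measurable] = \<tau>_measurable
  let ?N = "density lborel (\<lambda>x. ennreal (hitting_density \<nu> s a x))"
  consider "0 < t" "t \<in> psi_domain \<nu> s a" | "0 < t" "t \<notin> psi_domain \<nu> s a" | "t \<le> 0" by linarith
  then show ?thesis
  proof cases
    case 1
    then show ?thesis using \<tau>_cdf hitting_density_integral[OF \<nu>_pos s a] by simp
  next
    case 2
    \<comment> \<open>For \<open>t\<close> beyond the right end \<open>r\<close> of the domain the
      boundary has come down to 0 at \<open>r\<close>, so every nonnegative path has hit by then,
      and the density carries its full mass on the domain.\<close>
    define r where "r = s / ((1 / a) powr (1 / (\<nu> + 1)) - 1)"
    have a1: "a < 1" using 2 by (auto simp: psi_domain_def split: if_splits)
    then have c: "1 < (1 / a) powr (1 / (\<nu> + 1))" using a \<nu>_pos by (intro gr_one_powr) auto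
    have r0: "0 < r" using c s by (simp add: r_def)
    have S: "psi_domain \<nu> s a = {0..r}" using a1 by (simp add: psi_domain_def r_def)
    have rt: "r < t" using 2 S by simp
    have rS: "r \<in> psi_domain \<nu> s a" using r0 S by simp
    \<comment> \<open>Otherwise continuity would make \<open>log_ratio\<close> positive slightly
      beyond \<open>r\<close>, and the domain would reach further.\<close>
    have "\<not> 0 < log_ratio (\<nu> + 1) s a r"
    proof
      assume "0 < log_ratio (\<nu> + 1) s a r"
      moreover have "isCont (log_ratio (\<nu> + 1) s a) r" by (rule DERIV_isCont[OF log_ratio_has_derivative[OF s a r0]])
      ultimately have "\<forall>\<^sub>F x in at r. 0 < log_ratio (\<nu> + 1) s a x" by (intro order_tendstoD(1)) (auto simp: isCont_def)
      then have "\<forall>\<^sub>F x in at_right r. 0 < log_ratio (\<nu> + 1) s a x \<and> r < x"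
        by (auto simp: eventually_at_split eventually_at_right_less intro: eventually_conj)
      from eventually_happens'[OF trivial_limit_at_right_real this]
      obtain x where "0 < log_ratio (\<nu> + 1) s a x" "r < x" by blast
      then have "x \<in> psi_domain \<nu> s a" using psi_domain_iff[OF \<nu>_pos s a, of x] r0 by simp
      then show False using S \<open>r < x\<close> by simp
    qed
    then have L0: "log_ratio (\<nu> + 1) s a r = 0" using psi_domain_iff[OF \<nu>_pos s a r0] rS by simp
    have "emeasure M {\<omega>\<in>space M. \<tau> \<omega> \<le> ereal t} = 1"
    proof (rule emeasure_eq_1_AE)
      show "AE \<omega> in M. \<omega> \<in> {\<omega>\<in>space M. \<tau> \<omega> \<le> ereal t}"
        using Z AE_space
      proof eventually_elim
        fix \<omega> assume "\<forall>t\<ge>0. 0 \<le> Z t \<omega> \<and> (Z t \<omega>)\<^sup>2 = Y t \<omega>" and \<omega>: "\<omega> \<in> space M"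
        then have "psi \<nu> s a r \<le> Z r \<omega>" using r0 psi_eq[OF s a r0] L0 by simp
        then have "\<tau> \<omega> \<le> ereal r" unfolding hitting_time_def using rS r0 by (intro Inf_lower) auto
        then show "\<omega> \<in> {\<omega>\<in>space M. \<tau> \<omega> \<le> ereal t}" using \<omega> rt by (auto intro: order_trans[of _ "ereal r"])
      qed
    qed measurable
    also have "1 = ennreal (hitting_cdf (\<nu> + 1) s a r)" by (simp add: hitting_cdf_def L0)
    also have "\<dots> = emeasure ?N {..r}" by (rule hitting_density_integral[OF \<nu>_pos s a r0 rS, symmetric])
    also have "\<dots> = emeasure ?N {..t}"
    proof -
      have "hitting_density \<nu> s a x = 0" if "r < x" for x using that S by (simp add: hitting_density_def)
      then show ?thesis
        using rt by (simp add: emeasure_density) (intro nn_integral_cong, auto simp: indicator_def)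
    qed
    finally show ?thesis .
  next
    case 3
    \<comment> \<open>For every small \<open>e > 0\<close> the event is contained in the one that
      \<tau> is at most \<open>e\<close>, whose probability tends to 0 with \<open>e\<close>. In
      particular \<tau> has no atom at 0.\<close>
    have "emeasure M {\<omega>\<in>space M. \<tau> \<omega> \<le> ereal t} \<le> ennreal 0"
    proof (rule tendsto_lowerbound)
      show "((\<lambda>e. ennreal (hitting_cdf (\<nu> + 1) s a e)) \<longlongrightarrow> ennreal 0) (at_right 0)"
        by (intro tendsto_intros hitting_cdf_at_0[OF \<nu>_pos s a])
      obtain r where r: "0 < r" "r \<in> psi_domain \<nu> s a"
      proof (cases "a \<ge> 1")
        case True
        then show ?thesis using that[of 1] by (simp add: psi_domain_def)
      next
        case False
        have "1 < (1 / a) powr (1 / (\<nu> + 1))" using False a \<nu>_pos by (intro gr_one_powr) auto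
        then show ?thesis using False s that[of "s / ((1 / a) powr (1 / (\<nu> + 1)) - 1)"] by (simp add: psi_domain_def)
      qed
      have "\<forall>\<^sub>F e in at_right 0. e \<in> {0<..<r}" using r by (intro eventually_at_right_real)
      then show "\<forall>\<^sub>F e in at_right 0. emeasure M {\<omega>\<in>space M. \<tau> \<omega> \<le> ereal t} \<le> ennreal (hitting_cdf (\<nu> + 1) s a e)"
      proof eventually_elim
        fix e assume e: "e \<in> {0<..<r}"
        then have "0 < e" "e \<in> psi_domain \<nu> s a" using psi_domain_downward[OF r(2)] by auto
        then have E: "emeasure M {\<omega>\<in>space M. \<tau> \<omega> \<le> ereal e} = ennreal (hitting_cdf (\<nu> + 1) s a e)" by (rule \<tau>_cdf)
        have "t \<le> e" using 3 e by simp
        then show "emeasure M {\<omega>\<in>space M. \<tau> \<omega> \<le> ereal t} \<le> ennreal (hitting_cdf (\<nu> + 1) s a e)"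
          unfolding E[symmetric] by (intro emeasure_mono) (auto intro: order_trans[of _ "ereal t"])
      qed
    qed (simp add: trivial_limit_at_right_real)
    moreover have "emeasure ?N {..t} = 0"
    proof -
      have "emeasure ?N {..t} = (\<integral>\<^sup>+x. ennreal (hitting_density \<nu> s a x) * indicator {..t} x \<partial>lborel)"
        by (subst emeasure_density) auto
      also have "\<dots> = (\<integral>\<^sup>+x. 0 \<partial>(lborel :: real measure))"
      proof (rule nn_integral_cong)
        fix x
        show "ennreal (hitting_density \<nu> s a x) * indicator {..t} x = 0"
          using 3 hitting_density_nonpos[OF s \<nu>_pos a, of x] by (cases "x \<le> t") auto
      qed
      finally show ?thesis by simp
    qed
    ultimately show ?thesis by simp
  qed
qed

lemma \<tau>_law:
  assumes A: "A \<in> sets borel"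
  shows "emeasure M {\<omega>\<in>space M. \<tau> \<omega> \<in> ereal ` A} = (\<integral>\<^sup>+t\<in>A. ennreal (hitting_density \<nu> s a t) \<partial>lborel)"
proof -
  note [measurable] = \<tau>_measurable
  let ?N = "density lborel (\<lambda>x. ennreal (hitting_density \<nu> s a x))"
  \<comment> \<open>The restriction to finite \<tau> comes before the conversion to reals:
    \<open>real_of_ereal\<close> sends infinity to 0 and would create an atom there.\<close>
  define N where "N = distr (density M (indicator {\<omega>\<in>space M. \<tau> \<omega> < \<infinity>})) borel (\<lambda>\<omega>. real_of_ereal (\<tau> \<omega>))"
  have N: "emeasure N A = emeasure M {\<omega>\<in>space M. \<tau> \<omega> \<in> ereal ` A}" if [measurable]: "A \<in> sets borel" for A
  proof -
    have set: "{\<omega>\<in>space M. \<tau> \<omega> < \<infinity>} \<inter> ((\<lambda>\<omega>. real_of_ereal (\<tau> \<omega>)) -` A \<inter> space M) = {\<omega>\<in>space M. \<tau> \<omega> \<in> ereal ` A}"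
    proof (intro set_eqI iffI)
      fix \<omega> assume *: "\<omega> \<in> {\<omega>\<in>space M. \<tau> \<omega> < \<infinity>} \<inter> ((\<lambda>\<omega>. real_of_ereal (\<tau> \<omega>)) -` A \<inter> space M)"
      then have "\<tau> \<omega> = ereal (real_of_ereal (\<tau> \<omega>))" using \<tau>_nonneg[of \<omega>] by (cases "\<tau> \<omega>") auto
      with * show "\<omega> \<in> {\<omega>\<in>space M. \<tau> \<omega> \<in> ereal ` A}" by blast
    qed auto
    have "emeasure N A = emeasure (density M (indicator {\<omega>\<in>space M. \<tau> \<omega> < \<infinity>})) ((\<lambda>\<omega>. real_of_ereal (\<tau> \<omega>)) -` A \<inter> space M)"
      unfolding N_def by (subst emeasure_distr) auto
    also have "\<dots> = emeasure M ({\<omega>\<in>space M. \<tau> \<omega> < \<infinity>} \<inter> ((\<lambda>\<omega>. real_of_ereal (\<tau> \<omega>)) -` A \<inter> space M))"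
      by (rule emeasure_restricted) auto
    finally show ?thesis unfolding set .
  qed
  have atMost: "emeasure N {..t} = emeasure ?N {..t}" for t
  proof -
    have "\<tau> \<omega> \<in> ereal ` {..t} \<longleftrightarrow> \<tau> \<omega> \<le> ereal t" for \<omega>
      using \<tau>_nonneg[of \<omega>] by (cases "\<tau> \<omega>") auto
    then show ?thesis using \<tau>_le_eq_density by (simp add: N)
  qed
  have "N = ?N"
  \<comment> \<open>Closed half lines are stable under intersection and generate the Borel sets, so
    the distribution functions determine both measures.\<close>
  proof (rule measure_eqI_generator_eq[where E = "range (\<lambda>t. {..t})" and \<Omega> = UNIV and A = "\<lambda>i::nat. {..real i}"])
    show "Int_stable (range (\<lambda>t::real. {..t}))" by (auto simp: Int_stable_def)
    show "emeasure N X = emeasure ?N X" if "X \<in> range (\<lambda>t. {..t})" for X using that atMost by auto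
    show "sets N = sigma_sets UNIV (range (\<lambda>t. {..t}))" "sets ?N = sigma_sets UNIV (range (\<lambda>t. {..t}))"
      by (auto simp: N_def borel_eq_atMost)
    show "(\<Union>i::nat. {..real i}) = UNIV" using real_arch_simple by auto
    show "emeasure N {..real i} \<noteq> \<infinity>" for i by (simp add: N emeasure_eq_measure)
  qed auto
  then have "emeasure N A = (\<integral>\<^sup>+t\<in>A. ennreal (hitting_density \<nu> s a t) \<partial>lborel)"
    using A by (simp add: emeasure_density)
  then show ?thesis using N[OF A] by simp
qed

end
end

theorem proposition2p3:
  fixes M :: "'a measure" and Z :: "real \<Rightarrow> 'a \<Rightarrow> real" and \<delta> \<nu> s a :: real
  assumes "\<delta> = 2 * \<nu> + 2" and "\<delta> > 0" and "s > 0" and "a > 0"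
    and "prob_space M"
    and "bessel_process M \<delta> 0 Z"
  defines "\<tau> \<equiv> hitting_time (psi_domain \<nu> s a) (psi \<nu> s a) Z"
  shows "\<tau> \<in> borel_measurable M \<and>
    (\<forall>A\<in>sets borel. emeasure M {\<omega>\<in>space M. \<tau> \<omega> \<in> ereal ` A} =
       (\<integral>\<^sup>+t\<in>A. ennreal (hitting_density \<nu> s a t) \<partial>lborel))"
proof -
  from \<open>bessel_process M \<delta> 0 Z\<close> obtain F B Y where
    Z: "adapted (\<lambda>_. M) Z" "continuous_paths M Z" and filt: "filtration_on M F" and bm: "brownian_motion M F B"
    and Y: "squared_bessel_process M F B \<delta> (0\<^sup>2) Y"
    and ZY: "AE \<omega> in M. \<forall>t\<ge>0. 0 \<le> Z t \<omega> \<and> (Z t \<omega>)\<^sup>2 = Y t \<omega>"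
    unfolding bessel_process_def by blast
  from Y obtain I where Y': "adapted F Y" "continuous_paths M Y" "AE \<omega> in M. Y 0 \<omega> = 0"
    and I: "ito_integral M F B (\<lambda>t \<omega>. 2 * sqrt \<bar>Y t \<omega>\<bar>) I"
    and eq: "AE \<omega> in M. \<forall>t\<ge>0. Y t \<omega> = Y 0 \<omega> + \<delta> * t + I t \<omega>"
    unfolding squared_bessel_process_def by auto
  interpret prob_space M by fact
  \<comment> \<open>Almost surely \<open>Y t\<close> is the square of \<open>Z t\<close> for all
    \<open>t >= 0\<close>, so taking absolute values preserves the equation.\<close>
  interpret squared_bessel_setting M F B "\<lambda>t \<omega>. \<bar>Y t \<omega>\<bar>" I \<delta>
  proof
    show "filtration_on M F" "brownian_motion M F B" "0 < \<delta>" by fact+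
    show "adapted F (\<lambda>t \<omega>. \<bar>Y t \<omega>\<bar>)" "continuous_paths M (\<lambda>t \<omega>. \<bar>Y t \<omega>\<bar>)"
      using Y' by (auto simp: adapted_def continuous_paths_def intro: continuous_on_rabs)
    show "AE \<omega> in M. \<bar>Y 0 \<omega>\<bar> = 0" using Y'(3) by simp
    show "ito_integral M F B (\<lambda>t \<omega>. 2 * sqrt \<bar>Y t \<omega>\<bar>) I" by (rule I)
    show "AE \<omega> in M. \<forall>t\<ge>0. \<bar>Y t \<omega>\<bar> = \<bar>Y 0 \<omega>\<bar> + \<delta> * t + I t \<omega>"
      using eq ZY
    proof eventually_elim
      fix \<omega> assume e: "\<forall>t\<ge>0. Y t \<omega> = Y 0 \<omega> + \<delta> * t + I t \<omega>" and z: "\<forall>t\<ge>0. 0 \<le> Z t \<omega> \<and> (Z t \<omega>)\<^sup>2 = Y t \<omega>"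
      have abs: "\<bar>Y t \<omega>\<bar> = Y t \<omega>" if "0 \<le> t" for t
      proof -
        have "Y t \<omega> = (Z t \<omega>)\<^sup>2" using z that by simp
        then show ?thesis by simp
      qed
      show "\<forall>t\<ge>0. \<bar>Y t \<omega>\<bar> = \<bar>Y 0 \<omega>\<bar> + \<delta> * t + I t \<omega>"
      proof (intro allI impI)
        fix t :: real assume t: "0 \<le> t"
        show "\<bar>Y t \<omega>\<bar> = \<bar>Y 0 \<omega>\<bar> + \<delta> * t + I t \<omega>"
          unfolding abs[OF t] abs[OF order_refl] using e t by blast
      qed
    qed
  qed simp
  have ZY': "AE \<omega> in M. \<forall>t\<ge>0. 0 \<le> Z t \<omega> \<and> (Z t \<omega>)\<^sup>2 = \<bar>Y t \<omega>\<bar>"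
    using ZY
  proof eventually_elim
    fix \<omega> assume z: "\<forall>t\<ge>0. 0 \<le> Z t \<omega> \<and> (Z t \<omega>)\<^sup>2 = Y t \<omega>"
    have "\<bar>Y t \<omega>\<bar> = Y t \<omega>" if "0 \<le> t" for t
    proof -
      have "Y t \<omega> = (Z t \<omega>)\<^sup>2" using z that by simp
      then show ?thesis by simp
    qed
    then show "\<forall>t\<ge>0. 0 \<le> Z t \<omega> \<and> (Z t \<omega>)\<^sup>2 = \<bar>Y t \<omega>\<bar>" using z by simp
  qed
  note facts = \<open>\<delta> = 2 * \<nu> + 2\<close> \<open>s > 0\<close> \<open>a > 0\<close> Z ZY'
  show ?thesis
    unfolding \<tau>_def by (intro conjI ballI \<tau>_measurable[OF facts] \<tau>_law[OF facts])
qed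

end
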